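(* Let $r\ge 2$ be an integer, and let $F$ be a finite $r$-graph with $e(F)>0$ and no isolated vertices. (1) A possibly infinite family of $F$-coloured finite $r$-graphs is $F$-abundant if and only if it contains an $F$-abundant member. (2) A possibly infinite family of finite $r$-graphs is $F$-abundant if and only if it contains an $F$-abundant member.
   Context: An $r$-graph is a finite simple $r$-uniform hypergraph $H$ with vertex set $V(H)$ and edge set $E(H)\subseteq\binom{V(H)}{r}$; $v(H)=|V(H)|$, $e(H)=|E(H)|$. A vertex is isolated if it lies in no edge. A homomorphism $H\to G$ is a map $\phi:V(H)\to V(G)$ with $\phi(e)\in E(G)$ for every $e\in E(H)$; an embedding is an injective homomorphism. $\mathrm{Emb}(H,G)$ is the number of embeddings of $H$ into $G$. Copies are not required to be induced; $G$ is $F$-free if there is no embedding of $F$ into $G$. Farness. An $n$-vertex $r$-graph $G$ is $\varepsilon$-far from being $F$-free if at least $\varepsilon n^r$ edges must be deleted from $G$ to make it $F$-free. Colourings. An $F$-colouring of an $r$-graph $G$ is a homomorphism $\kappa_G:G\to F$; the sets $V_a(G)=\kappa_G^{-1}(a)$, $a\in V(F)$, form an $F$-partition of $G$, and an $r$-graph with such a (fixed) partition is called $F$-partite. An $F$-coloured $r$-graph is a pair $(H,\sigma)$ with $\sigma:H\to F$ an $F$-colouring. For $G$ $F$-partite, $\mathrm{Emb}_\sigma(H,G)$ is the number of embeddings $\phi:H\to G$ with $\kappa_G\circ\phi=\sigma$. Uniform farness. An $n$-vertex $F$-partite $r$-graph $G$ is uniformly $\varepsilon$-far from being $F$-free if there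 is a collection $\mathcal C$ of embeddings $\psi:F\to G$ such that the sets $\psi(E(F))$, $\psi\in\mathcal C$, are pairwise disjoint, $\kappa_G\circ\psi=\mathrm{id}_{V(F)}$ for every $\psi\in\mathcal C$, and every vertex of $G$ belongs to $\psi(V(F))$ for at least $\varepsilon n^{r-1}$ members $\psi\in\mathcal C$. Abundance. - An $r$-graph $H$ is $F$-abundant if there are constants $c,C>0$ such that, for every $0<\varepsilon\le1$, there is $n_0(\varepsilon)$ for which every $\varepsilon$-far (from being $F$-free) $n$-vertex $r$-graph $G$ with $n\ge n_0(\varepsilon)$ satisfies $\mathrm{Emb}(H,G)\ge c\varepsilon^C n^{v(H)}$. - An $F$-coloured $r$-graph $(H,\sigma)$ is $F$-abundant if there are constants $c,C>0$ such that, for every $0<\varepsilon\le1$, there is $n_0(\varepsilon)$ for which every uniformly $\varepsilon$-far $n$-vertex $F$-partite $r$-graph $G$ with $n\ge n_0(\varepsilon)$ satisfies $\mathrm{Emb}_\sigma(H,G)\ge c\varepsilon^C n^{v(H)}$. - A family $\mathcal U$ of $r$-graphs is $F$-abundant if there are constants $c,C>0$ such that, for every $0<\varepsilon\le1$, there is $n_0(\varepsilon)$ for which every $\varepsilon$-far $n$-vertex $r$-graph $G$ with $n\ge n_0(\varepsilon)$ admits some $H\in\mathcal U$ (which may depend on $G$ and $\varepsilon$) with $\mathrm{Emb}(H,G)\ge c\varepsilon^C n^{v(H)}$. - A family $\mathcal H$ of $F$-coloured $r$-graphs is $F$-abundant if there are constants $c,C>0$ such that, for every $0<\varepsilon\le1$,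 there is $n_0(\varepsilon)$ for which every uniformly $\varepsilon$-far $n$-vertex $F$-partite $r$-graph $G$ with $n\ge n_0(\varepsilon)$ admits some $(H,\sigma)\in\mathcal H$ (which may depend on $G$ and $\varepsilon$) with $\mathrm{Emb}_\sigma(H,G)\ge c\varepsilon^C n^{v(H)}$. *)

theory Defs
  imports Complex_Main "HOL-Library.FuncSet" "HOL-Library.Disjoint_Sets"
begin

datatype 'a hypergraph = Hypergraph (verts: "'a set") (edges: "'a set set")

definition r_graph :: "nat \<Rightarrow> 'a hypergraph \<Rightarrow> bool" where
  "r_graph r H \<longleftrightarrow> finite (verts H) \<and> (\<forall>e\<in>edges H. e \<subseteq> verts H \<and> card e = r)"

definition isolated :: "'a hypergraph \<Rightarrow> 'a \<Rightarrow> bool" where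
  "isolated H v \<longleftrightarrow> v \<in> verts H \<and> (\<forall>e\<in>edges H. v \<notin> e)"

text \<open>Maps between vertex sets are taken to be extensional (they are \<open>undefined\<close> outside the
  domain), so that the cardinality of a set of embeddings counts maps on the vertex set.\<close>

definition homs :: "'a hypergraph \<Rightarrow> 'b hypergraph \<Rightarrow> ('a \<Rightarrow> 'b) set" where
  "homs H G = {\<phi> \<in> verts H \<rightarrow>\<^sub>E verts G. \<forall>e\<in>edges H. \<phi> ` e \<in> edges G}"

definition embeddings :: "'a hypergraph \<Rightarrow> 'b hypergraph \<Rightarrow> ('a \<Rightarrow> 'b) set" where
  "embeddings H G = {\<phi> \<in> homs H G. inj_on \<phi> (verts H)}"

definition Emb :: "'a hypergraph \<Rightarrow> 'b hypergraph \<Rightarrow> nat" where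
  "Emb H G = card (embeddings H G)"

definition free_of :: "'f hypergraph \<Rightarrow> 'a hypergraph \<Rightarrow> bool" where
  "free_of F G \<longleftrightarrow> embeddings F G = {}"

definition delete_edges :: "'a hypergraph \<Rightarrow> 'a set set \<Rightarrow> 'a hypergraph" where
  "delete_edges G D = Hypergraph (verts G) (edges G - D)"

definition far :: "nat \<Rightarrow> 'f hypergraph \<Rightarrow> real \<Rightarrow> 'a hypergraph \<Rightarrow> bool" where
  "far r F \<epsilon> G \<longleftrightarrow>
     (\<forall>D \<subseteq> edges G. free_of F (delete_edges G D) \<longrightarrow>
        real (card D) \<ge> \<epsilon> * real (card (verts G)) ^ r)"

definition coloured_r_graph :: "nat \<Rightarrow> 'f hypergraph \<Rightarrow> 'a hypergraph \<Rightarrow> ('a \<Rightarrow> 'f) \<Rightarrow> bool" where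
  "coloured_r_graph r F H \<sigma> \<longleftrightarrow> r_graph r H \<and> \<sigma> \<in> homs H F"

text \<open>In the next two definitions \<open>G\<close> is \<open>F\<close>-partite and \<open>\<kappa>\<close> is its fixed \<open>F\<close>-colouring.\<close>

definition Emb_col ::
    "'h hypergraph \<Rightarrow> ('h \<Rightarrow> 'f) \<Rightarrow> 'a hypergraph \<Rightarrow> ('a \<Rightarrow> 'f) \<Rightarrow> nat" where
  "Emb_col H \<sigma> G \<kappa> = card {\<phi> \<in> embeddings H G. \<forall>v\<in>verts H. \<kappa> (\<phi> v) = \<sigma> v}"

definition uniformly_far ::
    "nat \<Rightarrow> 'f hypergraph \<Rightarrow> real \<Rightarrow> 'a hypergraph \<Rightarrow> ('a \<Rightarrow> 'f) \<Rightarrow> bool" where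
  "uniformly_far r F \<epsilon> G \<kappa> \<longleftrightarrow>
     (\<exists>\<C> \<subseteq> embeddings F G.
        disjoint_family_on (\<lambda>\<psi>. (\<lambda>e. \<psi> ` e) ` edges F) \<C> \<and>
        (\<forall>\<psi>\<in>\<C>. \<forall>a\<in>verts F. \<kappa> (\<psi> a) = a) \<and>
        (\<forall>v\<in>verts G. real (card {\<psi> \<in> \<C>. v \<in> \<psi> ` verts F})
                        \<ge> \<epsilon> * real (card (verts G)) ^ (r - 1)))"

text \<open>The host graphs \<open>G\<close> range over finite \<open>r\<close>-graphs with vertices in \<^typ>\<open>nat\<close> (the vertex set
  being an arbitrary finite subset). This represents every finite \<open>r\<close>-graph up to isomorphism, and
  all notions involved are invariant under isomorphism.\<close>

definition abundant :: "nat \<Rightarrow> 'f hypergraph \<Rightarrow> 'h hypergraph \<Rightarrow> bool" where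
  "abundant r F H \<longleftrightarrow>
     (\<exists>c>0. \<exists>C>0. \<forall>\<epsilon>. 0 < \<epsilon> \<and> \<epsilon> \<le> 1 \<longrightarrow>
        (\<exists>n\<^sub>0. \<forall>G :: nat hypergraph.
           r_graph r G \<and> card (verts G) \<ge> n\<^sub>0 \<and> far r F \<epsilon> G \<longrightarrow>
             real (Emb H G) \<ge> c * \<epsilon> powr C * real (card (verts G)) ^ card (verts H)))"

definition abundant_col :: "nat \<Rightarrow> 'f hypergraph \<Rightarrow> 'h hypergraph \<Rightarrow> ('h \<Rightarrow> 'f) \<Rightarrow> bool" where
  "abundant_col r F H \<sigma> \<longleftrightarrow>
     (\<exists>c>0. \<exists>C>0. \<forall>\<epsilon>. 0 < \<epsilon> \<and> \<epsilon> \<le> 1 \<longrightarrow>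
        (\<exists>n\<^sub>0. \<forall>(G :: nat hypergraph) \<kappa>.
           coloured_r_graph r F G \<kappa> \<and> card (verts G) \<ge> n\<^sub>0 \<and> uniformly_far r F \<epsilon> G \<kappa> \<longrightarrow>
             real (Emb_col H \<sigma> G \<kappa>)
               \<ge> c * \<epsilon> powr C * real (card (verts G)) ^ card (verts H)))"

definition abundant_family :: "nat \<Rightarrow> 'f hypergraph \<Rightarrow> 'h hypergraph set \<Rightarrow> bool" where
  "abundant_family r F \<U> \<longleftrightarrow>
     (\<exists>c>0. \<exists>C>0. \<forall>\<epsilon>. 0 < \<epsilon> \<and> \<epsilon> \<le> 1 \<longrightarrow>
        (\<exists>n\<^sub>0. \<forall>G :: nat hypergraph.
           r_graph r G \<and> card (verts G) \<ge> n\<^sub>0 \<and> far r F \<epsilon> G \<longrightarrow>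
             (\<exists>H\<in>\<U>. real (Emb H G)
                \<ge> c * \<epsilon> powr C * real (card (verts G)) ^ card (verts H))))"

definition abundant_family_col ::
    "nat \<Rightarrow> 'f hypergraph \<Rightarrow> ('h hypergraph \<times> ('h \<Rightarrow> 'f)) set \<Rightarrow> bool" where
  "abundant_family_col r F \<H> \<longleftrightarrow>
     (\<exists>c>0. \<exists>C>0. \<forall>\<epsilon>. 0 < \<epsilon> \<and> \<epsilon> \<le> 1 \<longrightarrow>
        (\<exists>n\<^sub>0. \<forall>(G :: nat hypergraph) \<kappa>.
           coloured_r_graph r F G \<kappa> \<and> card (verts G) \<ge> n\<^sub>0 \<and> uniformly_far r F \<epsilon> G \<kappa> \<longrightarrow>
             (\<exists>(H, \<sigma>)\<in>\<H>. real (Emb_col H \<sigma> G \<kappa>)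
                \<ge> c * \<epsilon> powr C * real (card (verts G)) ^ card (verts H))))"

end

theory Submission
  imports Defs "HOL-Computational_Algebra.Polynomial" "HOL-Computational_Algebra.Primes"
begin

text \<open>Only one implication has content: a family without an abundant member is not abundant. Everything
rests on the product of \<open>F\<close>-partite hypergraphs, whose vertices are the pairs of equally coloured
vertices and whose edges are the sets projecting onto edges in both coordinates (\<open>cprod\<close>).
A homomorphism into a product is a pair of homomorphisms, so homomorphism counts are
submultiplicative; and pairing the canonical copies of \<open>F\<close> shows that the product of a uniformly
\<open>\<epsilon>\<^sub>1\<close>-far and a uniformly \<open>\<epsilon>\<^sub>2\<close>-far hypergraph is uniformly \<open>\<epsilon>\<^sub>1 * \<epsilon>\<^sub>2\<close>-far. Polynomial dependence on
\<open>\<epsilon>\<close> is exactly what survives taking products. Therefore it is enough to find one uniformly far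
hypergraph for each reason why a member of the family fails to be abundant, and to multiply.

Coloured and uncoloured counts are treated together, as homomorphisms \<open>\<phi>\<close> with the colour of \<open>\<phi> v\<close>
in a prescribed list \<open>L v\<close>: the lists \<open>{\<sigma> v}\<close> give the coloured count and the lists \<open>UNIV\<close> the
uncoloured one. A pair \<open>(H, L)\<close> is called \<open>suppressible\<close> when, for every exponent \<open>C\<close>, some uniformly
\<open>\<epsilon>\<close>-far hypergraph has at most \<open>\<epsilon> ^ C * n ^ v(H)\<close> such homomorphisms.

From failure of abundance to suppressibility: in the coloured case one only has to pass from
embeddings to homomorphisms, which differ in few maps when \<open>n\<close> is large. In the uncoloured case the
witness is merely far. Its tensor product with \<open>F\<close> itself is \<open>F\<close>-partite and contains many
edge-disjoint canonical copies, and an extremal vertex subset of it is uniformly far; here \<open>\<epsilon>\<close> changes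
by a constant factor and the number of vertices by a factor of order \<open>\<epsilon>\<close> at worst (\<open>far_imp_host\<close>).

Finitely many suppressible pairs: powers of one witness show that the bound can be achieved for all
small \<open>\<epsilon>\<close>, not just for some (\<open>suppressible_all\<close>), and then witnesses for the same \<open>\<epsilon>\<close> can be multiplied
(\<open>suppressible_finite_family\<close>).

Infinite families: Reed-Solomon codes give a uniformly \<open>const / p\<close>-far hypergraph in which \<open>r - 1\<close>
vertices of an edge and the colour of the last one determine the last one among \<open>p\<close> candidates. After
multiplication with it, every edge of \<open>H\<close> that brings in a new vertex costs a factor \<open>1 / p\<close>, so all \<open>H\<close>
with at least \<open>s * r\<close> non-isolated vertices have at most \<open>p ^ (- s) * n ^ v(H)\<close> homomorphisms
(\<open>card_lhoms_thin_le\<close>). Isolated vertices are harmless because the parts of a uniformly far hypergraph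
are large, and up to isolated vertices and isomorphism only finitely many pairs remain. The lemma
\<open>common_sparse_host\<close> combines these: the given exponent determines \<open>s\<close>, hence the finite list, and
only then is the prime \<open>p\<close> chosen, large, with the witness for the list taken at \<open>\<epsilon> = 1 / p\<close>. A second
Reed-Solomon factor of constant density makes the number of vertices arbitrarily large.\<close>

section \<open>Polynomials modulo a prime, powers and counting\<close>

text \<open>The root bound over the field with \<open>p\<close> elements, stated for integer polynomials so that \<open>p\<close> can be a
variable: split off one root by synthetic division and use that \<open>p\<close> divides no other difference of
elements of \<open>S\<close>.\<close>

lemma prime_dvd_poly_with_many_roots:
  fixes p :: int and f :: "int poly"
  assumes "prime p" "finite S" "card S = n" "degree f < n"
    and "\<And>x y. x \<in> S \<Longrightarrow> y \<in> S \<Longrightarrow> p dvd x - y \<Longrightarrow> x = y"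
    and "\<And>x. x \<in> S \<Longrightarrow> p dvd poly f x"
  shows "[:p:] dvd f"
  using assms(2-)
proof (induction n arbitrary: S f)
  case 0
  then show ?case by simp
next
  case (Suc n)
  then obtain a where a: "a \<in> S"
    by fastforce
  define g where "g = synthetic_div f a"
  have f: "f = [:- a, 1:] * g + [:poly f a:]"
    unfolding g_def by (metis synthetic_div_correct')
  have "[:p:] dvd g"
  proof (cases "degree f = 0")
    case True
    then have "g = 0"
      unfolding g_def by (metis synthetic_div_eq_0_iff)
    then show ?thesis by simp
  next
    case False
    show ?thesis
    proof (rule Suc.IH[of "S - {a}"])
      show "degree g < n"
        using False Suc.prems(3) by (simp add: g_def degree_synthetic_div)
      fix x assume x: "x \<in> S - {a}"
      have "p dvd poly f x - poly f a"
        using x a Suc.prems(5) by (simp add: dvd_diff)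
      also have "poly f x - poly f a = (x - a) * poly g x"
        by (subst (1) f) (simp add: algebra_simps)
      finally show "p dvd poly g x"
        using x a Suc.prems(4)[of x a] assms(1) by (auto simp: prime_dvd_mult_iff)
    qed (use Suc.prems a in auto)
  qed
  moreover have "[:p:] dvd [:poly f a:]"
    using Suc.prems(5)[OF a] by (simp add: const_poly_dvd_const_poly_iff)
  ultimately show ?case
    by (subst f) (intro dvd_add dvd_mult)
qed

lemma dvd_diff_imp_eq:
  fixes x y p :: int
  assumes "p dvd x - y" "0 \<le> x" "x < p" "0 \<le> y" "y < p"
  shows "x = y"
  using assms by (metis mod_eq_dvd_iff mod_pos_pos_trivial)

lemma powr_ge_power:
  fixes \<epsilon> C :: real
  assumes "0 < \<epsilon>" "\<epsilon> \<le> 1"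
  shows "\<epsilon> ^ nat \<lceil>C\<rceil> \<le> \<epsilon> powr C"
proof -
  have "\<epsilon> ^ nat \<lceil>C\<rceil> = \<epsilon> powr real (nat \<lceil>C\<rceil>)" using assms by (simp add: powr_realpow)
  also have "\<dots> \<le> \<epsilon> powr C"
    using assms by (intro powr_mono') linarith+
  finally show ?thesis .
qed

text \<open>The bookkeeping step when passing to a product with \<open>N\<close> vertices: \<open>N\<close> may be smaller than
\<open>n1 * n2\<close> by a factor \<open>\<delta>\<close>, and the surplus \<open>m\<close> in the exponent pays for this loss in all \<open>v\<close> coordinates.\<close>

lemma power_rescale:
  fixes \<delta> X n1 n2 N :: real
  assumes "X \<le> \<delta> ^ (D + m) * (n1 ^ v * n2 ^ v)" "v \<le> m" "0 < \<delta>" "\<delta> \<le> 1"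
    "\<delta> * n1 * n2 \<le> N" "0 \<le> n1" "0 \<le> n2"
  shows "X \<le> \<delta> ^ D * N ^ v"
proof -
  have "X \<le> \<delta> ^ D * (\<delta> ^ m * (n1 ^ v * n2 ^ v))"
    using assms(1) by (simp add: power_add mult_ac)
  also have "\<dots> \<le> \<delta> ^ D * (\<delta> ^ v * (n1 ^ v * n2 ^ v))"
    using assms by (intro mult_left_mono mult_right_mono power_decreasing) auto
  also have "\<dots> = \<delta> ^ D * (\<delta> * n1 * n2) ^ v"
    by (simp add: power_mult_distrib mult_ac)
  also have "\<dots> \<le> \<delta> ^ D * N ^ v"
    using assms by (intro mult_left_mono power_mono) auto
  finally show ?thesis .
qed

lemma card_le_by_fibres:
  fixes K :: real
  assumes "finite B" "f ` A \<subseteq> B"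
    and "\<And>b. b \<in> B \<Longrightarrow> real (card {a \<in> A. f a = b}) \<le> K"
    and "finite A"
  shows "real (card A) \<le> real (card B) * K"
proof -
  have "card A = (\<Sum>b\<in>B. card {a \<in> A. f a = b})"
    using sum.group[OF assms(4,1,2), of "\<lambda>_. 1::nat"] by simp
  then have "real (card A) = (\<Sum>b\<in>B. real (card {a \<in> A. f a = b}))"
    by simp
  also have "\<dots> \<le> (\<Sum>b\<in>B. K)"
    by (rule sum_mono) (use assms in auto)
  finally show ?thesis by simp
qed

lemma of_nat_le_mult: "a \<le> b * c \<Longrightarrow> real a \<le> real b * real c"
  by (simp flip: of_nat_mult)

lemma restrict_PiE_mono:
  assumes "\<phi> \<in> A \<rightarrow>\<^sub>E B" "S \<subseteq> A"
  shows "restrict \<phi> S \<in> S \<rightarrow>\<^sub>E B"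
  using assms by (auto simp: PiE_iff subset_iff)

lemma card_noninjective_le:
  assumes "finite A" "finite B"
  shows "card {\<phi> \<in> A \<rightarrow>\<^sub>E B. \<not> inj_on \<phi> A} \<le> card A ^ 2 * card B ^ (card A - 1)"
proof -
  define M where "M = (\<lambda>q. {\<phi> \<in> A \<rightarrow>\<^sub>E B. \<phi> (fst q) = \<phi> (snd q)})"
  define P where "P = {q \<in> A \<times> A. fst q \<noteq> snd q}"
  have fin: "finite (A \<rightarrow>\<^sub>E B)"
    using assms by (simp add: finite_PiE)
  have P: "P \<subseteq> A \<times> A" "finite (A \<times> A)" "finite P"
    unfolding P_def using assms by auto
  have M: "card (M q) \<le> card B ^ (card A - 1)" if "q \<in> P" for q
  proof -
    from that obtain u w where q: "q = (u, w)" "u \<in> A" "w \<in> A" "u \<noteq> w"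
      by (auto simp: P_def)
    have "card (M q) \<le> card ((A - {w}) \<rightarrow>\<^sub>E B)"
    proof (rule card_inj_on_le[where f = "\<lambda>\<phi>. restrict \<phi> (A - {w})"])
      show "inj_on (\<lambda>\<phi>. restrict \<phi> (A - {w})) (M q)"
      proof (rule inj_onI)
        fix \<phi> \<chi> assume *: "\<phi> \<in> M q" "\<chi> \<in> M q"
          "restrict \<phi> (A - {w}) = restrict \<chi> (A - {w})"
        have eq: "\<phi> x = \<chi> x" if "x \<in> A - {w}" for x
          using fun_cong[OF *(3), of x] that by simp
        have "\<phi> x = \<chi> x" if "x \<in> A" for x
          using *(1,2) q eq[of u] eq[of x] that by (cases "x = w") (auto simp: M_def)
        then show "\<phi> = \<chi>"
          using *(1,2) q by (intro PiE_ext[of _ A "\<lambda>_. B"]) (auto simp: M_def)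
      qed
      show "(\<lambda>\<phi>. restrict \<phi> (A - {w})) ` M q \<subseteq> (A - {w}) \<rightarrow>\<^sub>E B"
        by (intro image_subsetI restrict_PiE_mono[of _ A]) (auto simp: M_def)
    qed (use assms in \<open>simp add: finite_PiE\<close>)
    also have "\<dots> = card B ^ (card A - 1)"
      using assms q by (simp add: card_PiE)
    finally show ?thesis .
  qed
  have "{\<phi> \<in> A \<rightarrow>\<^sub>E B. \<not> inj_on \<phi> A} \<subseteq> (\<Union>q\<in>P. M q)"
    by (force simp: inj_on_def M_def P_def)
  then have "card {\<phi> \<in> A \<rightarrow>\<^sub>E B. \<not> inj_on \<phi> A} \<le> card (\<Union>q\<in>P. M q)"
    by (rule card_mono[rotated]) (use P fin in \<open>auto simp: M_def\<close>)
  also have "\<dots> \<le> (\<Sum>q\<in>P. card (M q))"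
    by (rule card_UN_le[OF P(3)])
  also have "\<dots> \<le> (\<Sum>q\<in>P. card B ^ (card A - 1))"
    by (rule sum_mono[OF M])
  also have "\<dots> = card P * card B ^ (card A - 1)"
    by simp
  also have "\<dots> \<le> card (A \<times> A) * card B ^ (card A - 1)"
    by (intro mult_right_mono card_mono P) auto
  finally show ?thesis
    using assms by (simp add: card_cartesian_product power2_eq_square)
qed

section \<open>Homomorphisms with prescribed lists of colours\<close>

text \<open>Colours are constrained pointwise by lists, so that restricting a map to a vertex subset, extending
it vertex by vertex and projecting it from a product all preserve the constraint.\<close>

definition lhoms :: "'h hypergraph \<Rightarrow> ('h \<Rightarrow> 'f set) \<Rightarrow> 'a hypergraph \<Rightarrow> ('a \<Rightarrow> 'f) \<Rightarrow> ('h \<Rightarrow> 'a) set" where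
  "lhoms H L G \<kappa> = {\<phi> \<in> homs H G. \<forall>v\<in>verts H. \<kappa> (\<phi> v) \<in> L v}"

definition part :: "'a hypergraph \<Rightarrow> ('a \<Rightarrow> 'f) \<Rightarrow> 'f \<Rightarrow> 'a set" where
  "part G \<kappa> a = {x \<in> verts G. \<kappa> x = a}"

lemma homs_subset: "homs H G \<subseteq> verts H \<rightarrow>\<^sub>E verts G"
  by (auto simp: homs_def)

lemma lhoms_subset: "lhoms H L G \<kappa> \<subseteq> verts H \<rightarrow>\<^sub>E verts G"
  using homs_subset by (auto simp: lhoms_def)

lemma lhoms_ext:
  assumes "\<phi> \<in> lhoms H L G \<kappa>" "\<chi> \<in> lhoms H L' G \<kappa>'" "\<And>v. v \<in> verts H \<Longrightarrow> \<phi> v = \<chi> v"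
  shows "\<phi> = \<chi>"
  by (rule PiE_ext[OF subsetD[OF lhoms_subset assms(1)] subsetD[OF lhoms_subset assms(2)] assms(3)])

lemma lhomsI:
  assumes "\<And>v. v \<in> verts H \<Longrightarrow> \<phi> v \<in> verts G \<and> \<kappa> (\<phi> v) \<in> L v" "\<phi> \<in> extensional (verts H)"
    "\<And>e. e \<in> edges H \<Longrightarrow> \<phi> ` e \<in> edges G"
  shows "\<phi> \<in> lhoms H L G \<kappa>"
  using assms by (auto simp: lhoms_def homs_def PiE_iff)

lemma finite_lhoms [intro]: "finite (verts H) \<Longrightarrow> finite (verts G) \<Longrightarrow> finite (lhoms H L G \<kappa>)"
  by (rule finite_subset[OF lhoms_subset]) (simp add: finite_PiE)

lemma card_lhoms_le:
  assumes "finite (verts H)" "finite (verts G)"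
  shows "card (lhoms H L G \<kappa>) \<le> card (verts G) ^ card (verts H)"
proof -
  have "card (lhoms H L G \<kappa>) \<le> card (verts H \<rightarrow>\<^sub>E verts G)"
    using assms by (intro card_mono lhoms_subset) (simp add: finite_PiE)
  then show ?thesis
    using assms by (simp add: card_PiE)
qed

lemma r_graph_finite [dest]: "r_graph r G \<Longrightarrow> finite (verts G)"
  by (simp add: r_graph_def)

lemma r_graph_finite_edges: "r_graph r G \<Longrightarrow> finite (edges G)"
  by (rule finite_subset[of _ "Pow (verts G)"]) (auto simp: r_graph_def)

lemma r_graph_edge: "r_graph r G \<Longrightarrow> e \<in> edges G \<Longrightarrow> e \<subseteq> verts G \<and> card e = r \<and> finite e"
  by (auto simp: r_graph_def intro: finite_subset)

lemma inj_on_edge: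
  assumes "r_graph r H" "r_graph r G" "\<phi> \<in> homs H G" "e \<in> edges H"
  shows "inj_on \<phi> e"
proof (rule eq_card_imp_inj_on)
  show "finite e" using r_graph_edge[OF assms(1,4)] by blast
  have "\<phi> ` e \<in> edges G" using assms(3,4) by (auto simp: homs_def)
  then show "card (\<phi> ` e) = card e"
    using r_graph_edge[OF assms(1,4)] r_graph_edge[OF assms(2)] by auto
qed

section \<open>Uniformly far hypergraphs as hosts\<close>

locale covered_r_graph =
  fixes r :: nat and F :: "'f hypergraph"
  assumes r_ge_2: "2 \<le> r"
    and r_graph_F: "r_graph r F"
    and edges_F: "edges F \<noteq> {}"
    and covered: "\<And>a. a \<in> verts F \<Longrightarrow> \<exists>e\<in>edges F. a \<in> e"
begin

abbreviation "k \<equiv> card (verts F)"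

lemma finite_F [simp]: "finite (verts F)"
  using r_graph_F by auto

lemma r_le_k: "r \<le> k"
  using edges_F r_graph_edge[OF r_graph_F] by (metis card_mono ex_in_conv finite_F)

lemma k_ge_2: "2 \<le> k"
  using r_ge_2 r_le_k by linarith

lemma verts_F_ne: "verts F \<noteq> {}"
  using k_ge_2 by auto

text \<open>The families of canonical copies that occur in \<open>uniformly_far\<close>, without the degree condition.\<close>

definition packing :: "'a hypergraph \<Rightarrow> ('a \<Rightarrow> 'f) \<Rightarrow> ('f \<Rightarrow> 'a) set \<Rightarrow> bool" where
  "packing G \<kappa> \<C> \<longleftrightarrow> \<C> \<subseteq> embeddings F G
     \<and> disjoint_family_on (\<lambda>\<psi>. (\<lambda>e. \<psi> ` e) ` edges F) \<C>
     \<and> (\<forall>\<psi>\<in>\<C>. \<forall>a\<in>verts F. \<kappa> (\<psi> a) = a)"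

text \<open>An empty hypergraph is uniformly far for every \<open>\<epsilon>\<close>; it has to be excluded for the products below to
have controlled size.\<close>

definition host :: "real \<Rightarrow> 'a hypergraph \<Rightarrow> ('a \<Rightarrow> 'f) \<Rightarrow> bool" where
  "host \<epsilon> G \<kappa> \<longleftrightarrow> coloured_r_graph r F G \<kappa> \<and> verts G \<noteq> {} \<and> uniformly_far r F \<epsilon> G \<kappa>"

lemma packing_section:
  assumes "packing G \<kappa> \<C>" "\<psi> \<in> \<C>" "a \<in> verts F"
  shows "\<psi> a \<in> verts G" "\<kappa> (\<psi> a) = a"
  using assms by (auto simp: packing_def embeddings_def homs_def PiE_iff)

lemma packing_extensional: "packing G \<kappa> \<C> \<Longrightarrow> \<psi> \<in> \<C> \<Longrightarrow> \<psi> \<in> extensional (verts F)"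
  by (auto simp: packing_def embeddings_def homs_def PiE_iff)

lemma packing_edge: "packing G \<kappa> \<C> \<Longrightarrow> \<psi> \<in> \<C> \<Longrightarrow> e \<in> edges F \<Longrightarrow> \<psi> ` e \<in> edges G"
  by (auto simp: packing_def embeddings_def homs_def)

lemma packing_determined:
  assumes "packing G \<kappa> \<C>" "\<psi> \<in> \<C>" "\<chi> \<in> \<C>" "e \<in> edges F" "\<psi> ` e = \<chi> ` e"
  shows "\<psi> = \<chi>"
proof (rule ccontr)
  assume "\<psi> \<noteq> \<chi>"
  then have "(\<lambda>e. \<psi> ` e) ` edges F \<inter> (\<lambda>e. \<chi> ` e) ` edges F = {}"
    using assms by (auto simp: packing_def disjoint_family_on_def)
  then show False
    using assms(4,5) by blast
qed

text \<open>Because the copies are sections of the colouring, two of them can share the image of an edge only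
if it is the same edge of \<open>F\<close> and they agree on it. Edge-disjointness thus becomes the statement that a
copy is determined by its restriction to an edge.\<close>

lemma packingI:
  assumes "\<And>\<psi> a. \<psi> \<in> \<C> \<Longrightarrow> a \<in> verts F \<Longrightarrow> \<psi> a \<in> verts G \<and> \<kappa> (\<psi> a) = a"
    and "\<And>\<psi>. \<psi> \<in> \<C> \<Longrightarrow> \<psi> \<in> extensional (verts F)"
    and "\<And>\<psi> e. \<psi> \<in> \<C> \<Longrightarrow> e \<in> edges F \<Longrightarrow> \<psi> ` e \<in> edges G"
    and det: "\<And>\<psi> \<chi> e. \<psi> \<in> \<C> \<Longrightarrow> \<chi> \<in> \<C> \<Longrightarrow> e \<in> edges F \<Longrightarrow> (\<And>a. a \<in> e \<Longrightarrow> \<psi> a = \<chi> a) \<Longrightarrow> \<psi> = \<chi>"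
  shows "packing G \<kappa> \<C>"
  unfolding packing_def
proof (intro conjI)
  have "inj_on \<psi> (verts F)" if "\<psi> \<in> \<C>" for \<psi>
    by (rule inj_on_inverseI[where g = \<kappa>]) (use assms(1)[OF that] in auto)
  then show "\<C> \<subseteq> embeddings F G"
    using assms(1-3) by (auto simp: embeddings_def homs_def PiE_iff)
  show "\<forall>\<psi>\<in>\<C>. \<forall>a\<in>verts F. \<kappa> (\<psi> a) = a"
    using assms(1) by auto
  show "disjoint_family_on (\<lambda>\<psi>. (\<lambda>e. \<psi> ` e) ` edges F) \<C>"
    unfolding disjoint_family_on_def
  proof (intro ballI impI, rule ccontr)
    fix \<psi> \<chi> assume *: "\<psi> \<in> \<C>" "\<chi> \<in> \<C>" "\<psi> \<noteq> \<chi>"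
      and "(\<lambda>e. \<psi> ` e) ` edges F \<inter> (\<lambda>e. \<chi> ` e) ` edges F \<noteq> {}"
    then obtain e e' where e: "e \<in> edges F" "e' \<in> edges F" "\<psi> ` e = \<chi> ` e'"
      by auto
    have sub: "e \<subseteq> verts F" "e' \<subseteq> verts F"
      using e r_graph_edge[OF r_graph_F] by auto
    have "\<kappa> ` \<psi> ` e = e" "\<kappa> ` \<chi> ` e' = e'"
      using assms(1)[OF *(1)] assms(1)[OF *(2)] sub by (force simp: image_image)+
    then have "e = e'"
      using e(3) by simp
    have "\<psi> a = \<chi> a" if a: "a \<in> e" for a
    proof -
      have "\<psi> a \<in> \<chi> ` e" using a e(3) \<open>e = e'\<close> by blast
      then obtain b where b: "b \<in> e" "\<psi> a = \<chi> b" by blast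
      then have "a = b"
        using assms(1)[OF *(1), of a] assms(1)[OF *(2), of b] a sub by auto
      then show ?thesis using b by simp
    qed
    then show False using det[OF *(1,2) e(1)] * by blast
  qed
qed

lemma uniformly_far_iff_packing:
  "uniformly_far r F \<epsilon> G \<kappa> \<longleftrightarrow> (\<exists>\<C>. packing G \<kappa> \<C> \<and>
     (\<forall>v\<in>verts G. real (card {\<psi> \<in> \<C>. v \<in> \<psi> ` verts F}) \<ge> \<epsilon> * real (card (verts G)) ^ (r - 1)))"
  unfolding uniformly_far_def packing_def by blast

lemma finite_packing:
  assumes "packing G \<kappa> \<C>" "finite (verts G)"
  shows "finite \<C>"
proof (rule finite_subset)
  show "\<C> \<subseteq> verts F \<rightarrow>\<^sub>E verts G"
    using assms(1) by (auto simp: packing_def embeddings_def homs_def)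
qed (use assms in \<open>simp add: finite_PiE\<close>)

lemma copies_through:
  assumes "packing G \<kappa> \<C>" "\<kappa> v \<in> verts F"
  shows "{\<psi> \<in> \<C>. v \<in> \<psi> ` verts F} = {\<psi> \<in> \<C>. \<psi> (\<kappa> v) = v}"
proof (intro Collect_cong conj_cong refl iffI)
  fix \<psi> assume "\<psi> \<in> \<C>"
  then show "v \<in> \<psi> ` verts F \<Longrightarrow> \<psi> (\<kappa> v) = v"
    using packing_section(2)[OF assms(1)] by force
  show "\<psi> (\<kappa> v) = v \<Longrightarrow> v \<in> \<psi> ` verts F"
    using assms(2) by force
qed

lemma host_r_graph: "host \<epsilon> G \<kappa> \<Longrightarrow> r_graph r G"
  and host_finite: "host \<epsilon> G \<kappa> \<Longrightarrow> finite (verts G)"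
  and host_hom: "host \<epsilon> G \<kappa> \<Longrightarrow> \<kappa> \<in> homs G F"
  and host_col: "host \<epsilon> G \<kappa> \<Longrightarrow> v \<in> verts G \<Longrightarrow> \<kappa> v \<in> verts F"
  and host_card: "host \<epsilon> G \<kappa> \<Longrightarrow> card (verts G) > 0"
  by (auto simp: host_def coloured_r_graph_def homs_def PiE_iff card_gt_0_iff)

lemma host_packing:
  assumes "host \<epsilon> G \<kappa>"
  shows "\<exists>\<C>. packing G \<kappa> \<C> \<and>
    (\<forall>v\<in>verts G. \<epsilon> * real (card (verts G)) ^ (r - 1) \<le> real (card {\<psi> \<in> \<C>. \<psi> (\<kappa> v) = v}))"
proof -
  obtain \<C> where *: "packing G \<kappa> \<C>" "\<forall>v\<in>verts G. real (card {\<psi> \<in> \<C>. v \<in> \<psi> ` verts F}) \<ge> \<epsilon> * real (card (verts G)) ^ (r - 1)"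
    using assms by (auto simp: host_def uniformly_far_iff_packing)
  have "\<epsilon> * real (card (verts G)) ^ (r - 1) \<le> real (card {\<psi> \<in> \<C>. \<psi> (\<kappa> v) = v})"
    if v: "v \<in> verts G" for v
    using bspec[OF *(2) v] unfolding copies_through[OF *(1) host_col[OF assms v]] .
  then show ?thesis
    using *(1) by blast
qed

lemma hostI:
  assumes "r_graph r G" "\<kappa> \<in> homs G F" "verts G \<noteq> {}" "packing G \<kappa> \<C>"
    "\<And>v. v \<in> verts G \<Longrightarrow> \<epsilon> * real (card (verts G)) ^ (r - 1) \<le> real (card {\<psi> \<in> \<C>. \<psi> (\<kappa> v) = v})"
  shows "host \<epsilon> G \<kappa>"
proof -
  have "\<kappa> v \<in> verts F" if "v \<in> verts G" for v
    using assms(2) that by (auto simp: homs_def PiE_iff)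
  then show ?thesis
    using assms copies_through[OF assms(4)]
    by (auto simp: host_def coloured_r_graph_def uniformly_far_iff_packing intro!: exI[of _ \<C>])
qed

lemma host_mono:
  assumes "host \<epsilon> G \<kappa>" "\<delta> \<le> \<epsilon>"
  shows "host \<delta> G \<kappa>"
proof -
  obtain \<C> where *: "packing G \<kappa> \<C>"
    "\<forall>v\<in>verts G. \<epsilon> * real (card (verts G)) ^ (r - 1) \<le> real (card {\<psi> \<in> \<C>. \<psi> (\<kappa> v) = v})"
    using host_packing[OF assms(1)] by blast
  have "\<delta> * real (card (verts G)) ^ (r - 1) \<le> \<epsilon> * real (card (verts G)) ^ (r - 1)"
    by (rule mult_right_mono[OF assms(2)]) simp
  then show ?thesis
    using *(2) host_r_graph[OF assms(1)] host_hom[OF assms(1)] assms(1)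
    by (intro hostI[OF _ _ _ *(1)]) (auto simp: host_def dest: bspec)
qed

text \<open>Choose an edge of \<open>F\<close> containing \<open>a\<close> and a second vertex \<open>b\<close>, and a vertex \<open>v\<close> of colour \<open>b\<close>. The copies
through \<open>v\<close> are determined by their values on the other \<open>r - 1\<close> vertices of this edge, one of which is
confined to the part of \<open>a\<close>; as there are many copies, this part cannot be small. This is where \<open>F\<close> having
no isolated vertex is used.\<close>

lemma part_lower_bound:
  assumes host: "host \<epsilon> G \<kappa>" and "0 < \<epsilon>" and a: "a \<in> verts F"
  shows "\<epsilon> * real (card (verts G)) \<le> real (card (part G \<kappa> a))"
proof -
  let ?n = "card (verts G)"
  obtain \<C> where \<C>: "packing G \<kappa> \<C>"
    "\<forall>v\<in>verts G. \<epsilon> * real ?n ^ (r - 1) \<le> real (card {\<psi> \<in> \<C>. \<psi> (\<kappa> v) = v})"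
    using host_packing[OF host] by blast
  have fin: "finite (verts G)" "?n > 0" "finite \<C>"
    using host_finite[OF host] host_card[OF host] finite_packing[OF \<C>(1)] by auto
  have pos: "0 < \<epsilon> * real ?n ^ (r - 1)"
    using assms(2) fin by simp
  obtain e where e: "e \<in> edges F" "a \<in> e"
    using covered[OF a] by blast
  have eF: "e \<subseteq> verts F" "card e = r" "finite e"
    using r_graph_edge[OF r_graph_F e(1)] by auto
  have "card (e - {a}) > 0"
    using eF e r_ge_2 by simp
  then obtain b where b: "b \<in> e" "b \<noteq> a"
    by (metis DiffE card_gt_0_iff ex_in_conv insertI1)
  obtain w where "w \<in> verts G"
    using host by (auto simp: host_def)
  then have "card {\<psi> \<in> \<C>. \<psi> (\<kappa> w) = w} > 0"
    using bspec[OF \<C>(2), of w] pos by linarith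
  then obtain \<psi>0 where \<psi>0: "\<psi>0 \<in> \<C>"
    by (metis (no_types, lifting) card_gt_0_iff ex_in_conv mem_Collect_eq)
  define v where "v = \<psi>0 b"
  have v: "v \<in> verts G" "\<kappa> v = b"
    using packing_section[OF \<C>(1) \<psi>0] b eF by (auto simp: v_def)
  let ?P = "{\<psi> \<in> \<C>. \<psi> b = v}"
  let ?B = "\<lambda>c. if c = a then part G \<kappa> a else verts G"
  have "card ?P \<le> card (PiE (e - {b}) ?B)"
  proof (rule card_inj_on_le[where f = "\<lambda>\<psi>. restrict \<psi> (e - {b})"])
    show "inj_on (\<lambda>\<psi>. restrict \<psi> (e - {b})) ?P"
    proof (rule inj_onI)
      fix \<psi> \<chi> assume *: "\<psi> \<in> ?P" "\<chi> \<in> ?P" "restrict \<psi> (e - {b}) = restrict \<chi> (e - {b})"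
      have "\<psi> c = \<chi> c" if "c \<in> e" for c
        using fun_cong[OF *(3), of c] *(1,2) that by (cases "c = b") auto
      then have "\<psi> ` e = \<chi> ` e" by simp
      then show "\<psi> = \<chi>"
        using packing_determined[OF \<C>(1) _ _ e(1), of \<psi> \<chi>] *(1,2) by simp
    qed
    show "(\<lambda>\<psi>. restrict \<psi> (e - {b})) ` ?P \<subseteq> PiE (e - {b}) ?B"
    proof (intro image_subsetI PiE_I)
      fix \<psi> c assume "\<psi> \<in> ?P" "c \<in> e - {b}"
      then show "restrict \<psi> (e - {b}) c \<in> ?B c"
        using packing_section[OF \<C>(1), of \<psi> c] eF by (auto simp: part_def)
    qed auto
    show "finite (PiE (e - {b}) ?B)"
      using eF fin by (intro finite_PiE) (auto simp: part_def)
  qed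
  also have "\<dots> = (\<Prod>c\<in>e - {b}. card (?B c))"
    using eF by (simp add: card_PiE)
  also have "\<dots> = card (part G \<kappa> a) * (\<Prod>c\<in>e - {b} - {a}. card (?B c))"
    using eF e b by (subst prod.remove[of _ a]) auto
  also have "(\<Prod>c\<in>e - {b} - {a}. card (?B c)) = (\<Prod>c\<in>e - {b} - {a}. ?n)"
    by (rule prod.cong) auto
  also have "\<dots> = ?n ^ (r - 2)"
    using eF e b by (simp add: card_Diff_singleton diff_diff_eq numeral_2_eq_2)
  finally have "card ?P \<le> card (part G \<kappa> a) * ?n ^ (r - 2)" .
  then have "real (card ?P) \<le> real (card (part G \<kappa> a)) * real (?n ^ (r - 2))"
    by (rule of_nat_le_mult)
  then have "\<epsilon> * real ?n ^ (r - 1) \<le> real (card (part G \<kappa> a)) * real ?n ^ (r - 2)"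
    using bspec[OF \<C>(2) v(1)] v(2) by simp
  moreover have "r - 1 = Suc (r - 2)"
    using r_ge_2 by simp
  ultimately have "(\<epsilon> * real ?n) * real ?n ^ (r - 2) \<le> real (card (part G \<kappa> a)) * real ?n ^ (r - 2)"
    by (simp add: mult_ac)
  then show ?thesis
    by (rule mult_right_le_imp_le) (use fin in simp)
qed

end

section \<open>Products of hypergraphs\<close>

text \<open>The vertex set \<open>W\<close> is a parameter: pairs of equal colour for the product of two \<open>F\<close>-partite
hypergraphs, and all pairs for the product of an uncoloured hypergraph with \<open>F\<close>.\<close>

definition tensor :: "nat \<Rightarrow> ('a \<times> 'b) set \<Rightarrow> 'a hypergraph \<Rightarrow> 'b hypergraph \<Rightarrow> ('a \<times> 'b) hypergraph" where
  "tensor r W G1 G2 = Hypergraph W {e. e \<subseteq> W \<and> card e = r \<and> fst ` e \<in> edges G1 \<and> snd ` e \<in> edges G2}"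

lemma verts_tensor [simp]: "verts (tensor r W G1 G2) = W"
  and edges_tensor [simp]:
    "edges (tensor r W G1 G2) = {e. e \<subseteq> W \<and> card e = r \<and> fst ` e \<in> edges G1 \<and> snd ` e \<in> edges G2}"
  by (simp_all add: tensor_def)

lemma r_graph_tensor: "finite W \<Longrightarrow> r_graph r (tensor r W G1 G2)"
  by (auto simp: r_graph_def)

lemma card_lhoms_tensor_le:
  assumes H: "r_graph s H" and fin: "finite (verts G1)" "finite (verts G2)"
    and W: "W \<subseteq> verts G1 \<times> verts G2"
    and L: "\<And>v w. v \<in> verts H \<Longrightarrow> w \<in> W \<Longrightarrow> \<kappa> w \<in> L v \<Longrightarrow> \<kappa>1 (fst w) \<in> L1 v \<and> \<kappa>2 (snd w) \<in> L2 v"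
  shows "card (lhoms H L (tensor r W G1 G2) \<kappa>) \<le> card (lhoms H L1 G1 \<kappa>1) * card (lhoms H L2 G2 \<kappa>2)"
proof -
  let ?V = "verts H"
  let ?f = "\<lambda>\<phi>. (restrict (fst \<circ> \<phi>) ?V, restrict (snd \<circ> \<phi>) ?V)"
  have "card (lhoms H L (tensor r W G1 G2) \<kappa>) \<le> card (lhoms H L1 G1 \<kappa>1 \<times> lhoms H L2 G2 \<kappa>2)"
  proof (rule card_inj_on_le[where f = ?f])
    show "inj_on ?f (lhoms H L (tensor r W G1 G2) \<kappa>)"
    proof (rule inj_onI)
      fix \<phi> \<chi> assume *: "\<phi> \<in> lhoms H L (tensor r W G1 G2) \<kappa>" "\<chi> \<in> lhoms H L (tensor r W G1 G2) \<kappa>"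
        "?f \<phi> = ?f \<chi>"
      show "\<phi> = \<chi>"
      proof (rule lhoms_ext[OF *(1,2)])
        fix v assume v: "v \<in> ?V"
        have fs: "restrict (fst \<circ> \<phi>) ?V = restrict (fst \<circ> \<chi>) ?V"
          "restrict (snd \<circ> \<phi>) ?V = restrict (snd \<circ> \<chi>) ?V"
          using *(3) by simp_all
        show "\<phi> v = \<chi> v"
          using fun_cong[OF fs(1), of v] fun_cong[OF fs(2), of v] v by (simp add: prod_eq_iff)
      qed
    qed
    show "?f ` lhoms H L (tensor r W G1 G2) \<kappa> \<subseteq> lhoms H L1 G1 \<kappa>1 \<times> lhoms H L2 G2 \<kappa>2"
    proof (rule image_subsetI)
      fix \<phi> assume \<phi>: "\<phi> \<in> lhoms H L (tensor r W G1 G2) \<kappa>"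
      have in_W: "\<phi> v \<in> W" "\<kappa> (\<phi> v) \<in> L v" if "v \<in> ?V" for v
        using \<phi> that by (auto simp: lhoms_def homs_def)
      have img: "restrict (fst \<circ> \<phi>) ?V ` e = fst ` \<phi> ` e" "restrict (snd \<circ> \<phi>) ?V ` e = snd ` \<phi> ` e"
        if "e \<in> edges H" for e
        using r_graph_edge[OF H that] by (auto simp: image_image subset_iff intro!: image_cong)
      have E: "fst ` \<phi> ` e \<in> edges G1" "snd ` \<phi> ` e \<in> edges G2" if "e \<in> edges H" for e
        using \<phi> that by (auto simp: lhoms_def homs_def)
      have V: "fst (\<phi> v) \<in> verts G1" "snd (\<phi> v) \<in> verts G2" if "v \<in> ?V" for v
        using in_W(1)[OF that] W by auto
      show "?f \<phi> \<in> lhoms H L1 G1 \<kappa>1 \<times> lhoms H L2 G2 \<kappa>2"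
        using L[OF _ in_W] img E V by (simp add: lhoms_def homs_def)
    qed
    show "finite (lhoms H L1 G1 \<kappa>1 \<times> lhoms H L2 G2 \<kappa>2)"
      using H fin by auto
  qed
  then show ?thesis
    by (simp add: card_cartesian_product)
qed

text \<open>Products live on types of pairs, while the hosts in the definition of abundance have natural numbers
as vertices; relabelling along an injection moves between the two.\<close>

definition relabel :: "('a \<Rightarrow> 'b) \<Rightarrow> 'a hypergraph \<Rightarrow> 'b hypergraph" where
  "relabel f G = Hypergraph (f ` verts G) ((`) f ` edges G)"

definition relabel_col :: "('a \<Rightarrow> 'b) \<Rightarrow> 'a hypergraph \<Rightarrow> ('a \<Rightarrow> 'f) \<Rightarrow> 'b \<Rightarrow> 'f" where
  "relabel_col f G \<kappa> = restrict (\<kappa> \<circ> inv_into (verts G) f) (f ` verts G)"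

lemma verts_relabel [simp]: "verts (relabel f G) = f ` verts G"
  and edges_relabel [simp]: "edges (relabel f G) = (`) f ` edges G"
  by (simp_all add: relabel_def)

lemma relabel_col_apply [simp]:
  "inj_on f (verts G) \<Longrightarrow> x \<in> verts G \<Longrightarrow> relabel_col f G \<kappa> (f x) = \<kappa> x"
  by (simp add: relabel_col_def)

lemma r_graph_relabel:
  assumes "r_graph r G" "inj_on f (verts G)"
  shows "r_graph r (relabel f G)"
  using assms by (auto simp: r_graph_def card_image inj_on_subset)

lemma inv_into_image_edge:
  assumes "inj_on f V" "e \<subseteq> V"
  shows "inv_into V f ` f ` e = e"
proof -
  have "inv_into V f ` f ` e = (\<lambda>x. x) ` e"
    unfolding image_image using assms by (intro image_cong) auto
  then show ?thesis by simp
qed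

lemma insert_relabel_edge_iff:
  assumes G: "r_graph r G" and f: "inj_on f (verts G)" and "x \<in> verts G" "S \<subseteq> verts G"
  shows "insert (f x) (f ` S) \<in> edges (relabel f G) \<longleftrightarrow> insert x S \<in> edges G"
proof
  assume "insert (f x) (f ` S) \<in> edges (relabel f G)"
  then obtain e where e: "e \<in> edges G" "f ` insert x S = f ` e" by auto
  then have "insert x S = e"
    using r_graph_edge[OF G e(1)] assms by (subst (asm) inj_on_image_eq_iff[OF f]) auto
  then show "insert x S \<in> edges G" using e by simp
qed (auto simp flip: image_insert)

lemma part_relabel:
  assumes "inj_on f (verts G)"
  shows "part (relabel f G) (relabel_col f G \<kappa>) a = f ` part G \<kappa> a"
  using assms by (auto simp: part_def)

lemma card_lhoms_relabel_le:
  assumes H: "r_graph s H" and G: "r_graph r G" and f: "inj_on f (verts G)"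
  shows "card (lhoms H L (relabel f G) (relabel_col f G \<kappa>)) \<le> card (lhoms H L G \<kappa>)"
proof (rule card_inj_on_le[where f = "\<lambda>\<phi>. restrict (inv_into (verts G) f \<circ> \<phi>) (verts H)"])
  let ?g = "inv_into (verts G) f"
  let ?A = "lhoms H L (relabel f G) (relabel_col f G \<kappa>)"
  have in_V: "\<phi> v \<in> f ` verts G" if "\<phi> \<in> ?A" "v \<in> verts H" for \<phi> v
    using that by (auto simp: lhoms_def homs_def)
  show "inj_on (\<lambda>\<phi>. restrict (?g \<circ> \<phi>) (verts H)) ?A"
  proof (rule inj_onI)
    fix \<phi> \<chi> assume *: "\<phi> \<in> ?A" "\<chi> \<in> ?A" "restrict (?g \<circ> \<phi>) (verts H) = restrict (?g \<circ> \<chi>) (verts H)"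
    show "\<phi> = \<chi>"
    proof (rule lhoms_ext[OF *(1,2)])
      fix v assume v: "v \<in> verts H"
      then have "?g (\<phi> v) = ?g (\<chi> v)"
        using fun_cong[OF *(3), of v] by simp
      then show "\<phi> v = \<chi> v"
        by (rule inv_into_injective[OF _ in_V[OF *(1) v] in_V[OF *(2) v]])
    qed
  qed
  show "(\<lambda>\<phi>. restrict (?g \<circ> \<phi>) (verts H)) ` ?A \<subseteq> lhoms H L G \<kappa>"
  proof (rule image_subsetI)
    fix \<phi> assume \<phi>: "\<phi> \<in> ?A"
    have V: "?g (\<phi> v) \<in> verts G" "\<kappa> (?g (\<phi> v)) \<in> L v" if "v \<in> verts H" for v
      using in_V[OF \<phi> that] \<phi> that f by (auto simp: lhoms_def)
    have E: "(?g \<circ> \<phi>) ` e \<in> edges G" if e: "e \<in> edges H" for e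
    proof -
      have "\<phi> ` e \<in> (`) f ` edges G"
        using \<phi> e by (auto simp: lhoms_def homs_def)
      then obtain d where d: "d \<in> edges G" "\<phi> ` e = f ` d" by auto
      then have "?g ` \<phi> ` e = d"
        using inv_into_image_edge[OF f, of d] r_graph_edge[OF G, of d] by simp
      then show ?thesis unfolding image_comp[symmetric] using d(1) by simp
    qed
    have img: "restrict (?g \<circ> \<phi>) (verts H) ` e = (?g \<circ> \<phi>) ` e" if "e \<in> edges H" for e
      using r_graph_edge[OF H that] by (auto simp: subset_iff intro!: image_cong)
    show "restrict (?g \<circ> \<phi>) (verts H) \<in> lhoms H L G \<kappa>"
      using V E img by (simp add: lhoms_def homs_def)
  qed
  show "finite (lhoms H L G \<kappa>)"
    using H G by auto
qed

context covered_r_graph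
begin

text \<open>Asking for the bound inside each colour class makes the property pass from one factor to a product,
whatever the sizes of the parts are.\<close>

definition thin :: "real \<Rightarrow> 'a hypergraph \<Rightarrow> ('a \<Rightarrow> 'f) \<Rightarrow> bool" where
  "thin \<delta> G \<kappa> \<longleftrightarrow> (\<forall>S a. card S = r - 1 \<longrightarrow>
     real (card {x \<in> part G \<kappa> a. insert x S \<in> edges G}) \<le> \<delta> * real (card (part G \<kappa> a)))"

lemma card_eq_sum_parts:
  assumes "host \<epsilon> G \<kappa>"
  shows "card (verts G) = (\<Sum>a\<in>verts F. card (part G \<kappa> a))"
proof -
  have "verts G = (\<Union>a\<in>verts F. part G \<kappa> a)"
    using host_col[OF assms] by (auto simp: part_def)
  then show ?thesis
    using host_finite[OF assms] by (subst card_UN_disjoint[symmetric]) (auto simp: part_def)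
qed

lemma thin_degree:
  assumes "host \<epsilon> G \<kappa>" "thin \<delta> G \<kappa>" "card S = r - 1"
  shows "real (card {x \<in> verts G. insert x S \<in> edges G}) \<le> \<delta> * real (card (verts G))"
proof -
  have eq: "{x \<in> verts G. insert x S \<in> edges G} = (\<Union>a\<in>verts F. {x \<in> part G \<kappa> a. insert x S \<in> edges G})"
    using host_col[OF assms(1)] by (auto simp: part_def)
  have "card {x \<in> verts G. insert x S \<in> edges G}
    \<le> (\<Sum>a\<in>verts F. card {x \<in> part G \<kappa> a. insert x S \<in> edges G})"
    unfolding eq by (rule card_UN_le[OF finite_F])
  then have "real (card {x \<in> verts G. insert x S \<in> edges G})
    \<le> (\<Sum>a\<in>verts F. real (card {x \<in> part G \<kappa> a. insert x S \<in> edges G}))"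
    by (simp flip: of_nat_sum)
  also have "\<dots> \<le> (\<Sum>a\<in>verts F. \<delta> * real (card (part G \<kappa> a)))"
    using assms(2,3) by (intro sum_mono) (auto simp: thin_def)
  also have "\<dots> = \<delta> * real (card (verts G))"
    by (simp add: card_eq_sum_parts[OF assms(1)] sum_distrib_left)
  finally show ?thesis .
qed

lemma host_relabel:
  assumes host: "host \<epsilon> G \<kappa>" and f: "inj_on f (verts G)"
  shows "host \<epsilon> (relabel f G) (relabel_col f G \<kappa>)"
proof -
  note G = host_r_graph[OF host]
  obtain \<C> where \<C>: "packing G \<kappa> \<C>"
    "\<forall>v\<in>verts G. \<epsilon> * real (card (verts G)) ^ (r - 1) \<le> real (card {\<psi> \<in> \<C>. \<psi> (\<kappa> v) = v})"
    using host_packing[OF host] by blast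
  let ?h = "\<lambda>\<psi>. restrict (f \<circ> \<psi>) (verts F)"
  have img: "?h \<psi> ` e = f ` \<psi> ` e" if "e \<in> edges F" for \<psi> e
    using r_graph_edge[OF r_graph_F that] by (auto simp: image_image subset_iff intro!: image_cong)
  have eq_on: "\<psi> a = \<chi> a" if "\<psi> \<in> \<C>" "\<chi> \<in> \<C>" "a \<in> verts F" "f (\<psi> a) = f (\<chi> a)" for \<psi> \<chi> a
    using that packing_section(1)[OF \<C>(1)] f by (auto dest: inj_onD)
  have pack: "packing (relabel f G) (relabel_col f G \<kappa>) (?h ` \<C>)"
  proof (rule packingI)
    fix \<psi>' \<chi>' e assume *: "\<psi>' \<in> ?h ` \<C>" "\<chi>' \<in> ?h ` \<C>" "e \<in> edges F" "\<And>a. a \<in> e \<Longrightarrow> \<psi>' a = \<chi>' a"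
    then obtain \<psi> \<chi> where \<psi>: "\<psi> \<in> \<C>" "\<psi>' = ?h \<psi>" "\<chi> \<in> \<C>" "\<chi>' = ?h \<chi>" by auto
    have "\<psi> a = \<chi> a" if "a \<in> e" for a
      using *(4)[OF that] r_graph_edge[OF r_graph_F *(3)] that \<psi> eq_on[of \<psi> \<chi> a] by auto
    then have "\<psi> ` e = \<chi> ` e" by simp
    then show "\<psi>' = \<chi>'"
      using packing_determined[OF \<C>(1) \<psi>(1,3) *(3)] \<psi> by simp
  qed (use packing_section[OF \<C>(1)] f packing_edge[OF \<C>(1)] img in auto)
  have hom: "relabel_col f G \<kappa> \<in> homs (relabel f G) F"
  proof -
    have "relabel_col f G \<kappa> ` f ` e = \<kappa> ` e" if "e \<in> edges G" for e
      unfolding image_image using r_graph_edge[OF G that] f by (intro image_cong) auto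
    then show ?thesis
      using host_hom[OF host] f by (auto simp: homs_def relabel_col_def PiE_iff)
  qed
  show ?thesis
  proof (rule hostI[OF r_graph_relabel[OF G f] hom _ pack])
    fix w assume "w \<in> verts (relabel f G)"
    then obtain v where v: "v \<in> verts G" "w = f v" by auto
    note a = host_col[OF host v(1)]
    have "card {\<psi> \<in> \<C>. \<psi> (\<kappa> v) = v} \<le> card {\<psi> \<in> ?h ` \<C>. \<psi> (\<kappa> v) = w}"
    proof (rule card_inj_on_le[where f = ?h])
      show "inj_on ?h {\<psi> \<in> \<C>. \<psi> (\<kappa> v) = v}"
      proof (rule inj_onI)
        fix \<psi> \<chi> assume *: "\<psi> \<in> {\<psi> \<in> \<C>. \<psi> (\<kappa> v) = v}" "\<chi> \<in> {\<psi> \<in> \<C>. \<psi> (\<kappa> v) = v}" "?h \<psi> = ?h \<chi>"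
        have "\<psi> c = \<chi> c" if "c \<in> verts F" for c
          using fun_cong[OF *(3), of c] that *(1,2) eq_on[of \<psi> \<chi> c] by simp
        then show "\<psi> = \<chi>"
          using *(1,2) packing_extensional[OF \<C>(1)] by (intro extensionalityI[of _ "verts F"]) auto
      qed
      show "finite {\<psi> \<in> ?h ` \<C>. \<psi> (\<kappa> v) = w}"
        using finite_packing[OF \<C>(1)] host_finite[OF host] by auto
    qed (use a v in auto)
    then show "\<epsilon> * real (card (verts (relabel f G))) ^ (r - 1)
      \<le> real (card {\<psi> \<in> ?h ` \<C>. \<psi> (relabel_col f G \<kappa> w) = w})"
      using bspec[OF \<C>(2) v(1)] v f by (simp add: card_image)
  qed (use host in \<open>auto simp: host_def\<close>)
qed

lemma thin_relabel:
  fixes f :: "'a \<Rightarrow> 'b"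
  assumes host: "host \<epsilon> G \<kappa>" and f: "inj_on f (verts G)" and thin: "thin \<delta> G \<kappa>" and "0 \<le> \<delta>"
  shows "thin \<delta> (relabel f G) (relabel_col f G \<kappa>)"
  unfolding thin_def
proof (intro allI impI)
  fix S :: "'b set" and a assume S: "card S = r - 1"
  note G = host_r_graph[OF host]
  let ?P = "{x \<in> part (relabel f G) (relabel_col f G \<kappa>) a. insert x S \<in> edges (relabel f G)}"
  have inj: "inj_on f (part G \<kappa> a)"
    using f by (rule inj_on_subset) (auto simp: part_def)
  show "real (card ?P) \<le> \<delta> * real (card (part (relabel f G) (relabel_col f G \<kappa>) a))"
  proof (cases "S \<subseteq> f ` verts G")
    case True
    then obtain T where T: "T \<subseteq> verts G" "S = f ` T" by (auto simp: subset_image_iff)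
    have "card T = r - 1"
      using S T f by (simp add: card_image inj_on_subset)
    moreover have "?P = f ` {x \<in> part G \<kappa> a. insert x T \<in> edges G}"
      using insert_relabel_edge_iff[OF G f _ T(1)] T(2)
      unfolding part_relabel[OF f] by (auto simp: part_def simp del: edges_relabel)
    moreover have "card (f ` {x \<in> part G \<kappa> a. insert x T \<in> edges G}) = card {x \<in> part G \<kappa> a. insert x T \<in> edges G}"
      by (rule card_image[OF inj_on_subset[OF inj]]) auto
    ultimately show ?thesis
      using thin inj by (simp add: thin_def part_relabel[OF f] card_image del: edges_relabel)
  next
    case False
    then have P: "?P = {}"
      using r_graph_edge[OF r_graph_relabel[OF G f]] by (auto simp del: edges_relabel)
    show ?thesis unfolding P using \<open>0 \<le> \<delta>\<close> by simp
  qed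
qed

text \<open>The categorical product of hypergraphs over \<open>F\<close>.\<close>

definition cverts :: "'a hypergraph \<Rightarrow> ('a \<Rightarrow> 'f) \<Rightarrow> 'b hypergraph \<Rightarrow> ('b \<Rightarrow> 'f) \<Rightarrow> ('a \<times> 'b) set" where
  "cverts G1 \<kappa>1 G2 \<kappa>2 = {(x, y). x \<in> verts G1 \<and> y \<in> verts G2 \<and> \<kappa>1 x = \<kappa>2 y}"

definition cprod :: "'a hypergraph \<Rightarrow> ('a \<Rightarrow> 'f) \<Rightarrow> 'b hypergraph \<Rightarrow> ('b \<Rightarrow> 'f) \<Rightarrow> ('a \<times> 'b) hypergraph" where
  "cprod G1 \<kappa>1 G2 \<kappa>2 = tensor r (cverts G1 \<kappa>1 G2 \<kappa>2) G1 G2"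

definition cprod_col :: "'a hypergraph \<Rightarrow> ('a \<Rightarrow> 'f) \<Rightarrow> 'b hypergraph \<Rightarrow> ('b \<Rightarrow> 'f) \<Rightarrow> 'a \<times> 'b \<Rightarrow> 'f" where
  "cprod_col G1 \<kappa>1 G2 \<kappa>2 = restrict (\<kappa>1 \<circ> fst) (cverts G1 \<kappa>1 G2 \<kappa>2)"

lemma cverts_subset: "cverts G1 \<kappa>1 G2 \<kappa>2 \<subseteq> verts G1 \<times> verts G2"
  by (auto simp: cverts_def)

lemma part_cprod:
  fixes G1 :: "'a hypergraph" and G2 :: "'b hypergraph"
  shows "part (cprod G1 \<kappa>1 G2 \<kappa>2) (cprod_col G1 \<kappa>1 G2 \<kappa>2) a = part G1 \<kappa>1 a \<times> part G2 \<kappa>2 a"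
proof (rule set_eqI)
  fix w :: "'a \<times> 'b"
  obtain x y where w: "w = (x, y)" by (cases w)
  have "w \<in> part (cprod G1 \<kappa>1 G2 \<kappa>2) (cprod_col G1 \<kappa>1 G2 \<kappa>2) a
    \<longleftrightarrow> w \<in> cverts G1 \<kappa>1 G2 \<kappa>2 \<and> \<kappa>1 x = a"
    by (auto simp: part_def cprod_def cprod_col_def w)
  then show "w \<in> part (cprod G1 \<kappa>1 G2 \<kappa>2) (cprod_col G1 \<kappa>1 G2 \<kappa>2) a
    \<longleftrightarrow> w \<in> part G1 \<kappa>1 a \<times> part G2 \<kappa>2 a"
    by (auto simp: w part_def cverts_def)
qed

text \<open>If \<open>\<psi>1\<close> and \<open>\<psi>2\<close> run through the two packings, the maps \<open>a \<mapsto> (\<psi>1 a, \<psi>2 a)\<close> form a packing of the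
product: an edge of such a copy determines its projections, hence both \<open>\<psi>1\<close> and \<open>\<psi>2\<close>. The number of copies
through \<open>(x, y)\<close> is the product of the numbers through \<open>x\<close> and through \<open>y\<close>, and the product has at most
as many vertices as the product of the vertex numbers.\<close>

lemma host_cprod:
  assumes h1: "host \<epsilon>1 G1 \<kappa>1" and h2: "host \<epsilon>2 G2 \<kappa>2" and "0 < \<epsilon>1" "0 < \<epsilon>2"
  shows "host (\<epsilon>1 * \<epsilon>2) (cprod G1 \<kappa>1 G2 \<kappa>2) (cprod_col G1 \<kappa>1 G2 \<kappa>2)"
proof -
  let ?W = "cverts G1 \<kappa>1 G2 \<kappa>2" and ?G = "cprod G1 \<kappa>1 G2 \<kappa>2" and ?\<kappa> = "cprod_col G1 \<kappa>1 G2 \<kappa>2"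
  have finW: "finite ?W"
    by (rule finite_subset[OF cverts_subset]) (use host_finite[OF h1] host_finite[OF h2] in auto)
  obtain \<C>1 where \<C>1: "packing G1 \<kappa>1 \<C>1"
    "\<forall>v\<in>verts G1. \<epsilon>1 * real (card (verts G1)) ^ (r - 1) \<le> real (card {\<psi> \<in> \<C>1. \<psi> (\<kappa>1 v) = v})"
    using host_packing[OF h1] by blast
  obtain \<C>2 where \<C>2: "packing G2 \<kappa>2 \<C>2"
    "\<forall>v\<in>verts G2. \<epsilon>2 * real (card (verts G2)) ^ (r - 1) \<le> real (card {\<psi> \<in> \<C>2. \<psi> (\<kappa>2 v) = v})"
    using host_packing[OF h2] by blast
  let ?h = "\<lambda>(\<psi>1, \<psi>2). restrict (\<lambda>a. (\<psi>1 a, \<psi>2 a)) (verts F)"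
  have in_W: "(\<psi>1 a, \<psi>2 a) \<in> ?W" if "\<psi>1 \<in> \<C>1" "\<psi>2 \<in> \<C>2" "a \<in> verts F" for \<psi>1 \<psi>2 a
    using packing_section[OF \<C>1(1) that(1,3)] packing_section[OF \<C>2(1) that(2,3)]
    by (simp add: cverts_def)
  have pack: "packing ?G ?\<kappa> (?h ` (\<C>1 \<times> \<C>2))"
  proof (rule packingI)
    fix \<psi> a assume "\<psi> \<in> ?h ` (\<C>1 \<times> \<C>2)" "a \<in> verts F"
    then show "\<psi> a \<in> verts ?G \<and> ?\<kappa> (\<psi> a) = a"
      using in_W packing_section(2)[OF \<C>1(1)] by (auto simp: cprod_def cprod_col_def)
  next
    fix \<psi> e assume "\<psi> \<in> ?h ` (\<C>1 \<times> \<C>2)" and e: "e \<in> edges F"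
    then obtain \<psi>1 \<psi>2 where \<psi>: "\<psi>1 \<in> \<C>1" "\<psi>2 \<in> \<C>2" "\<psi> = ?h (\<psi>1, \<psi>2)" by auto
    have eF: "e \<subseteq> verts F" "card e = r" using r_graph_edge[OF r_graph_F e] by auto
    have img: "\<psi> ` e = (\<lambda>a. (\<psi>1 a, \<psi>2 a)) ` e"
      using \<psi>(3) eF by (auto simp: subset_iff intro!: image_cong)
    have "inj_on (\<lambda>a. (\<psi>1 a, \<psi>2 a)) e"
      by (rule inj_on_inverseI[where g = "\<kappa>1 \<circ> fst"])
         (use packing_section(2)[OF \<C>1(1) \<psi>(1)] eF in auto)
    then have "card (\<psi> ` e) = r" using eF img by (simp add: card_image)
    moreover have "fst ` \<psi> ` e = \<psi>1 ` e" "snd ` \<psi> ` e = \<psi>2 ` e"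
      unfolding img by (auto simp: image_image)
    moreover have "\<psi> ` e \<subseteq> ?W"
      unfolding img using in_W[OF \<psi>(1,2)] eF by auto
    ultimately show "\<psi> ` e \<in> edges ?G"
      using packing_edge[OF \<C>1(1) \<psi>(1) e] packing_edge[OF \<C>2(1) \<psi>(2) e] by (simp add: cprod_def)
  next
    fix \<psi> \<chi> e
    assume "\<psi> \<in> ?h ` (\<C>1 \<times> \<C>2)" "\<chi> \<in> ?h ` (\<C>1 \<times> \<C>2)" and e: "e \<in> edges F" and eq: "\<And>a. a \<in> e \<Longrightarrow> \<psi> a = \<chi> a"
    then obtain \<psi>1 \<psi>2 \<chi>1 \<chi>2 where \<psi>: "\<psi>1 \<in> \<C>1" "\<psi>2 \<in> \<C>2" "\<psi> = ?h (\<psi>1, \<psi>2)"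
      and \<chi>: "\<chi>1 \<in> \<C>1" "\<chi>2 \<in> \<C>2" "\<chi> = ?h (\<chi>1, \<chi>2)" by auto
    have "\<psi>1 a = \<chi>1 a \<and> \<psi>2 a = \<chi>2 a" if "a \<in> e" for a
      using eq[OF that] \<psi>(3) \<chi>(3) that r_graph_edge[OF r_graph_F e] by auto
    then have "\<psi>1 ` e = \<chi>1 ` e" "\<psi>2 ` e = \<chi>2 ` e" by (auto intro!: image_cong)
    then show "\<psi> = \<chi>"
      using packing_determined[OF \<C>1(1) \<psi>(1) \<chi>(1) e] packing_determined[OF \<C>2(1) \<psi>(2) \<chi>(2) e] \<psi> \<chi> by simp
  qed auto
  have G: "r_graph r ?G"
    using r_graph_tensor[OF finW] by (simp add: cprod_def)
  have hom: "?\<kappa> \<in> homs ?G F"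
  proof -
    have "?\<kappa> ` e \<in> edges F" if "e \<in> edges ?G" for e
    proof -
      have e: "e \<subseteq> ?W" "fst ` e \<in> edges G1" using that by (auto simp: cprod_def)
      then have "?\<kappa> ` e = \<kappa>1 ` fst ` e"
        by (auto simp: cprod_col_def image_image subset_iff intro!: image_cong)
      then show ?thesis using host_hom[OF h1] e by (simp add: homs_def)
    qed
    moreover have "?\<kappa> \<in> verts ?G \<rightarrow>\<^sub>E verts F"
      using host_col[OF h2] by (auto simp: cprod_def cprod_col_def cverts_def)
    ultimately show ?thesis by (simp add: homs_def)
  qed
  have ne: "verts ?G \<noteq> {}"
  proof -
    obtain a where a: "a \<in> verts F" using verts_F_ne by auto
    have "card (part G1 \<kappa>1 a) > 0" "card (part G2 \<kappa>2 a) > 0"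
      using part_lower_bound[OF h1 \<open>0 < \<epsilon>1\<close> a] part_lower_bound[OF h2 \<open>0 < \<epsilon>2\<close> a]
        host_card[OF h1] host_card[OF h2] assms(3,4)
      by (metis (no_types, opaque_lifting) gr0I mult_pos_pos not_le of_nat_0 of_nat_0_less_iff)+
    then have "part ?G ?\<kappa> a \<noteq> {}"
      unfolding part_cprod by (auto simp: card_gt_0_iff)
    then show ?thesis by (auto simp: part_def)
  qed
  show ?thesis
  proof (rule hostI[OF G hom ne pack])
    fix w assume w: "w \<in> verts ?G"
    then obtain x y where xy: "w = (x, y)" "x \<in> verts G1" "y \<in> verts G2" "\<kappa>1 x = \<kappa>2 y"
      by (auto simp: cprod_def cverts_def)
    let ?a = "\<kappa>1 x"
    have col: "?\<kappa> w = ?a" using w xy(1) by (simp add: cprod_def cprod_col_def)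
    let ?P1 = "{\<psi> \<in> \<C>1. \<psi> ?a = x}" and ?P2 = "{\<psi> \<in> \<C>2. \<psi> ?a = y}"
    have "card (?P1 \<times> ?P2) \<le> card {\<psi> \<in> ?h ` (\<C>1 \<times> \<C>2). \<psi> ?a = w}"
    proof (rule card_inj_on_le[where f = ?h])
      show "inj_on ?h (?P1 \<times> ?P2)"
      proof (rule inj_onI)
        fix p q assume "p \<in> ?P1 \<times> ?P2" "q \<in> ?P1 \<times> ?P2" "?h p = ?h q"
        then obtain \<psi>1 \<psi>2 \<chi>1 \<chi>2 where pq: "p = (\<psi>1, \<psi>2)" "q = (\<chi>1, \<chi>2)"
          and *: "?h (\<psi>1, \<psi>2) = ?h (\<chi>1, \<chi>2)" "\<psi>1 \<in> \<C>1" "\<psi>2 \<in> \<C>2" "\<chi>1 \<in> \<C>1" "\<chi>2 \<in> \<C>2"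
          by (cases p; cases q) auto
        have "\<psi>1 a = \<chi>1 a \<and> \<psi>2 a = \<chi>2 a" if "a \<in> verts F" for a
          using fun_cong[OF *(1), of a] that by simp
        then show "p = q"
          using extensionalityI[OF packing_extensional[OF \<C>1(1) *(2)] packing_extensional[OF \<C>1(1) *(4)]]
            extensionalityI[OF packing_extensional[OF \<C>2(1) *(3)] packing_extensional[OF \<C>2(1) *(5)]]
          unfolding pq by blast
      qed
      show "?h ` (?P1 \<times> ?P2) \<subseteq> {\<psi> \<in> ?h ` (\<C>1 \<times> \<C>2). \<psi> ?a = w}"
        using host_col[OF h1 xy(2)] xy(1) by auto
      show "finite {\<psi> \<in> ?h ` (\<C>1 \<times> \<C>2). \<psi> ?a = w}"
        using finite_packing[OF \<C>1(1) host_finite[OF h1]] finite_packing[OF \<C>2(1) host_finite[OF h2]] by auto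
    qed
    then have le: "real (card ?P1) * real (card ?P2) \<le> real (card {\<psi> \<in> ?h ` (\<C>1 \<times> \<C>2). \<psi> ?a = w})"
      unfolding card_cartesian_product by (simp only: of_nat_mult[symmetric] of_nat_le_iff)
    have "card ?W \<le> card (verts G1) * card (verts G2)"
      unfolding card_cartesian_product[symmetric]
      using host_finite[OF h1] host_finite[OF h2] by (intro card_mono cverts_subset) auto
    then have N: "real (card (verts ?G)) \<le> real (card (verts G1)) * real (card (verts G2))"
      by (simp add: cprod_def flip: of_nat_mult)
    have "\<epsilon>1 * \<epsilon>2 * real (card (verts ?G)) ^ (r - 1)
        \<le> \<epsilon>1 * \<epsilon>2 * (real (card (verts G1)) * real (card (verts G2))) ^ (r - 1)"
      using N assms(3,4) by (intro mult_left_mono power_mono) auto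
    also have "\<dots> = (\<epsilon>1 * real (card (verts G1)) ^ (r - 1)) * (\<epsilon>2 * real (card (verts G2)) ^ (r - 1))"
      by (simp add: power_mult_distrib mult_ac)
    also have "\<dots> \<le> real (card ?P1) * real (card ?P2)"
      using bspec[OF \<C>1(2) xy(2)] bspec[OF \<C>2(2) xy(3)] xy(4) assms(3,4) by (intro mult_mono) auto
    finally show "\<epsilon>1 * \<epsilon>2 * real (card (verts ?G)) ^ (r - 1)
        \<le> real (card {\<psi> \<in> ?h ` (\<C>1 \<times> \<C>2). \<psi> (?\<kappa> w) = w})"
      unfolding col using le by linarith
  qed
qed

text \<open>Only the balance of the second factor enters, so in an iterated product the loss is a single factor
\<open>\<beta>\<close> per multiplication.\<close>

lemma card_cprod_lower:
  assumes h1: "host \<epsilon>1 G1 \<kappa>1" and h2: "host \<epsilon>2 G2 \<kappa>2" and "0 < \<epsilon>1" "0 < \<epsilon>2"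
    and \<beta>: "\<And>a. a \<in> verts F \<Longrightarrow> \<beta> * real (card (verts G2)) \<le> real (card (part G2 \<kappa>2 a))"
  shows "\<beta> * real (card (verts G1)) * real (card (verts G2)) \<le> real (card (verts (cprod G1 \<kappa>1 G2 \<kappa>2)))"
proof -
  have "\<beta> * real (card (verts G1)) * real (card (verts G2))
    = (\<Sum>a\<in>verts F. real (card (part G1 \<kappa>1 a)) * (\<beta> * real (card (verts G2))))"
    by (simp add: card_eq_sum_parts[OF h1] sum_distrib_right sum_distrib_left mult_ac)
  also have "\<dots> \<le> (\<Sum>a\<in>verts F. real (card (part G1 \<kappa>1 a)) * real (card (part G2 \<kappa>2 a)))"
    using \<beta> by (intro sum_mono mult_left_mono) auto
  also have "\<dots> = real (card (verts (cprod G1 \<kappa>1 G2 \<kappa>2)))"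
    by (simp add: card_eq_sum_parts[OF host_cprod[OF assms(1-4)]] part_cprod card_cartesian_product)
  finally show ?thesis .
qed

lemma card_lhoms_cprod_le:
  assumes "r_graph s H" "host \<epsilon>1 G1 \<kappa>1" "host \<epsilon>2 G2 \<kappa>2"
  shows "card (lhoms H L (cprod G1 \<kappa>1 G2 \<kappa>2) (cprod_col G1 \<kappa>1 G2 \<kappa>2))
    \<le> card (lhoms H L G1 \<kappa>1) * card (lhoms H L G2 \<kappa>2)"
  unfolding cprod_def
  by (rule card_lhoms_tensor_le[OF assms(1) host_finite[OF assms(2)] host_finite[OF assms(3)] cverts_subset])
     (auto simp: cprod_col_def cverts_def)

lemma thin_cprod:
  fixes G1 :: "'a hypergraph" and G2 :: "'b hypergraph"
  assumes h1: "host \<epsilon>1 G1 \<kappa>1" and h2: "host \<epsilon>2 G2 \<kappa>2" and thin: "thin \<delta> G2 \<kappa>2" and "0 \<le> \<delta>"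
  shows "thin \<delta> (cprod G1 \<kappa>1 G2 \<kappa>2) (cprod_col G1 \<kappa>1 G2 \<kappa>2)"
  unfolding thin_def
proof (intro allI impI)
  fix S :: "('a \<times> 'b) set" and a assume S: "card S = r - 1"
  let ?G = "cprod G1 \<kappa>1 G2 \<kappa>2" and ?\<kappa> = "cprod_col G1 \<kappa>1 G2 \<kappa>2"
  let ?P = "{w \<in> part ?G ?\<kappa> a. insert w S \<in> edges ?G}"
  let ?Q = "{y \<in> part G2 \<kappa>2 a. insert y (snd ` S) \<in> edges G2}"
  have finS: "finite S" using S r_ge_2 by (auto intro: card_ge_0_finite)
  have finQ: "finite (part G1 \<kappa>1 a \<times> ?Q)"
    using host_finite[OF h1] host_finite[OF h2] by (auto simp: part_def)
  have sub: "?P \<subseteq> part G1 \<kappa>1 a \<times> ?Q"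
    unfolding part_cprod by (auto simp: cprod_def)
  show "real (card ?P) \<le> \<delta> * real (card (part ?G ?\<kappa> a))"
  proof (cases "?P = {}")
    case True
    show ?thesis unfolding True using \<open>0 \<le> \<delta>\<close> by simp
  next
    case False
    then obtain w where "insert w S \<in> edges ?G" by auto
    then have "insert (snd w) (snd ` S) \<in> edges G2" by (simp add: cprod_def)
    then have "card (insert (snd w) (snd ` S)) = r"
      using r_graph_edge[OF host_r_graph[OF h2]] by blast
    then have "r \<le> Suc (card (snd ` S))"
      using finS by (auto simp: card_insert_if split: if_splits)
    moreover have "card (snd ` S) \<le> r - 1"
      using card_image_le[OF finS, of snd] S by simp
    ultimately have "card (snd ` S) = r - 1" by simp
    then have Q: "real (card ?Q) \<le> \<delta> * real (card (part G2 \<kappa>2 a))"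
      using thin by (simp add: thin_def)
    have "card ?P \<le> card (part G1 \<kappa>1 a) * card ?Q"
      unfolding card_cartesian_product[symmetric] by (rule card_mono[OF finQ sub])
    then have "real (card ?P) \<le> real (card (part G1 \<kappa>1 a)) * real (card ?Q)"
      by (rule of_nat_le_mult)
    also have "\<dots> \<le> real (card (part G1 \<kappa>1 a)) * (\<delta> * real (card (part G2 \<kappa>2 a)))"
      by (rule mult_left_mono[OF Q]) simp
    finally show ?thesis
      unfolding part_cprod by (simp add: card_cartesian_product mult_ac)
  qed
qed

section \<open>Reed-Solomon hypergraphs\<close>

text \<open>A numbering of the vertices of \<open>F\<close>; the numbers serve as evaluation points.\<close>

definition idx :: "'f \<Rightarrow> nat" where
  "idx = (SOME h. bij_betw h (verts F) {0..<k})"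

lemma idx: "bij_betw idx (verts F) {0..<k}"
  unfolding idx_def by (rule someI_ex[OF ex_bij_betw_finite_nat[OF finite_F]])

lemma idx_less: "a \<in> verts F \<Longrightarrow> idx a < k"
  using bij_betw_apply[OF idx] by fastforce

lemma idx_inj: "inj_on idx (verts F)"
  using idx by (rule bij_betw_imp_inj_on)

definition rs_poly :: "nat \<Rightarrow> (nat \<Rightarrow> int) \<Rightarrow> int poly" where
  "rs_poly d c = (\<Sum>j<d. monom (c j) j)"

definition rs_coeffs :: "nat \<Rightarrow> nat \<Rightarrow> (nat \<Rightarrow> int) set" where
  "rs_coeffs p d = {..<d} \<rightarrow>\<^sub>E {0..<int p}"

definition rs_copy :: "nat \<Rightarrow> nat \<Rightarrow> (nat \<Rightarrow> int) \<Rightarrow> 'f \<Rightarrow> 'f \<times> int" where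
  "rs_copy p d c = restrict (\<lambda>a. (a, poly (rs_poly d c) (int (idx a)) mod int p)) (verts F)"

text \<open>Each part is a copy of the integers modulo \<open>p\<close>, and the edges are those of the copies of \<open>F\<close> given by
the polynomials of degree less than \<open>d\<close>. For \<open>d = r\<close> any \<open>r\<close> vertices in distinct parts lie on a unique
polynomial and the hypergraph is a complete \<open>F\<close>-partite one, decomposed into copies of \<open>F\<close>; for
\<open>d = r - 1\<close> already \<open>r - 1\<close> vertices determine the polynomial.\<close>

definition rs_graph :: "nat \<Rightarrow> nat \<Rightarrow> ('f \<times> int) hypergraph" where
  "rs_graph p d = Hypergraph (verts F \<times> {0..<int p}) {rs_copy p d c ` e |c e. c \<in> rs_coeffs p d \<and> e \<in> edges F}"

definition rs_col :: "nat \<Rightarrow> 'f \<times> int \<Rightarrow> 'f" where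
  "rs_col p = restrict fst (verts F \<times> {0..<int p})"

lemma coeff_rs_poly: "coeff (rs_poly d c) j = (if j < d then c j else 0)"
  by (simp add: rs_poly_def coeff_sum)

lemma poly_rs_poly: "poly (rs_poly d c) x = (\<Sum>j<d. c j * x ^ j)"
  by (simp add: rs_poly_def poly_sum poly_monom)

lemma rs_copy_apply: "a \<in> verts F \<Longrightarrow> rs_copy p d c a = (a, poly (rs_poly d c) (int (idx a)) mod int p)"
  by (simp add: rs_copy_def)

text \<open>Lagrange interpolation: two polynomials of degree less than \<open>d\<close> with the same values modulo \<open>p\<close> in \<open>d\<close> points
have coefficients that are congruent, hence equal since they are reduced modulo \<open>p\<close>. The assumption
\<open>k \<le> p\<close> makes the evaluation points distinct modulo \<open>p\<close>.\<close>

lemma rs_coeffs_determined: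
  assumes p: "prime p" "k \<le> p" and d: "0 < d"
    and c: "c \<in> rs_coeffs p d" "c' \<in> rs_coeffs p d"
    and A: "A \<subseteq> verts F" "d \<le> card A" "\<And>a. a \<in> A \<Longrightarrow> rs_copy p d c a = rs_copy p d c' a"
  shows "c = c'"
proof -
  define f where "f = rs_poly d c - rs_poly d c'"
  let ?S = "(\<lambda>a. int (idx a)) ` A"
  have finA: "finite A" using A(1) finite_F by (rule finite_subset)
  have inj: "inj_on (\<lambda>a. int (idx a)) A"
    using idx_inj A(1) by (auto simp: inj_on_def)
  have "degree f \<le> d - 1"
    by (rule degree_le) (auto simp: f_def coeff_rs_poly)
  then have deg: "degree f < card ?S"
    using d A(2) by (simp add: card_image[OF inj])
  have "[:int p:] dvd f"
  proof (rule prime_dvd_poly_with_many_roots[OF _ _ refl deg])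
    fix x y assume xy: "x \<in> ?S" "y \<in> ?S" "int p dvd x - y"
    have "0 \<le> z \<and> z < int p" if "z \<in> ?S" for z
      using that idx_less A(1) p(2) by fastforce
    then show "x = y" using dvd_diff_imp_eq[OF xy(3)] xy by blast
  next
    fix x assume "x \<in> ?S"
    then obtain a where a: "a \<in> A" "x = int (idx a)" by auto
    have "poly (rs_poly d c) x mod int p = poly (rs_poly d c') x mod int p"
      using A(3)[OF a(1)] A(1) a by (auto simp: rs_copy_apply)
    then show "int p dvd poly f x"
      by (simp add: f_def mod_eq_dvd_iff)
  qed (use p finA in auto)
  then have dvd: "int p dvd c j - c' j" if "j < d" for j
    using that by (auto simp: const_poly_dvd_iff f_def coeff_rs_poly dest: spec[of _ j])
  have "c j = c' j" if "j < d" for j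
  proof -
    have "c j \<in> {0..<int p}" "c' j \<in> {0..<int p}"
      using c that unfolding rs_coeffs_def by blast+
    then show ?thesis using dvd_diff_imp_eq[OF dvd[OF that]] by auto
  qed
  then show ?thesis
    using c unfolding rs_coeffs_def by (intro PiE_ext[of c _ _ c']) auto
qed

lemma rs_r_graph: "r_graph r (rs_graph p d)" if "0 < p"
proof -
  have "rs_copy p d c ` e \<subseteq> verts F \<times> {0..<int p} \<and> card (rs_copy p d c ` e) = r" if e: "e \<in> edges F" for c e
  proof -
    have eF: "e \<subseteq> verts F" "card e = r" using r_graph_edge[OF r_graph_F e] by auto
    then have "inj_on (rs_copy p d c) e"
      by (intro inj_on_inverseI[where g = fst]) (auto simp: rs_copy_apply)
    then show ?thesis
      using eF \<open>0 < p\<close> by (auto simp: card_image rs_copy_apply)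
  qed
  then show ?thesis by (auto simp: r_graph_def rs_graph_def)
qed

lemma rs_col_hom: "rs_col p \<in> homs (rs_graph p d) F" if "0 < p"
proof -
  have "rs_col p ` rs_copy p d c ` e = e" if e: "e \<in> edges F" for c e
  proof -
    have "rs_col p ` rs_copy p d c ` e = (\<lambda>a. a) ` e"
      unfolding image_image
      using r_graph_edge[OF r_graph_F e] \<open>0 < p\<close>
      by (intro image_cong) (auto simp: rs_copy_apply rs_col_def)
    then show ?thesis by simp
  qed
  then show ?thesis by (auto simp: homs_def rs_graph_def rs_col_def)
qed

lemma part_rs: "part (rs_graph p d) (rs_col p) a = (if a \<in> verts F then {a} \<times> {0..<int p} else {})"
  by (auto simp: part_def rs_graph_def rs_col_def)

text \<open>Two polynomials that agree on an edge agree in \<open>r \<ge> d\<close> points, so they coincide and the copies are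
edge-disjoint. Through a vertex \<open>(a, x)\<close> there are \<open>p ^ (d - 1)\<close> copies: the higher coefficients are
arbitrary and the constant one is then forced.\<close>

lemma host_rs:
  assumes p: "prime p" "k \<le> p" and d: "0 < d" "d \<le> r"
  shows "host (real p ^ (d - 1) / (real k * real p) ^ (r - 1)) (rs_graph p d) (rs_col p)"
proof -
  have p0: "0 < p" using p(1) by (rule prime_gt_0_nat)
  let ?\<C> = "rs_copy p d ` rs_coeffs p d"
  have fin: "finite ?\<C>" by (auto simp: rs_coeffs_def intro!: finite_PiE)
  have pack: "packing (rs_graph p d) (rs_col p) ?\<C>"
  proof (rule packingI)
    fix \<psi> \<chi> e assume "\<psi> \<in> ?\<C>" "\<chi> \<in> ?\<C>" and e: "e \<in> edges F" and eq: "\<And>a. a \<in> e \<Longrightarrow> \<psi> a = \<chi> a"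
    then obtain c c' where c: "c \<in> rs_coeffs p d" "c' \<in> rs_coeffs p d" "\<psi> = rs_copy p d c" "\<chi> = rs_copy p d c'"
      by auto
    have "c = c'"
      by (rule rs_coeffs_determined[OF p d(1) c(1,2), of e])
         (use r_graph_edge[OF r_graph_F e] d eq c in auto)
    then show "\<psi> = \<chi>" using c by simp
  qed (use p0 in \<open>auto simp: rs_graph_def rs_col_def rs_copy_apply\<close>, auto simp: rs_copy_def)
  show ?thesis
  proof (rule hostI[OF rs_r_graph[OF p0] rs_col_hom[OF p0] _ pack])
    show "verts (rs_graph p d) \<noteq> {}"
      using verts_F_ne p0 by (auto simp: rs_graph_def)
    fix v assume "v \<in> verts (rs_graph p d)"
    then obtain a x where v: "v = (a, x)" "a \<in> verts F" "0 \<le> x" "x < int p"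
      by (auto simp: rs_graph_def)
    have col: "rs_col p v = a" using v by (simp add: rs_col_def)
    let ?B = "{1..<d} \<rightarrow>\<^sub>E {0..<int p}"
    let ?X = "int (idx a)"
    \<comment> \<open>the constant coefficient that makes the value at \<open>a\<close> equal to \<open>x\<close>\<close>
    define fill where "fill c = c(0 := (x - (\<Sum>j=1..<d. c j * ?X ^ j)) mod int p)" for c :: "nat \<Rightarrow> int"
    have split: "{..<d} = insert 0 {1..<d}" using d by auto
    have fill: "fill c \<in> rs_coeffs p d" if "c \<in> ?B" for c
      using that p0 unfolding rs_coeffs_def split fill_def by (intro PiE_fun_upd) auto
    have val: "rs_copy p d (fill c) a = v" for c
    proof -
      have "poly (rs_poly d (fill c)) ?X = fill c 0 + (\<Sum>j=1..<d. fill c j * ?X ^ j)"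
        unfolding poly_rs_poly split by simp
      also have "(\<Sum>j=1..<d. fill c j * ?X ^ j) = (\<Sum>j=1..<d. c j * ?X ^ j)"
        by (rule sum.cong) (auto simp: fill_def)
      also have "fill c 0 = (x - (\<Sum>j=1..<d. c j * ?X ^ j)) mod int p"
        by (simp add: fill_def)
      finally have "poly (rs_poly d (fill c)) ?X mod int p = x mod int p"
        by (simp only: mod_simps diff_add_cancel)
      then show ?thesis using v by (simp add: rs_copy_apply)
    qed
    have "card ?B \<le> card {\<psi> \<in> ?\<C>. \<psi> a = v}"
    proof (rule card_inj_on_le[where f = "\<lambda>c. rs_copy p d (fill c)"])
      show "inj_on (\<lambda>c. rs_copy p d (fill c)) ?B"
      proof (rule inj_onI)
        fix c c' assume *: "c \<in> ?B" "c' \<in> ?B" "rs_copy p d (fill c) = rs_copy p d (fill c')"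
        have "fill c = fill c'"
          by (rule rs_coeffs_determined[OF p d(1) fill[OF *(1)] fill[OF *(2)], of "verts F"])
             (use *(3) d r_le_k in auto)
        then have eq: "fill c j = fill c' j" for j by (rule fun_cong)
        have "c j = c' j" if "j \<in> {1..<d}" for j
          using eq[of j] that by (simp add: fill_def)
        then show "c = c'" by (rule PiE_ext[OF *(1,2)])
      qed
    qed (use fill val fin in auto)
    then have "p ^ (d - 1) \<le> card {\<psi> \<in> ?\<C>. \<psi> a = v}"
      by (simp add: card_PiE)
    then have le: "real p ^ (d - 1) \<le> real (card {\<psi> \<in> ?\<C>. \<psi> a = v})"
      by (simp flip: of_nat_power)
    have n: "real (card (verts (rs_graph p d))) = real k * real p"
      by (simp add: rs_graph_def card_cartesian_product)
    have nz: "(real k * real p) ^ (r - 1) \<noteq> 0" using verts_F_ne p0 by simp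
    have "real p ^ (d - 1) / (real k * real p) ^ (r - 1) * real (card (verts (rs_graph p d))) ^ (r - 1) = real p ^ (d - 1)"
      unfolding n times_divide_eq_left by (rule nonzero_mult_div_cancel_right[OF nz])
    then show "real p ^ (d - 1) / (real k * real p) ^ (r - 1) * real (card (verts (rs_graph p d))) ^ (r - 1)
        \<le> real (card {\<psi> \<in> ?\<C>. \<psi> (rs_col p v) = v})"
      unfolding col using le by simp
  qed
qed

text \<open>All vertices of an edge lie on one polynomial of degree less than \<open>r - 1\<close>, which is already determined by
the \<open>r - 1\<close> vertices in \<open>S\<close>. So a part, which has \<open>p\<close> vertices, contains at most one completion of \<open>S\<close>.\<close>

lemma thin_rs:
  assumes p: "prime p" "k \<le> p"
  shows "thin (1 / real p) (rs_graph p (r - 1)) (rs_col p)"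
  unfolding thin_def
proof (intro allI impI)
  fix S :: "('f \<times> int) set" and a assume S: "card S = r - 1"
  let ?P = "{x \<in> part (rs_graph p (r - 1)) (rs_col p) a. insert x S \<in> edges (rs_graph p (r - 1))}"
  have p0: "0 < p" using p(1) by (rule prime_gt_0_nat)
  have unique: "x = y" if xy: "x \<in> ?P" "y \<in> ?P" for x y
  proof -
    have ex: "\<exists>c\<in>rs_coeffs p (r - 1). \<exists>e\<in>edges F. insert z S = rs_copy p (r - 1) c ` e" if "z \<in> ?P" for z
      using that by (auto simp: rs_graph_def)
    obtain c e where c: "c \<in> rs_coeffs p (r - 1)" "e \<in> edges F" "insert x S = rs_copy p (r - 1) c ` e"
      using ex[OF xy(1)] by blast
    obtain c' e' where c': "c' \<in> rs_coeffs p (r - 1)" "e' \<in> edges F" "insert y S = rs_copy p (r - 1) c' ` e'"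
      using ex[OF xy(2)] by blast
    have eF: "e \<subseteq> verts F" "e' \<subseteq> verts F"
      using r_graph_edge[OF r_graph_F c(2)] r_graph_edge[OF r_graph_F c'(2)] by auto
    have on_c: "s = rs_copy p (r - 1) c (fst s) \<and> fst s \<in> verts F" if "s \<in> insert x S" for s
      using that eF unfolding c(3) by (auto simp: rs_copy_apply subset_iff)
    have on_c': "s = rs_copy p (r - 1) c' (fst s)" if "s \<in> insert y S" for s
      using that eF unfolding c'(3) by (auto simp: rs_copy_apply subset_iff)
    have "inj_on fst S"
      by (rule inj_on_inverseI[where g = "rs_copy p (r - 1) c"]) (use on_c in auto)
    then have card: "card (fst ` S) = r - 1" using S by (simp add: card_image)
    have "c = c'"
    proof (rule rs_coeffs_determined[OF p _ c(1) c'(1), of "fst ` S"])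
      fix b assume "b \<in> fst ` S"
      then obtain s where "s \<in> S" "b = fst s" by auto
      then show "rs_copy p (r - 1) c b = rs_copy p (r - 1) c' b"
        using on_c[of s] on_c'[of s] by simp
    qed (use card r_ge_2 on_c in auto)
    moreover have "fst x = a" "fst y = a"
      using xy by (auto simp: part_rs split: if_splits)
    ultimately show ?thesis
      using on_c[of x] on_c'[of y] by simp
  qed
  have "finite ?P"
    by (rule finite_subset[of _ "verts F \<times> {0..<int p}"]) (auto simp: part_rs split: if_splits)
  then have "card ?P \<le> Suc 0"
    using unique card_le_Suc0_iff_eq by blast
  moreover have "?P = {}" if "a \<notin> verts F" using that by (auto simp: part_rs)
  ultimately show "real (card ?P) \<le> 1 / real p * real (card (part (rs_graph p (r - 1)) (rs_col p) a))"
    using p0 by (cases "a \<in> verts F") (auto simp: part_rs card_cartesian_product)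
qed

end

section \<open>Counting homomorphisms vertex by vertex\<close>

definition induced :: "'h hypergraph \<Rightarrow> 'h set \<Rightarrow> 'h hypergraph" where
  "induced H X = Hypergraph X {e \<in> edges H. e \<subseteq> X}"

definition covered_verts :: "'h hypergraph \<Rightarrow> 'h set" where
  "covered_verts H = {v \<in> verts H. \<exists>e\<in>edges H. v \<in> e}"

lemma verts_induced [simp]: "verts (induced H X) = X"
  and edges_induced [simp]: "edges (induced H X) = {e \<in> edges H. e \<subseteq> X}"
  by (simp_all add: induced_def)

lemma r_graph_induced: "r_graph r H \<Longrightarrow> X \<subseteq> verts H \<Longrightarrow> r_graph r (induced H X)"
  by (auto simp: r_graph_def intro: finite_subset)

lemma induced_verts: "r_graph r H \<Longrightarrow> induced H (verts H) = H"
  by (rule hypergraph.expand) (auto simp: r_graph_def)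

lemma edges_induced_covered: "r_graph r H \<Longrightarrow> edges (induced H (covered_verts H)) = edges H"
  by (auto simp: r_graph_def covered_verts_def)

lemma restrict_lhoms:
  assumes "\<phi> \<in> lhoms (induced H Y) L G \<kappa>" "X \<subseteq> Y"
  shows "restrict \<phi> X \<in> lhoms (induced H X) L G \<kappa>"
proof -
  have "restrict \<phi> X ` e = \<phi> ` e" if "e \<subseteq> X" for e
    using that by (auto simp: subset_iff intro!: image_cong)
  then show ?thesis
    using assms by (auto simp: lhoms_def homs_def subset_iff)
qed

lemma card_lhoms_extend:
  assumes fin: "finite X" "finite (verts G)" and v: "v \<notin> X"
    and K: "\<And>\<phi>. \<phi> \<in> lhoms (induced H X) L G \<kappa> \<Longrightarrow>
      real (card {x \<in> verts G. \<phi>(v := x) \<in> lhoms (induced H (insert v X)) L G \<kappa>}) \<le> K"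
  shows "real (card (lhoms (induced H (insert v X)) L G \<kappa>)) \<le> real (card (lhoms (induced H X) L G \<kappa>)) * K"
proof (rule card_le_by_fibres[where f = "\<lambda>\<phi>. restrict \<phi> X"])
  let ?A = "lhoms (induced H (insert v X)) L G \<kappa>"
  show "finite (lhoms (induced H X) L G \<kappa>)" "finite ?A"
    using fin by auto
  show "(\<lambda>\<phi>. restrict \<phi> X) ` ?A \<subseteq> lhoms (induced H X) L G \<kappa>"
    by (auto intro!: restrict_lhoms[of _ H "insert v X"])
  fix \<chi> assume \<chi>: "\<chi> \<in> lhoms (induced H X) L G \<kappa>"
  let ?P = "{\<phi> \<in> ?A. restrict \<phi> X = \<chi>}"
  have upd: "\<phi> = \<chi>(v := \<phi> v)" if "\<phi> \<in> ?P" for \<phi>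
  proof
    fix w
    have "\<phi> w = undefined" if "w \<notin> insert v X"
      using \<open>\<phi> \<in> ?P\<close> that by (auto simp: lhoms_def homs_def PiE_iff extensional_def)
    then show "\<phi> w = (\<chi>(v := \<phi> v)) w"
      using that by (auto simp: restrict_def)
  qed
  have "card ?P \<le> card {x \<in> verts G. \<chi>(v := x) \<in> ?A}"
  proof (rule card_inj_on_le[where f = "\<lambda>\<phi>. \<phi> v"])
    show "inj_on (\<lambda>\<phi>. \<phi> v) ?P"
    proof (rule inj_onI)
      fix \<phi>1 \<phi>2 assume "\<phi>1 \<in> ?P" "\<phi>2 \<in> ?P" "\<phi>1 v = \<phi>2 v"
      then show "\<phi>1 = \<phi>2" using upd[of \<phi>1] upd[of \<phi>2] by metis
    qed
    show "(\<lambda>\<phi>. \<phi> v) ` ?P \<subseteq> {x \<in> verts G. \<chi>(v := x) \<in> ?A}"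
    proof (rule image_subsetI)
      fix \<phi> assume "\<phi> \<in> ?P"
      then have "\<chi>(v := \<phi> v) \<in> ?A" "\<phi> v \<in> verts G"
        using upd[of \<phi>] by (auto simp: lhoms_def homs_def)
      then show "\<phi> v \<in> {x \<in> verts G. \<chi>(v := x) \<in> ?A}" by simp
    qed
  qed (use fin in auto)
  then show "real (card ?P) \<le> K"
    using K[OF \<chi>] by linarith
qed

lemma card_lhoms_extend_set:
  assumes "finite X" "finite Z" "finite (verts G)" "X \<inter> Z = {}"
  shows "real (card (lhoms (induced H (X \<union> Z)) L G \<kappa>))
    \<le> real (card (lhoms (induced H X) L G \<kappa>)) * real (card (verts G)) ^ card Z"
  using assms(2,4)
proof (induction Z rule: finite_induct)
  case empty
  then show ?case by simp
next
  case (insert v Z)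
  have "real (card (lhoms (induced H (insert v (X \<union> Z))) L G \<kappa>))
    \<le> real (card (lhoms (induced H (X \<union> Z)) L G \<kappa>)) * real (card (verts G))"
    by (rule card_lhoms_extend) (use insert assms in \<open>auto intro: card_mono\<close>)
  also have "\<dots> \<le> real (card (lhoms (induced H X) L G \<kappa>)) * real (card (verts G)) ^ card Z * real (card (verts G))"
    using insert by (intro mult_right_mono) auto
  finally show ?case
    using insert by (simp add: mult_ac)
qed

lemma card_lhoms_le_induced:
  assumes H: "r_graph s H" and "X \<subseteq> verts H" "finite (verts G)"
  shows "real (card (lhoms H L G \<kappa>))
    \<le> real (card (lhoms (induced H X) L G \<kappa>)) * real (card (verts G)) ^ (card (verts H) - card X)"
proof -
  have fin: "finite (verts H)" "finite X" using assms by (auto intro: finite_subset)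
  have "X \<union> (verts H - X) = verts H" using assms by auto
  then show ?thesis
    using card_lhoms_extend_set[of X "verts H - X" G H L \<kappa>] assms fin induced_verts[OF H]
    by (simp add: card_Diff_subset)
qed

context covered_r_graph
begin

text \<open>Once the other vertices of an edge are placed, they occupy \<open>r - 1\<close> distinct places since
homomorphisms between \<open>r\<close>-graphs are injective on edges, and thinness bounds the choices for the last vertex.\<close>

lemma card_lhoms_extend_thin:
  assumes G: "host \<epsilon> G \<kappa>" "thin \<delta> G \<kappa>" "0 \<le> \<delta>"
    and H: "r_graph r H" and X: "X \<subseteq> verts H" "v \<notin> X" and e: "e \<in> edges H" "v \<in> e" "e \<subseteq> insert v X"
  shows "real (card (lhoms (induced H (insert v X)) L G \<kappa>))
    \<le> real (card (lhoms (induced H X) L G \<kappa>)) * (\<delta> * real (card (verts G)))"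
proof (rule card_lhoms_extend)
  have eH: "e \<subseteq> verts H" "card e = r" "finite e" using r_graph_edge[OF H e(1)] by auto
  fix \<phi> assume "\<phi> \<in> lhoms (induced H X) L G \<kappa>"
  let ?Q = "{x \<in> verts G. \<phi>(v := x) \<in> lhoms (induced H (insert v X)) L G \<kappa>}"
  let ?S = "\<phi> ` (e - {v})"
  have hom: "inj_on \<phi> (e - {v}) \<and> insert x ?S \<in> edges G" if "x \<in> ?Q" for x
  proof -
    have h: "\<phi>(v := x) \<in> homs (induced H (insert v X)) G"
      using that by (simp add: lhoms_def)
    have "inj_on (\<phi>(v := x)) e"
      by (rule inj_on_edge[OF r_graph_induced[OF H] host_r_graph[OF G(1)] h]) (use X e eH in auto)
    then have "inj_on (\<phi>(v := x)) (e - {v})" by (rule inj_on_subset) auto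
    then have "inj_on \<phi> (e - {v})" by (simp add: inj_on_def)
    moreover have "(\<phi>(v := x)) ` e = insert x ?S"
      using e(2) by auto
    moreover have "(\<phi>(v := x)) ` e \<in> edges G"
      using h e by (auto simp: homs_def)
    ultimately show ?thesis by simp
  qed
  show "real (card ?Q) \<le> \<delta> * real (card (verts G))"
  proof (cases "?Q = {}")
    case True
    show ?thesis unfolding True using G(3) by simp
  next
    case False
    then obtain x where "x \<in> ?Q" by blast
    then have "inj_on \<phi> (e - {v})" using hom by blast
    then have "card ?S = r - 1"
      using eH e by (simp add: card_image)
    then have "real (card {x \<in> verts G. insert x ?S \<in> edges G}) \<le> \<delta> * real (card (verts G))"
      by (rule thin_degree[OF G(1,2)])
    moreover have "card ?Q \<le> card {x \<in> verts G. insert x ?S \<in> edges G}"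
      using host_finite[OF G(1)] hom by (intro card_mono) auto
    ultimately show ?thesis by linarith
  qed
qed (use X host_finite[OF G(1)] r_graph_finite[OF H] in \<open>auto intro: finite_subset\<close>)

text \<open>As long as some non-isolated vertex \<open>v\<close> lies outside \<open>X\<close>, place the rest of an edge containing \<open>v\<close>
freely and then \<open>v\<close> itself at the price of a factor \<open>\<delta>\<close>. Each such step enlarges \<open>X\<close> by at most \<open>r\<close>
vertices, so \<open>s * r\<close> non-isolated vertices allow \<open>s\<close> steps.\<close>

lemma thin_chain:
  assumes G: "host \<epsilon> G \<kappa>" "thin \<delta> G \<kappa>" "0 \<le> \<delta>"
    and H: "r_graph r H"
  shows "s * r \<le> card (covered_verts H) \<Longrightarrow> \<exists>X\<subseteq>verts H. card X \<le> s * r \<and>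
    real (card (lhoms (induced H X) L G \<kappa>)) \<le> \<delta> ^ s * real (card (verts G)) ^ card X"
proof (induction s)
  case 0
  have "card (lhoms (induced H {}) L G \<kappa>) \<le> 1"
    using card_lhoms_le[of "induced H {}" G L \<kappa>] host_finite[OF G(1)] by simp
  then show ?case by (intro exI[of _ "{}"]) auto
next
  case (Suc s)
  let ?n = "real (card (verts G))"
  obtain X where X: "X \<subseteq> verts H" "card X \<le> s * r"
      "real (card (lhoms (induced H X) L G \<kappa>)) \<le> \<delta> ^ s * ?n ^ card X"
    using Suc by auto
  have finX: "finite X" using X(1) r_graph_finite[OF H] by (rule finite_subset)
  have "card X < card (covered_verts H)"
    using X(2) Suc.prems r_ge_2 by simp
  then have "\<not> covered_verts H \<subseteq> X"
    using card_mono[OF finX] by (meson not_le)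
  then obtain v e where v: "v \<notin> X" "v \<in> verts H" "e \<in> edges H" "v \<in> e"
    by (auto simp: covered_verts_def)
  have eH: "e \<subseteq> verts H" "card e = r" "finite e" using r_graph_edge[OF H v(3)] by auto
  define Z where "Z = e - {v} - X"
  have Z: "finite Z" "X \<inter> Z = {}" "v \<notin> X \<union> Z" "card Z \<le> r - 1" "X \<union> Z \<subseteq> verts H"
  proof -
    have "card Z \<le> card (e - {v})" unfolding Z_def using eH by (intro card_mono) auto
    then show "card Z \<le> r - 1" using eH v by simp
  qed (use eH v X in \<open>auto simp: Z_def\<close>)
  have "real (card (lhoms (induced H (insert v (X \<union> Z))) L G \<kappa>))
      \<le> real (card (lhoms (induced H (X \<union> Z)) L G \<kappa>)) * (\<delta> * ?n)"
    by (rule card_lhoms_extend_thin[OF G H Z(5,3) v(3,4)]) (auto simp: Z_def)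
  also have "\<dots> \<le> (real (card (lhoms (induced H X) L G \<kappa>)) * ?n ^ card Z) * (\<delta> * ?n)"
    using card_lhoms_extend_set[OF finX Z(1) host_finite[OF G(1)] Z(2)] G(3)
    by (intro mult_right_mono) auto
  also have "\<dots> \<le> ((\<delta> ^ s * ?n ^ card X) * ?n ^ card Z) * (\<delta> * ?n)"
    using X(3) G(3) by (intro mult_right_mono) auto
  also have "\<dots> = \<delta> ^ Suc s * ?n ^ card (insert v (X \<union> Z))"
    using finX Z by (simp add: card_Un_disjoint power_add mult_ac)
  finally have "real (card (lhoms (induced H (insert v (X \<union> Z))) L G \<kappa>))
      \<le> \<delta> ^ Suc s * ?n ^ card (insert v (X \<union> Z))" .
  moreover have "card (insert v (X \<union> Z)) \<le> Suc s * r"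
    using finX Z X(2) r_ge_2 by (simp add: card_Un_disjoint)
  moreover have "insert v (X \<union> Z) \<subseteq> verts H"
    using Z v by auto
  ultimately show ?case by blast
qed

lemma card_lhoms_thin_le:
  assumes G: "host \<epsilon> G \<kappa>" "thin \<delta> G \<kappa>" "0 \<le> \<delta>"
    and H: "r_graph r H" and s: "s * r \<le> card (covered_verts H)"
  shows "real (card (lhoms H L G \<kappa>)) \<le> \<delta> ^ s * real (card (verts G)) ^ card (verts H)"
proof -
  let ?n = "real (card (verts G))"
  obtain X where X: "X \<subseteq> verts H"
    "real (card (lhoms (induced H X) L G \<kappa>)) \<le> \<delta> ^ s * ?n ^ card X"
    using thin_chain[OF G H s] by blast
  have le: "card X \<le> card (verts H)"
    using X(1) r_graph_finite[OF H] by (rule card_mono[rotated])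
  have "real (card (lhoms H L G \<kappa>))
    \<le> real (card (lhoms (induced H X) L G \<kappa>)) * ?n ^ (card (verts H) - card X)"
    by (rule card_lhoms_le_induced[OF H X(1) host_finite[OF G(1)]])
  also have "\<dots> \<le> (\<delta> ^ s * ?n ^ card X) * ?n ^ (card (verts H) - card X)"
    using X(2) by (rule mult_right_mono) simp
  also have "\<dots> = \<delta> ^ s * ?n ^ card (verts H)"
    using le by (simp flip: power_add)
  finally show ?thesis .
qed

text \<open>Isolated vertices can be placed independently, each anywhere in a part whose colour its list allows,
and all parts are large.\<close>

lemma card_lhoms_ge_core:
  assumes G: "host \<epsilon> G \<kappa>" "0 < \<epsilon>" and H: "r_graph r H"
    and L: "\<And>v. v \<in> verts H \<Longrightarrow> L v \<inter> verts F \<noteq> {}"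
  shows "real (card (lhoms (induced H (covered_verts H)) L G \<kappa>))
      * (\<epsilon> * real (card (verts G))) ^ (card (verts H) - card (covered_verts H))
    \<le> real (card (lhoms H L G \<kappa>))"
proof -
  let ?U = "covered_verts H" and ?n = "real (card (verts G))"
  let ?I = "verts H - ?U"
  have U: "?U \<subseteq> verts H" by (auto simp: covered_verts_def)
  have fin: "finite (verts H)" "finite ?U" "finite (verts G)"
    using H U host_finite[OF G(1)] by (auto intro: finite_subset)
  define c where "c v = (SOME a. a \<in> L v \<inter> verts F)" for v
  have c: "c v \<in> L v \<and> c v \<in> verts F" if "v \<in> verts H" for v
    using some_in_eq[of "L v \<inter> verts F"] L[OF that] by (simp add: c_def)
  let ?P = "PiE ?I (\<lambda>v. part G \<kappa> (c v))"
  let ?g = "\<lambda>(\<phi>, \<chi>). (\<lambda>v. if v \<in> ?U then \<phi> v else \<chi> v)"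
  have "(\<epsilon> * ?n) ^ card ?I = (\<Prod>v\<in>?I. \<epsilon> * ?n)"
    by (rule prod_constant[symmetric])
  also have "\<dots> \<le> (\<Prod>v\<in>?I. real (card (part G \<kappa> (c v))))"
    by (rule prod_mono) (use c part_lower_bound[OF G] G(2) in auto)
  also have "\<dots> = real (card ?P)"
    using fin by (simp add: card_PiE)
  finally have P: "(\<epsilon> * ?n) ^ card ?I \<le> real (card ?P)" .
  have "card (lhoms (induced H ?U) L G \<kappa> \<times> ?P) \<le> card (lhoms H L G \<kappa>)"
  proof (rule card_inj_on_le[where f = ?g])
    show "inj_on ?g (lhoms (induced H ?U) L G \<kappa> \<times> ?P)"
    proof (rule inj_onI)
      fix p q assume "p \<in> lhoms (induced H ?U) L G \<kappa> \<times> ?P" "q \<in> lhoms (induced H ?U) L G \<kappa> \<times> ?P" "?g p = ?g q"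
      then obtain \<phi>1 \<chi>1 \<phi>2 \<chi>2 where pq: "p = (\<phi>1, \<chi>1)" "q = (\<phi>2, \<chi>2)"
        and \<phi>: "\<phi>1 \<in> lhoms (induced H ?U) L G \<kappa>" "\<phi>2 \<in> lhoms (induced H ?U) L G \<kappa>"
        and \<chi>: "\<chi>1 \<in> ?P" "\<chi>2 \<in> ?P" and eq: "?g (\<phi>1, \<chi>1) = ?g (\<phi>2, \<chi>2)"
        by (cases p; cases q) auto
      have "\<phi>1 = \<phi>2"
      proof (rule lhoms_ext[OF \<phi>])
        fix v assume "v \<in> verts (induced H ?U)"
        then show "\<phi>1 v = \<phi>2 v" using fun_cong[OF eq, of v] by simp
      qed
      moreover have "\<chi>1 = \<chi>2"
      proof (rule PiE_ext[OF \<chi>])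
        fix v assume "v \<in> ?I"
        then show "\<chi>1 v = \<chi>2 v" using fun_cong[OF eq, of v] by simp
      qed
      ultimately show "p = q" using pq by simp
    qed
    show "?g ` (lhoms (induced H ?U) L G \<kappa> \<times> ?P) \<subseteq> lhoms H L G \<kappa>"
    proof (rule image_subsetI)
      fix p assume "p \<in> lhoms (induced H ?U) L G \<kappa> \<times> ?P"
      then obtain \<phi> \<chi> where p: "p = (\<phi>, \<chi>)" and \<phi>: "\<phi> \<in> lhoms (induced H ?U) L G \<kappa>" and \<chi>: "\<chi> \<in> ?P"
        by (cases p) auto
      have U': "\<phi> v \<in> verts G \<and> \<kappa> (\<phi> v) \<in> L v" if "v \<in> ?U" for v
        using \<phi> that by (auto simp: lhoms_def homs_def)
      have I': "\<chi> v \<in> verts G \<and> \<kappa> (\<chi> v) \<in> L v" if "v \<in> verts H" "v \<notin> ?U" for v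
        using PiE_mem[OF \<chi>, of v] that c[OF that(1)] by (auto simp: part_def)
      have "?g (\<phi>, \<chi>) ` e = \<phi> ` e" if "e \<in> edges H" for e
        using r_graph_edge[OF H that] that by (auto simp: covered_verts_def subset_iff intro!: image_cong)
      moreover have "\<phi> ` e \<in> edges G" if "e \<in> edges H" for e
        using \<phi> that edges_induced_covered[OF H] by (auto simp: lhoms_def homs_def simp del: edges_induced)
      moreover have "?g (\<phi>, \<chi>) \<in> verts H \<rightarrow>\<^sub>E verts G"
        using U' I' U PiE_arb[OF \<chi>] by (auto simp: subset_iff)
      ultimately show "?g p \<in> lhoms H L G \<kappa>"
        unfolding p using U' I' by (simp add: lhoms_def homs_def)
    qed
  qed (use fin in auto)
  then have "real (card (lhoms (induced H ?U) L G \<kappa>)) * real (card ?P) \<le> real (card (lhoms H L G \<kappa>))"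
    unfolding card_cartesian_product by (simp only: of_nat_mult[symmetric] of_nat_le_iff)
  moreover have "card ?I = card (verts H) - card ?U"
    using fin U by (simp add: card_Diff_subset)
  ultimately show ?thesis
    using mult_left_mono[OF P, of "real (card (lhoms (induced H ?U) L G \<kappa>))"] by simp
qed

end

section \<open>Suppressible patterns\<close>

lemma card_lhoms_relabel_pattern:
  assumes H: "r_graph s H" and f: "inj_on f (verts H)"
    and L: "\<And>v x. v \<in> verts H \<Longrightarrow> x \<in> verts G \<Longrightarrow> \<kappa> x \<in> L' (f v) \<longleftrightarrow> \<kappa> x \<in> L v"
  shows "card (lhoms (relabel f H) L' G \<kappa>) = card (lhoms H L G \<kappa>)"
proof (rule bij_betw_same_card)
  let ?V = "verts H" and ?g = "inv_into (verts H) f"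
  let ?to = "\<lambda>\<phi>. restrict (\<phi> \<circ> f) ?V" and ?fro = "\<lambda>\<phi>. restrict (\<phi> \<circ> ?g) (f ` ?V)"
  have img: "?to \<phi> ` e = \<phi> ` f ` e" "?fro \<chi> ` f ` e = \<chi> ` e" if "e \<in> edges H" for \<phi> \<chi> :: "_ \<Rightarrow> 'c" and e
  proof -
    have e: "e \<subseteq> ?V" using r_graph_edge[OF H that] by simp
    show "?to \<phi> ` e = \<phi> ` f ` e"
      unfolding image_image using e by (intro image_cong) auto
    show "?fro \<chi> ` f ` e = \<chi> ` e"
      unfolding image_image
    proof (intro image_cong refl)
      fix x assume "x \<in> e"
      then have "x \<in> ?V" using e by auto
      then show "?fro \<chi> (f x) = \<chi> x" using f by simp
    qed
  qed
  show "bij_betw ?to (lhoms (relabel f H) L' G \<kappa>) (lhoms H L G \<kappa>)"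
  proof (rule bij_betw_byWitness[where f' = ?fro])
    show "\<forall>\<phi>\<in>lhoms (relabel f H) L' G \<kappa>. ?fro (?to \<phi>) = \<phi>"
    proof
      fix \<phi> assume \<phi>: "\<phi> \<in> lhoms (relabel f H) L' G \<kappa>"
      then have "\<phi> \<in> extensional (f ` ?V)"
        by (auto simp: lhoms_def homs_def PiE_iff)
      then show "?fro (?to \<phi>) = \<phi>"
        using f by (intro extensionalityI[of _ "f ` ?V"]) auto
    qed
    show "\<forall>\<phi>\<in>lhoms H L G \<kappa>. ?to (?fro \<phi>) = \<phi>"
    proof
      fix \<phi> assume \<phi>: "\<phi> \<in> lhoms H L G \<kappa>"
      then have "\<phi> \<in> extensional ?V"
        by (auto simp: lhoms_def homs_def PiE_iff)
      then show "?to (?fro \<phi>) = \<phi>"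
        using f by (intro extensionalityI[of _ ?V]) auto
    qed
    show "?to ` lhoms (relabel f H) L' G \<kappa> \<subseteq> lhoms H L G \<kappa>"
    proof (rule image_subsetI)
      fix \<phi> assume \<phi>: "\<phi> \<in> lhoms (relabel f H) L' G \<kappa>"
      have V: "\<phi> (f v) \<in> verts G \<and> \<kappa> (\<phi> (f v)) \<in> L' (f v)" if "v \<in> ?V" for v
        using \<phi> that by (auto simp: lhoms_def homs_def)
      have E: "\<phi> ` f ` e \<in> edges G" if "e \<in> edges H" for e
        using \<phi> that by (auto simp: lhoms_def homs_def)
      show "?to \<phi> \<in> lhoms H L G \<kappa>"
      proof (rule lhomsI)
        show "?to \<phi> ` e \<in> edges G" if "e \<in> edges H" for e
          unfolding img(1)[OF that] by (rule E[OF that])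
      qed (use V L in auto)
    qed
    show "?fro ` lhoms H L G \<kappa> \<subseteq> lhoms (relabel f H) L' G \<kappa>"
    proof (rule image_subsetI)
      fix \<phi> assume \<phi>: "\<phi> \<in> lhoms H L G \<kappa>"
      have V: "\<phi> v \<in> verts G \<and> \<kappa> (\<phi> v) \<in> L v" if "v \<in> ?V" for v
        using \<phi> that by (auto simp: lhoms_def homs_def)
      have E: "\<phi> ` e \<in> edges G" if "e \<in> edges H" for e
        using \<phi> that by (auto simp: lhoms_def homs_def)
      show "?fro \<phi> \<in> lhoms (relabel f H) L' G \<kappa>"
      proof (rule lhomsI)
        fix d assume "d \<in> edges (relabel f H)"
        then obtain e where e: "e \<in> edges H" "d = f ` e" by auto
        show "?fro \<phi> ` d \<in> edges G"
          unfolding e(2) img(2)[OF e(1)] by (rule E[OF e(1)])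
      qed (use V L f in auto)
    qed
  qed
qed

context covered_r_graph
begin

text \<open>The bound \<open>1 / 2\<close> on \<open>\<epsilon>\<close> excludes \<open>\<epsilon> = 1\<close>, for which the condition would say nothing and the powers of
\<open>\<epsilon>\<close> would not tend to zero.\<close>

definition suppressible :: "'h hypergraph \<Rightarrow> ('h \<Rightarrow> 'f set) \<Rightarrow> bool" where
  "suppressible H L \<longleftrightarrow> (\<forall>C::nat. \<exists>\<epsilon>. 0 < \<epsilon> \<and> \<epsilon> \<le> 1 / 2 \<and> (\<exists>(G :: nat hypergraph) \<kappa>. host \<epsilon> G \<kappa> \<and>
     real (card (lhoms H L G \<kappa>)) \<le> \<epsilon> ^ C * real (card (verts G)) ^ card (verts H)))"

text \<open>Isolated vertices change the count by a factor between \<open>(\<epsilon> * n) ^ j\<close> and \<open>n ^ j\<close>, where \<open>j\<close> is their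
number; the power of \<open>\<epsilon>\<close> is absorbed by asking for the exponent \<open>C + j\<close>.\<close>

lemma suppressible_core:
  assumes H: "r_graph r H" and L: "\<And>v. v \<in> verts H \<Longrightarrow> L v \<inter> verts F \<noteq> {}" and sup: "suppressible H L"
  shows "suppressible (induced H (covered_verts H)) L"
  unfolding suppressible_def
proof
  fix C :: nat
  let ?U = "covered_verts H"
  define j where "j = card (verts H) - card ?U"
  have "card ?U \<le> card (verts H)"
    using r_graph_finite[OF H] by (intro card_mono) (auto simp: covered_verts_def)
  then have j: "card (verts H) = card ?U + j" by (simp add: j_def)
  obtain \<epsilon> G \<kappa> where *: "0 < \<epsilon>" "\<epsilon> \<le> 1 / 2" "host \<epsilon> (G :: nat hypergraph) \<kappa>"
    "real (card (lhoms H L G \<kappa>)) \<le> \<epsilon> ^ (C + j) * real (card (verts G)) ^ card (verts H)"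
    using sup unfolding suppressible_def by blast
  let ?n = "real (card (verts G))"
  have "real (card (lhoms (induced H ?U) L G \<kappa>)) * (\<epsilon> * ?n) ^ j \<le> real (card (lhoms H L G \<kappa>))"
    using card_lhoms_ge_core[OF *(3,1) H L] by (simp add: j_def)
  also have "\<dots> \<le> (\<epsilon> ^ C * ?n ^ card ?U) * (\<epsilon> * ?n) ^ j"
    using *(4) by (simp add: j power_add power_mult_distrib mult_ac)
  finally have "real (card (lhoms (induced H ?U) L G \<kappa>)) \<le> \<epsilon> ^ C * ?n ^ card ?U"
    by (rule mult_right_le_imp_le) (use *(1) host_card[OF *(3)] in simp)
  then show "\<exists>\<epsilon>. 0 < \<epsilon> \<and> \<epsilon> \<le> 1 / 2 \<and> (\<exists>(G :: nat hypergraph) \<kappa>. host \<epsilon> G \<kappa> \<and>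
     real (card (lhoms (induced H ?U) L G \<kappa>)) \<le> \<epsilon> ^ C * real (card (verts G)) ^ card (verts (induced H ?U)))"
    using * by auto
qed

text \<open>The properties of the product, transported to natural numbers as vertices so that products can be
iterated within one type.\<close>

lemma nat_cprod:
  fixes G1 :: "'a hypergraph" and G2 :: "'b hypergraph"
  assumes h1: "host \<epsilon>1 G1 \<kappa>1" and h2: "host \<epsilon>2 G2 \<kappa>2" and pos: "0 < \<epsilon>1" "0 < \<epsilon>2"
  obtains G :: "nat hypergraph" and \<kappa> where "host (\<epsilon>1 * \<epsilon>2) G \<kappa>"
    "\<And>(H :: 'h hypergraph) L s. r_graph s H \<Longrightarrow>
       card (lhoms H L G \<kappa>) \<le> card (lhoms H L G1 \<kappa>1) * card (lhoms H L G2 \<kappa>2)"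
    "\<And>\<beta>. (\<And>a. a \<in> verts F \<Longrightarrow> \<beta> * real (card (verts G2)) \<le> real (card (part G2 \<kappa>2 a))) \<Longrightarrow>
       \<beta> * real (card (verts G1)) * real (card (verts G2)) \<le> real (card (verts G))"
    "\<And>\<delta>. 0 \<le> \<delta> \<Longrightarrow> thin \<delta> G2 \<kappa>2 \<Longrightarrow> thin \<delta> G \<kappa>"
proof -
  let ?P = "cprod G1 \<kappa>1 G2 \<kappa>2" and ?c = "cprod_col G1 \<kappa>1 G2 \<kappa>2"
  have hP: "host (\<epsilon>1 * \<epsilon>2) ?P ?c" by (rule host_cprod[OF h1 h2 pos])
  obtain f :: "'a \<times> 'b \<Rightarrow> nat" where f: "inj_on f (verts ?P)"
    using finite_imp_inj_to_nat_seg[OF host_finite[OF hP]] by auto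
  show ?thesis
  proof (rule that[of "relabel f ?P" "relabel_col f ?P ?c"])
    show "host (\<epsilon>1 * \<epsilon>2) (relabel f ?P) (relabel_col f ?P ?c)"
      by (rule host_relabel[OF hP f])
    show "card (lhoms H L (relabel f ?P) (relabel_col f ?P ?c)) \<le> card (lhoms H L G1 \<kappa>1) * card (lhoms H L G2 \<kappa>2)"
      if "r_graph s H" for H :: "'h hypergraph" and L s
      using card_lhoms_relabel_le[OF that host_r_graph[OF hP] f, of L ?c]
        card_lhoms_cprod_le[OF that h1 h2, of L] by linarith
    show "\<beta> * real (card (verts G1)) * real (card (verts G2)) \<le> real (card (verts (relabel f ?P)))"
      if "\<And>a. a \<in> verts F \<Longrightarrow> \<beta> * real (card (verts G2)) \<le> real (card (part G2 \<kappa>2 a))" for \<beta>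
      using card_cprod_lower[OF h1 h2 pos that] by (simp add: card_image[OF f])
    show "thin \<delta> (relabel f ?P) (relabel_col f ?P ?c)" if "0 \<le> \<delta>" "thin \<delta> G2 \<kappa>2" for \<delta>
      by (rule thin_relabel[OF hP f thin_cprod[OF h1 h2 that(2,1)] that(1)])
  qed
qed

text \<open>Iterated products with one fixed host: farness and density are both raised to the power \<open>Suc l\<close>. Every
step multiplies by the same balanced factor, so the exponent lost per step is \<open>card (verts H)\<close>,
independently of \<open>l\<close>.\<close>

lemma host_power:
  fixes G :: "nat hypergraph" and H :: "'h hypergraph"
  assumes H: "r_graph s H" and h: "host \<epsilon> G \<kappa>" and \<epsilon>: "0 < \<epsilon>" "\<epsilon> \<le> 1"
    and le: "real (card (lhoms H L G \<kappa>)) \<le> \<epsilon> ^ (C + card (verts H)) * real (card (verts G)) ^ card (verts H)"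
  shows "\<exists>(G' :: nat hypergraph) \<kappa>'. host (\<epsilon> ^ Suc l) G' \<kappa>' \<and>
    real (card (lhoms H L G' \<kappa>')) \<le> \<epsilon> ^ (C * Suc l) * real (card (verts G')) ^ card (verts H)"
proof (induction l)
  case 0
  have "\<epsilon> ^ (C + card (verts H)) * real (card (verts G)) ^ card (verts H)
    \<le> \<epsilon> ^ C * real (card (verts G)) ^ card (verts H)"
    using \<epsilon> by (intro mult_right_mono power_decreasing) auto
  then show ?case using h le by (intro exI[of _ G] exI[of _ \<kappa>]) simp
next
  case (Suc l)
  let ?v = "card (verts H)"
  obtain G1 \<kappa>1 where 1: "host (\<epsilon> ^ Suc l) (G1 :: nat hypergraph) \<kappa>1"
    "real (card (lhoms H L G1 \<kappa>1)) \<le> \<epsilon> ^ (C * Suc l) * real (card (verts G1)) ^ ?v"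
    using Suc by blast
  obtain G2 \<kappa>2 where 2: "host (\<epsilon> ^ Suc l * \<epsilon>) (G2 :: nat hypergraph) \<kappa>2"
    "card (lhoms H L G2 \<kappa>2) \<le> card (lhoms H L G1 \<kappa>1) * card (lhoms H L G \<kappa>)"
    "\<epsilon> * real (card (verts G1)) * real (card (verts G)) \<le> real (card (verts G2))"
  proof (rule nat_cprod[OF 1(1) h, where 'h = 'h])
    fix G2 \<kappa>2 assume *: "host (\<epsilon> ^ Suc l * \<epsilon>) (G2 :: nat hypergraph) \<kappa>2"
      "\<And>(H :: 'h hypergraph) L s. r_graph s H \<Longrightarrow> card (lhoms H L G2 \<kappa>2) \<le> card (lhoms H L G1 \<kappa>1) * card (lhoms H L G \<kappa>)"
      "\<And>\<beta>. (\<And>a. a \<in> verts F \<Longrightarrow> \<beta> * real (card (verts G)) \<le> real (card (part G \<kappa> a))) \<Longrightarrow>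
        \<beta> * real (card (verts G1)) * real (card (verts G)) \<le> real (card (verts G2))"
    show thesis
      by (rule that[OF *(1) *(2)[OF H] *(3)[OF part_lower_bound[OF h \<epsilon>(1)]]])
  qed (use \<epsilon> in auto)
  have "real (card (lhoms H L G2 \<kappa>2)) \<le> real (card (lhoms H L G1 \<kappa>1)) * real (card (lhoms H L G \<kappa>))"
    using 2(2) by (rule of_nat_le_mult)
  also have "\<dots> \<le> (\<epsilon> ^ (C * Suc l) * real (card (verts G1)) ^ ?v) * (\<epsilon> ^ (C + ?v) * real (card (verts G)) ^ ?v)"
    using 1(2) le \<epsilon> by (intro mult_mono) auto
  also have "\<dots> = \<epsilon> ^ (C * Suc (Suc l) + ?v) * (real (card (verts G1)) ^ ?v * real (card (verts G)) ^ ?v)"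
    by (simp add: power_add mult_ac)
  finally have "real (card (lhoms H L G2 \<kappa>2)) \<le> \<epsilon> ^ (C * Suc (Suc l)) * real (card (verts G2)) ^ ?v"
    by (rule power_rescale) (use \<epsilon> 2(3) in auto)
  moreover have "host (\<epsilon> ^ Suc (Suc l)) G2 \<kappa>2"
    using 2(1) by (simp add: mult_ac)
  ultimately show ?case by blast
qed

text \<open>A witness at some \<open>\<eta>\<close> with twice the exponent yields witnesses at all \<open>\<epsilon> \<le> \<eta>\<close>: choose \<open>l\<close> with
\<open>\<eta> ^ (l + 2) < \<epsilon> \<le> \<eta> ^ (l + 1)\<close>. The power \<open>l + 1\<close> is far enough for \<open>\<epsilon>\<close>, and rounding costs at most a
factor of two in the exponent because \<open>l + 2 \<le> 2 * (l + 1)\<close>.\<close>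

lemma suppressible_all:
  assumes H: "r_graph s H" and sup: "suppressible H L"
  shows "\<exists>\<eta>>0. \<forall>\<epsilon>. 0 < \<epsilon> \<and> \<epsilon> \<le> \<eta> \<longrightarrow> (\<exists>(G :: nat hypergraph) \<kappa>. host \<epsilon> G \<kappa> \<and>
     real (card (lhoms H L G \<kappa>)) \<le> \<epsilon> ^ C * real (card (verts G)) ^ card (verts H))"
proof -
  let ?v = "card (verts H)"
  obtain \<eta> G \<kappa> where \<eta>: "0 < \<eta>" "\<eta> \<le> 1 / 2" and G: "host \<eta> (G :: nat hypergraph) \<kappa>"
    "real (card (lhoms H L G \<kappa>)) \<le> \<eta> ^ (2 * C + ?v) * real (card (verts G)) ^ ?v"
    using sup unfolding suppressible_def by blast
  show ?thesis
  proof (intro exI[of _ \<eta>] conjI allI impI)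
    fix \<epsilon> assume \<epsilon>: "0 < \<epsilon> \<and> \<epsilon> \<le> \<eta>"
    define m where "m = (LEAST m. \<eta> ^ m < \<epsilon>)"
    have "\<exists>m. \<eta> ^ m < \<epsilon>"
      using real_arch_pow_inv[of \<epsilon> \<eta>] \<epsilon> \<eta> by auto
    then have m: "\<eta> ^ m < \<epsilon>" unfolding m_def by (rule LeastI_ex)
    have "m \<noteq> 0" "m \<noteq> 1" using m \<epsilon> \<eta> by (auto intro: ccontr)
    then obtain l where l: "m = Suc (Suc l)" by (metis One_nat_def not0_implies_Suc)
    have "\<not> \<eta> ^ Suc l < \<epsilon>"
      using not_less_Least[of "Suc l" "\<lambda>m. \<eta> ^ m < \<epsilon>"] l unfolding m_def by simp
    then have le: "\<epsilon> \<le> \<eta> ^ Suc l" by simp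
    obtain G' \<kappa>' where G': "host (\<eta> ^ Suc l) (G' :: nat hypergraph) \<kappa>'"
      "real (card (lhoms H L G' \<kappa>')) \<le> \<eta> ^ (2 * C * Suc l) * real (card (verts G')) ^ ?v"
      using host_power[OF H G(1) \<eta>(1) _ G(2), of l] \<eta>(2) by auto
    have "\<eta> ^ (2 * C * Suc l) \<le> \<eta> ^ (m * C)"
      using \<eta> by (intro power_decreasing) (auto simp: l)
    also have "\<dots> \<le> \<epsilon> ^ C"
      unfolding power_mult using m \<eta> by (intro power_mono) auto
    finally have "\<eta> ^ (2 * C * Suc l) * real (card (verts G')) ^ ?v \<le> \<epsilon> ^ C * real (card (verts G')) ^ ?v"
      by (rule mult_right_mono) simp
    then show "\<exists>(G :: nat hypergraph) \<kappa>. host \<epsilon> G \<kappa> \<and>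
        real (card (lhoms H L G \<kappa>)) \<le> \<epsilon> ^ C * real (card (verts G)) ^ ?v"
      using G' host_mono[OF G'(1) le] by (intro exI[of _ G'] exI[of _ \<kappa>']) auto
  qed (rule \<eta>(1))
qed

lemma host_rs_blowup:
  assumes "prime p" "k \<le> p"
  shows "host (1 / real k ^ (r - 1)) (rs_graph p r) (rs_col p)"
proof -
  have "real p ^ (r - 1) / (real k * real p) ^ (r - 1) = 1 / real k ^ (r - 1)"
    using prime_gt_0_nat[OF assms(1)] by (simp add: power_mult_distrib)
  then show ?thesis
    using host_rs[OF assms, of r] r_ge_2 by simp
qed

lemma host_rs_thin:
  assumes "prime p" "k \<le> p"
  shows "host (1 / (real p * real k ^ (r - 1))) (rs_graph p (r - 1)) (rs_col p)"
proof -
  have "r - 1 = Suc (r - 1 - 1)" using r_ge_2 by simp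
  then have "real p ^ (r - 1) = real p ^ (r - 1 - 1) * real p"
    by (metis power_Suc2)
  then have "real p ^ (r - 1 - 1) / (real k * real p) ^ (r - 1) = 1 / (real p * real k ^ (r - 1))"
    using prime_gt_0_nat[OF assms(1)] by (simp add: power_mult_distrib divide_simps)
  then show ?thesis
    using host_rs[OF assms, of "r - 1"] r_ge_2 by simp
qed

lemma rs_balanced:
  "a \<in> verts F \<Longrightarrow> 1 / real k * real (card (verts (rs_graph p d))) \<le> real (card (part (rs_graph p d) (rs_col p) a))"
  using verts_F_ne by (simp add: part_rs card_cartesian_product) (simp add: rs_graph_def card_cartesian_product)

lemma exists_nat_host:
  obtains \<epsilon> and G :: "nat hypergraph" and \<kappa> where "0 < \<epsilon>" "host \<epsilon> G \<kappa>"
proof -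
  obtain p where p: "prime p" "k < p" using bigger_prime by blast
  have h: "host (1 / real k ^ (r - 1)) (rs_graph p r) (rs_col p)"
    using host_rs_blowup[of p] p by simp
  obtain f :: "'f \<times> int \<Rightarrow> nat" where f: "inj_on f (verts (rs_graph p r))"
    using finite_imp_inj_to_nat_seg[OF host_finite[OF h]] by auto
  show ?thesis
    by (rule that[OF _ host_relabel[OF h f]]) (use verts_F_ne in \<open>simp add: card_gt_0_iff\<close>)
qed

text \<open>The product of a host for \<open>T\<close> and a host for one more pair, both taken at \<open>sqrt \<epsilon>\<close>, is a host at \<open>\<epsilon>\<close>
and suppresses all of them, since the counts in the other factor are bounded trivially. Having hosts for
all small \<open>\<epsilon>\<close> is essential here: witnesses at very different \<open>\<epsilon>\<close> could not be combined.\<close>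

lemma suppressible_finite_family:
  fixes T :: "('h hypergraph \<times> ('h \<Rightarrow> 'f set)) set"
  assumes "finite T" "\<And>H L. (H, L) \<in> T \<Longrightarrow> r_graph r H \<and> suppressible H L"
  shows "\<exists>\<eta>>0. \<forall>\<epsilon>. 0 < \<epsilon> \<and> \<epsilon> \<le> \<eta> \<longrightarrow> (\<exists>(G :: nat hypergraph) \<kappa>. host \<epsilon> G \<kappa> \<and>
     (\<forall>(H, L)\<in>T. real (card (lhoms H L G \<kappa>)) \<le> \<epsilon> ^ C * real (card (verts G)) ^ card (verts H)))"
  using assms
proof (induction T arbitrary: C rule: finite_induct)
  case empty
  obtain \<eta> G \<kappa> where "0 < \<eta>" "host \<eta> (G :: nat hypergraph) \<kappa>"
    by (rule exists_nat_host)
  then have "0 < \<eta> \<and> (\<forall>\<epsilon>. 0 < \<epsilon> \<and> \<epsilon> \<le> \<eta> \<longrightarrow> host \<epsilon> G \<kappa>)"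
    using host_mono by blast
  then show ?case by blast
next
  case (insert t T)
  obtain H0 L0 where t: "t = (H0, L0)" by (cases t)
  have H0: "r_graph r H0" "suppressible H0 L0" using insert.prems[of H0 L0] t by auto
  \<comment> \<open>\<open>2 * C\<close> compensates the square root, \<open>m\<close> the possible unbalancedness of the product\<close>
  define m where "m = Max ((\<lambda>t. card (verts (fst t))) ` insert t T)"
  have m: "card (verts H) \<le> m" if "(H, L) \<in> insert t T" for H L
    unfolding m_def using that insert.hyps(1) by (intro Max_ge) force+
  define D where "D = 2 * C + m"
  obtain \<eta>1 where \<eta>1: "\<eta>1 > 0" "\<forall>\<epsilon>. 0 < \<epsilon> \<and> \<epsilon> \<le> \<eta>1 \<longrightarrow> (\<exists>(G :: nat hypergraph) \<kappa>. host \<epsilon> G \<kappa> \<and>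
     (\<forall>(H, L)\<in>T. real (card (lhoms H L G \<kappa>)) \<le> \<epsilon> ^ D * real (card (verts G)) ^ card (verts H)))"
    using insert.IH[of D] insert.prems by blast
  obtain \<eta>2 where \<eta>2: "\<eta>2 > 0" "\<forall>\<epsilon>. 0 < \<epsilon> \<and> \<epsilon> \<le> \<eta>2 \<longrightarrow> (\<exists>(G :: nat hypergraph) \<kappa>. host \<epsilon> G \<kappa> \<and>
     real (card (lhoms H0 L0 G \<kappa>)) \<le> \<epsilon> ^ D * real (card (verts G)) ^ card (verts H0))"
    using suppressible_all[OF H0, of D] by blast
  define \<eta> where "\<eta> = min 1 (min \<eta>1 \<eta>2)"
  have \<eta>: "0 < \<eta>" "\<eta> \<le> 1" "\<eta> \<le> \<eta>1" "\<eta> \<le> \<eta>2" using \<eta>1 \<eta>2 by (auto simp: \<eta>_def)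
  show ?case
  proof (intro exI[of _ "\<eta>\<^sup>2"] conjI allI impI)
    fix \<epsilon> :: real assume \<epsilon>: "0 < \<epsilon> \<and> \<epsilon> \<le> \<eta>\<^sup>2"
    define \<delta> where "\<delta> = sqrt \<epsilon>"
    have "\<delta> \<le> \<eta>" unfolding \<delta>_def using \<epsilon> \<eta> by (intro real_le_lsqrt) auto
    moreover have "0 < \<delta>" and \<delta>2: "\<delta> * \<delta> = \<epsilon>"
      using \<epsilon> by (auto simp: \<delta>_def)
    ultimately have \<delta>: "0 < \<delta>" "\<delta> \<le> 1" "\<delta> \<le> \<eta>1" "\<delta> \<le> \<eta>2"
      using \<eta> by auto
    obtain G1 \<kappa>1 where 1: "host \<delta> (G1 :: nat hypergraph) \<kappa>1"
      "\<forall>(H, L)\<in>T. real (card (lhoms H L G1 \<kappa>1)) \<le> \<delta> ^ D * real (card (verts G1)) ^ card (verts H)"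
      using \<eta>1(2) \<delta> by blast
    obtain G2 \<kappa>2 where 2: "host \<delta> (G2 :: nat hypergraph) \<kappa>2"
      "real (card (lhoms H0 L0 G2 \<kappa>2)) \<le> \<delta> ^ D * real (card (verts G2)) ^ card (verts H0)"
      using \<eta>2(2) \<delta> by blast
    obtain G \<kappa> where G: "host (\<delta> * \<delta>) (G :: nat hypergraph) \<kappa>"
      "\<And>(H :: 'h hypergraph) L s. r_graph s H \<Longrightarrow> card (lhoms H L G \<kappa>) \<le> card (lhoms H L G1 \<kappa>1) * card (lhoms H L G2 \<kappa>2)"
      "\<And>\<beta>. (\<And>a. a \<in> verts F \<Longrightarrow> \<beta> * real (card (verts G2)) \<le> real (card (part G2 \<kappa>2 a))) \<Longrightarrow>
        \<beta> * real (card (verts G1)) * real (card (verts G2)) \<le> real (card (verts G))"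
      by (rule nat_cprod[OF 1(1) 2(1) \<delta>(1,1), where 'h = 'h]) blast
    let ?n1 = "real (card (verts G1))" and ?n2 = "real (card (verts G2))"
    have N: "\<delta> * ?n1 * ?n2 \<le> real (card (verts G))"
      by (rule G(3)[OF part_lower_bound[OF 2(1) \<delta>(1)]])
    have "real (card (lhoms H L G \<kappa>)) \<le> \<epsilon> ^ C * real (card (verts G)) ^ card (verts H)"
      if HL: "(H, L) \<in> insert t T" for H L
    proof -
      let ?v = "card (verts H)"
      have H: "r_graph r H" using insert.prems[OF HL] by simp
      have triv: "real (card (lhoms H L G1 \<kappa>1)) \<le> ?n1 ^ ?v" "real (card (lhoms H L G2 \<kappa>2)) \<le> ?n2 ^ ?v"
        using card_lhoms_le[OF r_graph_finite[OF H] host_finite[OF 1(1)], of L \<kappa>1]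
          card_lhoms_le[OF r_graph_finite[OF H] host_finite[OF 2(1)], of L \<kappa>2]
        by (simp_all flip: of_nat_power)
      have "real (card (lhoms H L G \<kappa>)) \<le> real (card (lhoms H L G1 \<kappa>1)) * real (card (lhoms H L G2 \<kappa>2))"
        by (rule of_nat_le_mult[OF G(2)[OF H]])
      also have "\<dots> \<le> \<delta> ^ (2 * C + m) * (?n1 ^ ?v * ?n2 ^ ?v)"
      proof (cases "(H, L) = t")
        case True
        then have "real (card (lhoms H L G2 \<kappa>2)) \<le> \<delta> ^ D * ?n2 ^ ?v" using 2(2) t by simp
        then have "real (card (lhoms H L G1 \<kappa>1)) * real (card (lhoms H L G2 \<kappa>2)) \<le> ?n1 ^ ?v * (\<delta> ^ D * ?n2 ^ ?v)"
          using triv \<delta> by (intro mult_mono) auto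
        then show ?thesis by (simp add: D_def mult_ac)
      next
        case False
        then have "(H, L) \<in> T" using HL by auto
        then have "real (card (lhoms H L G1 \<kappa>1)) \<le> \<delta> ^ D * ?n1 ^ ?v" using 1(2) by auto
        then have "real (card (lhoms H L G1 \<kappa>1)) * real (card (lhoms H L G2 \<kappa>2)) \<le> (\<delta> ^ D * ?n1 ^ ?v) * ?n2 ^ ?v"
          using triv \<delta> by (intro mult_mono) auto
        then show ?thesis by (simp add: D_def mult_ac)
      qed
      finally have "real (card (lhoms H L G \<kappa>)) \<le> \<delta> ^ (2 * C) * real (card (verts G)) ^ ?v"
        by (rule power_rescale) (use \<delta> N m[OF HL] in auto)
      also have "\<delta> ^ (2 * C) = \<epsilon> ^ C"
        unfolding \<delta>2[symmetric] by (simp add: power_mult power2_eq_square)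
      finally show ?thesis .
    qed
    then show "\<exists>(G :: nat hypergraph) \<kappa>. host \<epsilon> G \<kappa> \<and>
      (\<forall>(H, L)\<in>insert t T. real (card (lhoms H L G \<kappa>)) \<le> \<epsilon> ^ C * real (card (verts G)) ^ card (verts H))"
      using G(1) \<delta>2 by (intro exI[of _ G] exI[of _ \<kappa>]) auto
  qed (use \<eta> in simp)
qed

text \<open>Representatives of all hypergraphs with at most \<open>M\<close> vertices with lists of colours, up to isomorphism.\<close>

definition small_patterns :: "nat \<Rightarrow> (nat hypergraph \<times> (nat \<Rightarrow> 'f set)) set" where
  "small_patterns M = (\<lambda>(j, E, L). (Hypergraph {..<j} E, L)) `
     ({..M} \<times> Pow (Pow {..<M}) \<times> ({..<M} \<rightarrow>\<^sub>E Pow (verts F)))"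

lemma finite_small_patterns: "finite (small_patterns M)"
  unfolding small_patterns_def by (intro finite_imageI finite_cartesian_product finite_PiE) auto

text \<open>Lists may be intersected with the vertex set of \<open>F\<close>, as no other colours occur in a host; this keeps
the set of representatives finite even when the vertices of \<open>F\<close> come from an infinite type.\<close>

lemma small_pattern_exists:
  assumes H: "r_graph s H" and M: "card (verts H) \<le> M"
  obtains H' L' where "(H', L') \<in> small_patterns M" "r_graph s H'" "card (verts H') = card (verts H)"
    "\<And>(G :: nat hypergraph) \<kappa>. (\<And>x. x \<in> verts G \<Longrightarrow> \<kappa> x \<in> verts F) \<Longrightarrow>
       card (lhoms H' L' G \<kappa>) = card (lhoms H L G \<kappa>)"
proof -
  let ?j = "card (verts H)"
  obtain f where f: "bij_betw f (verts H) {0..<?j}"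
    using ex_bij_betw_finite_nat[OF r_graph_finite[OF H]] by blast
  have inj: "inj_on f (verts H)" and img: "f ` verts H = {..<?j}"
    using f by (auto simp: bij_betw_def)
  define L' where "L' = restrict (\<lambda>i. if i < ?j then L (inv_into (verts H) f i) \<inter> verts F else {}) {..<M}"
  show ?thesis
  proof (rule that[of "relabel f H" L'])
    have "(`) f ` edges H \<subseteq> Pow {..<M}"
    proof (intro subsetI PowI, elim imageE)
      fix d e i assume "d = f ` e" "e \<in> edges H" "i \<in> d"
      then have "i \<in> f ` verts H" using r_graph_edge[OF H] by auto
      then show "i \<in> {..<M}" using img M by auto
    qed
    moreover have "L' \<in> {..<M} \<rightarrow>\<^sub>E Pow (verts F)" by (auto simp: L'_def)
    ultimately show "(relabel f H, L') \<in> small_patterns M"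
      unfolding small_patterns_def relabel_def img using M
      by (intro image_eqI[of _ _ "(?j, (`) f ` edges H, L')"]) auto
    show "r_graph s (relabel f H)" by (rule r_graph_relabel[OF H inj])
    show "card (verts (relabel f H)) = ?j" by (simp add: card_image[OF inj])
    show "card (lhoms (relabel f H) L' G \<kappa>) = card (lhoms H L G \<kappa>)"
      if col: "\<And>x. x \<in> verts G \<Longrightarrow> \<kappa> x \<in> verts F" for G :: "nat hypergraph" and \<kappa>
    proof (rule card_lhoms_relabel_pattern[OF H inj])
      fix v x assume v: "v \<in> verts H" "x \<in> verts G"
      have "f v \<in> f ` verts H" using v by simp
      then have "f v < ?j" using img by simp
      then show "\<kappa> x \<in> L' (f v) \<longleftrightarrow> \<kappa> x \<in> L v"
        using v col M inj by (simp add: L'_def)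
    qed
  qed
qed

section \<open>A common host for an infinite family\<close>

text \<open>The host is a product of three: one suppressing the finitely many small patterns at \<open>1 / p\<close>, a
Reed-Solomon hypergraph with \<open>d = r\<close> over a prime \<open>q\<close> (constant farness, arbitrarily many vertices) and one
with \<open>d = r - 1\<close> over \<open>p\<close> (thin). Its farness is at least \<open>p ^ (- 3)\<close>: two factors \<open>1 / p\<close> come from the
first and the last hypergraph, and the third covers the constant \<open>k ^ (2 * (r - 1))\<close>. Both kinds of
members end up with density at most \<open>p ^ (- s)\<close>, and \<open>s = 3 * m + 1\<close> beats \<open>\<epsilon> ^ m = p ^ (- 3 * m)\<close> by a factor \<open>p\<close>
that exceeds \<open>1 / c\<close>.\<close>

lemma common_sparse_host:
  fixes \<L> :: "('h hypergraph \<times> ('h \<Rightarrow> 'f set)) set"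
  assumes \<L>: "\<And>H L. (H, L) \<in> \<L> \<Longrightarrow>
      r_graph r H \<and> (\<forall>v\<in>verts H. L v \<inter> verts F \<noteq> {}) \<and> suppressible H L"
    and c: "0 < c"
  shows "\<exists>\<epsilon>. 0 < \<epsilon> \<and> \<epsilon> \<le> 1 \<and> (\<forall>n\<^sub>0. \<exists>(G :: nat hypergraph) \<kappa>. host \<epsilon> G \<kappa> \<and> n\<^sub>0 \<le> card (verts G) \<and>
     (\<forall>(H, L)\<in>\<L>. real (card (lhoms H L G \<kappa>)) < c * \<epsilon> ^ m * real (card (verts G)) ^ card (verts H)))"
proof -
  define s where "s = 3 * m + 1"
  define M where "M = s * r"
  define T where "T = {t \<in> small_patterns M. r_graph r (fst t) \<and> suppressible (fst t) (snd t)}"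
  have T: "r_graph r H \<and> suppressible H L" if "(H, L) \<in> T" for H L
    using that by (simp add: T_def)
  have "finite T"
    unfolding T_def by (rule finite_subset[OF _ finite_small_patterns]) auto
  then obtain \<eta> where \<eta>: "\<eta> > 0" "\<forall>\<epsilon>. 0 < \<epsilon> \<and> \<epsilon> \<le> \<eta> \<longrightarrow> (\<exists>(G :: nat hypergraph) \<kappa>. host \<epsilon> G \<kappa> \<and>
     (\<forall>(H, L)\<in>T. real (card (lhoms H L G \<kappa>)) \<le> \<epsilon> ^ (s + 1) * real (card (verts G)) ^ card (verts H)))"
    using suppressible_finite_family[OF _ T, of T "s + 1"] by blast
  \<comment> \<open>the five summands bound \<open>1 / \<eta>\<close>, \<open>1 / c\<close>, the unbalancedness of two Reed-Solomon factors in up to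
     \<open>M\<close> coordinates, the loss of farness in these factors, and the number of evaluation points\<close>
  obtain p where p: "prime p" "nat \<lceil>1 / \<eta>\<rceil> + nat \<lceil>1 / c\<rceil> + k ^ (2 * M) + k ^ (2 * (r - 1)) + k < p"
    using bigger_prime by blast
  have p0: "0 < real p" using prime_gt_0_nat[OF p(1)] by simp
  have "1 / \<eta> < real p" "1 / c < real p" using p(2) by linarith+
  then have p_\<eta>: "1 / real p \<le> \<eta>" and p_c: "1 / real p < c"
    using \<eta>(1) c p0 by (auto simp: field_simps)
  have p_M: "real k ^ (2 * M) \<le> real p" and p_r: "real k ^ (2 * (r - 1)) \<le> real p" and p_k: "k \<le> p"
    using p(2) by (simp_all flip: of_nat_power)
  define \<epsilon> where "\<epsilon> = (1 / real p) ^ 3"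
  obtain G1 \<kappa>1 where G1: "host (1 / real p) (G1 :: nat hypergraph) \<kappa>1"
    "\<forall>(H, L)\<in>T. real (card (lhoms H L G1 \<kappa>1)) \<le> (1 / real p) ^ (s + 1) * real (card (verts G1)) ^ card (verts H)"
    using spec[OF \<eta>(2), of "1 / real p"] p_\<eta> p0 by auto
  have k0: "0 < real k" using k_ge_2 by linarith
  show ?thesis
  proof (intro exI[of _ \<epsilon>] conjI allI)
    show "0 < \<epsilon>" "\<epsilon> \<le> 1"
      using p0 prime_gt_0_nat[OF p(1)] by (auto simp: \<epsilon>_def intro!: power_le_one)
    fix n\<^sub>0 :: nat
    obtain q where q: "prime q" "k + n\<^sub>0 < q" using bigger_prime by blast
    have q_k: "k \<le> q" using q by simp
    let ?Q = "rs_graph q r" and ?P = "rs_graph p (r - 1)"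
    note hQ = host_rs_blowup[OF q(1) q_k] and hP = host_rs_thin[OF p(1) p_k]
    have pos: "0 < 1 / real k ^ (r - 1)" "0 < 1 / (real p * real k ^ (r - 1))" "0 < 1 / real p"
      using k0 p0 by auto
    obtain G2 \<kappa>2 where G2: "host (1 / real p * (1 / real k ^ (r - 1))) (G2 :: nat hypergraph) \<kappa>2"
      "\<And>(H :: nat hypergraph) L s. r_graph s H \<Longrightarrow> card (lhoms H L G2 \<kappa>2) \<le> card (lhoms H L G1 \<kappa>1) * card (lhoms H L ?Q (rs_col q))"
      "\<And>\<beta>. (\<And>a. a \<in> verts F \<Longrightarrow> \<beta> * real (card (verts ?Q)) \<le> real (card (part ?Q (rs_col q) a))) \<Longrightarrow>
        \<beta> * real (card (verts G1)) * real (card (verts ?Q)) \<le> real (card (verts G2))"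
      by (rule nat_cprod[OF G1(1) hQ pos(3,1), where 'h = nat]) blast
    have pos2: "0 < 1 / real p * (1 / real k ^ (r - 1))" using k0 p0 by simp
    obtain G \<kappa> where G: "host (1 / real p * (1 / real k ^ (r - 1)) * (1 / (real p * real k ^ (r - 1)))) (G :: nat hypergraph) \<kappa>"
      "\<And>(H :: nat hypergraph) L s. r_graph s H \<Longrightarrow> card (lhoms H L G \<kappa>) \<le> card (lhoms H L G2 \<kappa>2) * card (lhoms H L ?P (rs_col p))"
      "\<And>\<beta>. (\<And>a. a \<in> verts F \<Longrightarrow> \<beta> * real (card (verts ?P)) \<le> real (card (part ?P (rs_col p) a))) \<Longrightarrow>
        \<beta> * real (card (verts G2)) * real (card (verts ?P)) \<le> real (card (verts G))"
      "\<And>\<delta>. 0 \<le> \<delta> \<Longrightarrow> thin \<delta> ?P (rs_col p) \<Longrightarrow> thin \<delta> G \<kappa>"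
      by (rule nat_cprod[OF G2(1) hP pos2 pos(2), where 'h = nat]) blast
    have thin: "thin (1 / real p) G \<kappa>"
      by (rule G(4)[OF _ thin_rs[OF p(1) p_k]]) simp
    let ?n1 = "real (card (verts G1))" and ?n2 = "real (card (verts G2))"
      and ?nq = "real (card (verts ?Q))" and ?np = "real (card (verts ?P))" and ?N = "real (card (verts G))"
    have nq: "?nq = real k * real q" and np: "?np = real k * real p"
      by (simp_all add: rs_graph_def card_cartesian_product)
    have N2: "1 / real k * ?n1 * ?nq \<le> ?n2" by (rule G2(3)[OF rs_balanced])
    have N: "1 / real k * ?n2 * ?np \<le> ?N" by (rule G(3)[OF rs_balanced])
    have n1: "1 \<le> ?n1" using host_card[OF G1(1)] by linarith
    have N_pos: "0 < ?N" using host_card[OF G(1)] by simp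
    have "real n\<^sub>0 \<le> ?N"
    proof -
      have "real n\<^sub>0 \<le> real q" using q by simp
      also have "\<dots> \<le> ?n1 * real q" using n1 by (simp add: mult_le_cancel_right1)
      also have "\<dots> \<le> ?n2" using N2 verts_F_ne nq by simp
      also have "\<dots> \<le> ?n2 * real p" using prime_gt_0_nat[OF p(1)] by (simp add: mult_le_cancel_left1)
      also have "\<dots> \<le> ?N" using N verts_F_ne np by simp
      finally show ?thesis .
    qed
    have host: "host \<epsilon> G \<kappa>"
    proof (rule host_mono[OF G(1)])
      have "(1 / real p) ^ 3 = 1 / (real p * real p * real p)"
        by (simp add: power3_eq_cube)
      also have "\<dots> \<le> 1 / (real p * real p * real k ^ (2 * (r - 1)))"
        using p_r p0 k0 by (intro divide_left_mono mult_left_mono) auto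
      also have "\<dots> = 1 / real p * (1 / real k ^ (r - 1)) * (1 / (real p * real k ^ (r - 1)))"
        by (simp add: power_add mult_2 mult_ac)
      finally show "\<epsilon> \<le> 1 / real p * (1 / real k ^ (r - 1)) * (1 / (real p * real k ^ (r - 1)))"
        by (simp add: \<epsilon>_def)
    qed
    have gain: "(1 / real p) ^ s < c * \<epsilon> ^ m"
    proof -
      have "(1 / real p) ^ s = 1 / real p * \<epsilon> ^ m"
        by (simp add: s_def \<epsilon>_def power_mult)
      also have "\<dots> < c * \<epsilon> ^ m"
        using p_c p0 by (intro mult_strict_right_mono) (auto simp: \<epsilon>_def)
      finally show ?thesis .
    qed
    have "real (card (lhoms H L G \<kappa>)) \<le> (1 / real p) ^ s * ?N ^ card (verts H)"
      if HL: "(H, L) \<in> \<L>" for H L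
    \<comment> \<open>many non-isolated vertices: the thin factor suffices; few: a pattern from the finite list\<close>
    proof (cases "s * r \<le> card (covered_verts H)")
      case True
      then show ?thesis
        using card_lhoms_thin_le[OF G(1) thin, of H s L] \<L>[OF HL] by simp
    next
      case False
      have H: "r_graph r H" and L: "\<And>v. v \<in> verts H \<Longrightarrow> L v \<inter> verts F \<noteq> {}" and sup: "suppressible H L"
        using \<L>[OF HL] by auto
      let ?U = "covered_verts H"
      let ?u = "card ?U"
      have U: "?U \<subseteq> verts H" by (auto simp: covered_verts_def)
      have uM: "?u \<le> M" using False by (simp add: M_def)
      have u_le: "?u \<le> card (verts H)" by (rule card_mono[OF r_graph_finite[OF H] U])
      obtain H' L' where pat: "(H', L') \<in> small_patterns M" "r_graph r H'" "card (verts H') = ?u"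
        "\<And>(G :: nat hypergraph) \<kappa>. (\<And>x. x \<in> verts G \<Longrightarrow> \<kappa> x \<in> verts F) \<Longrightarrow>
          card (lhoms H' L' G \<kappa>) = card (lhoms (induced H ?U) L G \<kappa>)"
        using small_pattern_exists[OF r_graph_induced[OF H U], of M L] uM by (metis verts_induced)
      have eq: "card (lhoms H' L' G \<kappa>) = card (lhoms (induced H ?U) L G \<kappa>)"
        if "host \<delta> G \<kappa>" for \<delta> and G :: "nat hypergraph" and \<kappa>
        using pat(4) host_col[OF that] by blast
      have "suppressible H' L'"
        using suppressible_core[OF H L sup] unfolding suppressible_def
        by (simp add: pat(3)) (metis eq)
      then have "(H', L') \<in> T" using pat by (simp add: T_def)
      then have 1: "real (card (lhoms H' L' G1 \<kappa>1)) \<le> (1 / real p) ^ (s + 1) * ?n1 ^ ?u"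
        using G1(2) pat(3) by auto
      have q': "real (card (lhoms H' L' ?Q (rs_col q))) \<le> ?nq ^ ?u"
        and p': "real (card (lhoms H' L' ?P (rs_col p))) \<le> ?np ^ ?u"
        using card_lhoms_le[OF r_graph_finite[OF pat(2)] host_finite[OF hQ], of L' "rs_col q"]
          card_lhoms_le[OF r_graph_finite[OF pat(2)] host_finite[OF hP], of L' "rs_col p"] pat(3)
        by (simp_all flip: of_nat_power)
      have "real (card (lhoms H' L' G2 \<kappa>2)) \<le> real (card (lhoms H' L' G1 \<kappa>1)) * real (card (lhoms H' L' ?Q (rs_col q)))"
        by (rule of_nat_le_mult[OF G2(2)[OF pat(2)]])
      also have "\<dots> \<le> ((1 / real p) ^ (s + 1) * ?n1 ^ ?u) * ?nq ^ ?u"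
        using 1 q' p0 by (intro mult_mono) auto
      finally have 2: "real (card (lhoms H' L' G2 \<kappa>2)) \<le> ((1 / real p) ^ (s + 1) * ?n1 ^ ?u) * ?nq ^ ?u" .
      have "real (card (lhoms H' L' G \<kappa>)) \<le> real (card (lhoms H' L' G2 \<kappa>2)) * real (card (lhoms H' L' ?P (rs_col p)))"
        by (rule of_nat_le_mult[OF G(2)[OF pat(2)]])
      also have "\<dots> \<le> (((1 / real p) ^ (s + 1) * ?n1 ^ ?u) * ?nq ^ ?u) * ?np ^ ?u"
        using 2 p' p0 by (intro mult_mono) auto
      also have "\<dots> = (1 / real p) ^ (s + 1) * (?n1 * ?nq * ?np) ^ ?u"
        by (simp add: power_mult_distrib mult_ac)
      also have "\<dots> \<le> (1 / real p) ^ (s + 1) * (real k ^ 2 * ?N) ^ ?u"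
      proof (intro mult_left_mono power_mono)
        have "?n1 * ?nq \<le> real k * ?n2" using N2 k0 by (simp add: field_simps)
        then have "?n1 * ?nq * ?np \<le> real k * ?n2 * ?np" by (rule mult_right_mono) simp
        also have "\<dots> \<le> real k * (real k * ?N)"
          using N k0 by (simp add: field_simps)
        finally show "?n1 * ?nq * ?np \<le> real k ^ 2 * ?N" by (simp add: power2_eq_square mult_ac)
      qed (use p0 in auto)
      also have "\<dots> = (1 / real p) ^ s * (real k ^ (2 * ?u) / real p) * ?N ^ ?u"
        by (simp add: power_mult_distrib power_mult)
      also have "\<dots> \<le> (1 / real p) ^ s * 1 * ?N ^ ?u"
      proof (intro mult_right_mono mult_left_mono)
        have "real k ^ (2 * ?u) \<le> real k ^ (2 * M)"
          using uM k_ge_2 by (intro power_increasing) auto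
        also have "\<dots> \<le> real p" by (rule p_M)
        finally show "real k ^ (2 * ?u) / real p \<le> 1" using p0 by (simp only: divide_le_eq_1_pos)
      qed (use p0 in auto)
      finally have core: "real (card (lhoms (induced H ?U) L G \<kappa>)) \<le> (1 / real p) ^ s * ?N ^ ?u"
        using eq[OF G(1)] by simp
      have "real (card (lhoms H L G \<kappa>)) \<le> real (card (lhoms (induced H ?U) L G \<kappa>)) * ?N ^ (card (verts H) - ?u)"
        by (rule card_lhoms_le_induced[OF H U host_finite[OF G(1)]])
      also have "\<dots> \<le> ((1 / real p) ^ s * ?N ^ ?u) * ?N ^ (card (verts H) - ?u)"
        by (rule mult_right_mono[OF core]) simp
      also have "\<dots> = (1 / real p) ^ s * ?N ^ card (verts H)"
        using u_le by (simp flip: power_add)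
      finally show ?thesis .
    qed
    then have "real (card (lhoms H L G \<kappa>)) < c * \<epsilon> ^ m * ?N ^ card (verts H)" if "(H, L) \<in> \<L>" for H L
      using that gain N_pos by (meson le_less_trans mult_strict_right_mono zero_less_power)
    then show "\<exists>(G :: nat hypergraph) \<kappa>. host \<epsilon> G \<kappa> \<and> n\<^sub>0 \<le> card (verts G) \<and>
      (\<forall>(H, L)\<in>\<L>. real (card (lhoms H L G \<kappa>)) < c * \<epsilon> ^ m * real (card (verts G)) ^ card (verts H))"
      using host \<open>real n\<^sub>0 \<le> ?N\<close> by (intro exI[of _ G] exI[of _ \<kappa>]) auto
  qed
qed

end

section \<open>Failure of abundance implies suppressibility\<close>

lemma card_lhoms_le_embeddings:
  assumes "finite (verts H)" "finite (verts G)"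
  shows "card (lhoms H L G \<kappa>) \<le> card {\<phi> \<in> lhoms H L G \<kappa>. inj_on \<phi> (verts H)}
    + card (verts H) ^ 2 * card (verts G) ^ (card (verts H) - 1)"
proof -
  let ?I = "{\<phi> \<in> lhoms H L G \<kappa>. inj_on \<phi> (verts H)}"
    and ?N = "{\<phi> \<in> verts H \<rightarrow>\<^sub>E verts G. \<not> inj_on \<phi> (verts H)}"
  have "finite (verts H \<rightarrow>\<^sub>E verts G)" using assms by (simp add: finite_PiE)
  then have "card (lhoms H L G \<kappa>) \<le> card (?I \<union> ?N)"
    using lhoms_subset[of H L G \<kappa>] finite_lhoms[OF assms, of L \<kappa>] by (intro card_mono) auto
  also have "\<dots> \<le> card ?I + card ?N" by (rule card_Un_le)
  finally show ?thesis using card_noninjective_le[OF assms] by linarith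
qed

lemma noninjective_negligible:
  fixes b :: real
  assumes "0 < b" "nat \<lceil>real (v ^ 2) / b\<rceil> + 1 \<le> n"
  shows "real (v ^ 2 * n ^ (v - 1)) \<le> b * real n ^ v"
proof (cases v)
  case (Suc w)
  have "real (v ^ 2) / b \<le> real n" using assms(2) by linarith
  then have "real (v ^ 2) \<le> b * real n" using assms(1) by (simp add: field_simps)
  then have "real (v ^ 2) * real n ^ w \<le> b * real n * real n ^ w" by (rule mult_right_mono) simp
  then show ?thesis by (simp add: Suc mult_ac)
qed (use assms in simp)

lemma lhoms_le_of_few_embeddings:
  fixes b :: real
  assumes fin: "finite (verts H)" "finite (verts G)" and b: "0 < b"
    and n: "nat \<lceil>real (card (verts H) ^ 2) / b\<rceil> + 1 \<le> card (verts G)"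
    and few: "real (card {\<phi> \<in> lhoms H L G \<kappa>. inj_on \<phi> (verts H)}) < b * real (card (verts G)) ^ card (verts H)"
  shows "real (card (lhoms H L G \<kappa>)) \<le> 2 * b * real (card (verts G)) ^ card (verts H)"
proof -
  have "real (card (lhoms H L G \<kappa>)) \<le> real (card {\<phi> \<in> lhoms H L G \<kappa>. inj_on \<phi> (verts H)})
      + real (card (verts H) ^ 2 * card (verts G) ^ (card (verts H) - 1))"
    using card_lhoms_le_embeddings[OF fin, of L \<kappa>] by (simp only: of_nat_add[symmetric] of_nat_le_iff)
  then show ?thesis
    using few noninjective_negligible[OF b n] by linarith
qed

lemma Emb_col_eq: "Emb_col H \<sigma> G \<kappa> = card {\<phi> \<in> lhoms H (\<lambda>v. {\<sigma> v}) G \<kappa>. inj_on \<phi> (verts H)}"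
  unfolding Emb_col_def by (rule arg_cong[of _ _ card]) (auto simp: embeddings_def lhoms_def)

lemma Emb_eq: "Emb H G = card {\<phi> \<in> lhoms H (\<lambda>_. UNIV) G \<kappa>. inj_on \<phi> (verts H)}"
  unfolding Emb_def by (rule arg_cong[of _ _ card]) (auto simp: embeddings_def lhoms_def)

context covered_r_graph
begin

lemma power_r: "x ^ r = x * x ^ (r - 1)" for x :: real
  using r_ge_2 by (cases r) auto

text \<open>Failure of abundance is used with the exponent \<open>C + 1\<close> and with \<open>c\<close> so small that the resulting bound is
\<open>(\<epsilon> / 2) ^ (C + 1)\<close>; replacing \<open>\<epsilon>\<close> by \<open>\<epsilon> / 2\<close> keeps the hypergraph uniformly far. The number of vertices is
taken large enough to neglect non-injective maps.\<close>

lemma suppressible_if_not_abundant_col: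
  assumes H: "coloured_r_graph r F H \<sigma>" and non: "\<not> abundant_col r F H \<sigma>"
  shows "suppressible H (\<lambda>v. {\<sigma> v})"
  unfolding suppressible_def
proof
  fix C :: nat
  let ?v = "card (verts H)"
  have finH: "finite (verts H)" using H by (auto simp: coloured_r_graph_def)
  define c :: real where "c = (1 / 2) ^ (C + 2)"
  have "0 < c" "0 < real (C + 1)" by (simp_all add: c_def)
  define Q where "Q \<epsilon> n\<^sub>0 \<longleftrightarrow> (\<forall>(G :: nat hypergraph) \<kappa>.
      coloured_r_graph r F G \<kappa> \<and> card (verts G) \<ge> n\<^sub>0 \<and> uniformly_far r F \<epsilon> G \<kappa> \<longrightarrow>
      real (Emb_col H \<sigma> G \<kappa>) \<ge> c * \<epsilon> powr real (C + 1) * real (card (verts G)) ^ ?v)" for \<epsilon> n\<^sub>0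
  have "\<not> (\<forall>\<epsilon>. 0 < \<epsilon> \<and> \<epsilon> \<le> 1 \<longrightarrow> (\<exists>n\<^sub>0. Q \<epsilon> n\<^sub>0))"
    using non \<open>0 < c\<close> \<open>0 < real (C + 1)\<close> unfolding abundant_col_def Q_def by blast
  then obtain \<epsilon> where \<epsilon>: "0 < \<epsilon>" "\<epsilon> \<le> 1" and bad: "\<not> Q \<epsilon> n\<^sub>0" for n\<^sub>0
    by blast
  define b where "b = c * \<epsilon> ^ (C + 1)"
  have b: "0 < b" using \<epsilon> by (simp add: b_def c_def)
  have b_eq: "c * \<epsilon> powr real (C + 1) = b"
    unfolding b_def using \<epsilon> by (subst powr_realpow) auto
  obtain G \<kappa> where G: "coloured_r_graph r F (G :: nat hypergraph) \<kappa>"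
      "nat \<lceil>real (?v ^ 2) / b\<rceil> + 1 \<le> card (verts G)" "uniformly_far r F \<epsilon> G \<kappa>"
      "real (Emb_col H \<sigma> G \<kappa>) < b * real (card (verts G)) ^ ?v"
    using bad[of "nat \<lceil>real (?v ^ 2) / b\<rceil> + 1"]
    unfolding Q_def b_eq not_all not_imp not_le by blast
  have "verts G \<noteq> {}" using G(2) by auto
  then have host: "host \<epsilon> G \<kappa>" using G by (simp add: host_def)
  have "2 * b = (\<epsilon> / 2) ^ (C + 1)"
    by (simp add: b_def c_def power_divide)
  also have "\<dots> \<le> (\<epsilon> / 2) ^ C"
    using \<epsilon> by (intro power_decreasing) auto
  finally have "2 * b * real (card (verts G)) ^ ?v \<le> (\<epsilon> / 2) ^ C * real (card (verts G)) ^ ?v"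
    by (rule mult_right_mono) simp
  then have "real (card (lhoms H (\<lambda>v. {\<sigma> v}) G \<kappa>)) \<le> (\<epsilon> / 2) ^ C * real (card (verts G)) ^ ?v"
    using lhoms_le_of_few_embeddings[OF finH host_finite[OF host] b G(2), of "\<lambda>v. {\<sigma> v}" \<kappa>] G(4)
    by (simp add: Emb_col_eq)
  moreover have "host (\<epsilon> / 2) G \<kappa>"
    by (rule host_mono[OF host]) (use \<epsilon> in simp)
  ultimately show "\<exists>\<epsilon>. 0 < \<epsilon> \<and> \<epsilon> \<le> 1 / 2 \<and> (\<exists>(G :: nat hypergraph) \<kappa>. host \<epsilon> G \<kappa> \<and>
     real (card (lhoms H (\<lambda>v. {\<sigma> v}) G \<kappa>)) \<le> \<epsilon> ^ C * real (card (verts G)) ^ ?v)"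
    using \<epsilon> by (intro exI[of _ "\<epsilon> / 2"] conjI exI[of _ G] exI[of _ \<kappa>]) auto
qed

text \<open>Deleting all edges of a maximal family of edge-disjoint copies of \<open>F\<close> destroys all copies.\<close>

lemma far_imp_edge_disjoint_copies:
  assumes G: "r_graph r G" and far: "far r F \<epsilon> G"
  obtains \<C> where "\<C> \<subseteq> embeddings F G" "disjoint_family_on (\<lambda>\<psi>. (\<lambda>e. \<psi> ` e) ` edges F) \<C>"
    "\<epsilon> * real (card (verts G)) ^ r \<le> real (card \<C>) * real (card (edges F))"
proof -
  let ?D = "\<lambda>\<psi>. (\<lambda>e. \<psi> ` e) ` edges F"
  have fin: "finite (embeddings F G)"
    by (rule finite_subset[of _ "verts F \<rightarrow>\<^sub>E verts G"])
       (use r_graph_finite[OF G] in \<open>auto simp: embeddings_def homs_def finite_PiE\<close>)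
  let ?S = "{\<C>. \<C> \<subseteq> embeddings F G \<and> disjoint_family_on ?D \<C>}"
  have "finite ?S" by (rule finite_subset[of _ "Pow (embeddings F G)"]) (use fin in auto)
  moreover have "{} \<in> ?S" by (simp add: disjoint_family_on_def)
  ultimately obtain \<C> where "\<C> \<in> ?S" and max: "\<forall>\<D>\<in>?S. \<C> \<subseteq> \<D> \<longrightarrow> \<C> = \<D>"
    using finite_has_maximal[of ?S] by blast
  then have \<C>: "\<C> \<subseteq> embeddings F G" "disjoint_family_on ?D \<C>" by auto
  have fin\<C>: "finite \<C>" using \<C>(1) fin by (rule finite_subset)
  let ?U = "\<Union>(?D ` \<C>)"
  have sub: "?U \<subseteq> edges G" using \<C>(1) by (auto simp: embeddings_def homs_def)
  have "free_of F (delete_edges G ?U)"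
    unfolding free_of_def
  proof (rule equals0I)
    fix \<chi> assume \<chi>: "\<chi> \<in> embeddings F (delete_edges G ?U)"
    then have mem: "\<chi> \<in> embeddings F G" and disj: "?D \<chi> \<inter> ?U = {}"
      by (auto simp: embeddings_def homs_def delete_edges_def)
    have "\<chi> \<notin> \<C>" using disj edges_F by auto
    then have "insert \<chi> \<C> \<in> ?S"
      using \<C> mem disj by (simp add: disjoint_family_on_insert)
    then have "\<C> = insert \<chi> \<C>" using max by blast
    then show False using \<open>\<chi> \<notin> \<C>\<close> by auto
  qed
  then have "\<epsilon> * real (card (verts G)) ^ r \<le> real (card ?U)"
    using far sub unfolding far_def by blast
  also have "card ?U \<le> (\<Sum>\<psi>\<in>\<C>. card (?D \<psi>))"
    by (rule card_UN_le[OF fin\<C>])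
  also have "\<dots> \<le> (\<Sum>\<psi>\<in>\<C>. card (edges F))"
    using r_graph_finite_edges[OF r_graph_F] by (intro sum_mono card_image_le)
  also have "\<dots> = card \<C> * card (edges F)" by simp
  finally have "\<epsilon> * real (card (verts G)) ^ r \<le> real (card \<C>) * real (card (edges F))"
    by simp
  then show ?thesis by (rule that[OF \<C>])
qed

text \<open>Let \<open>W\<close> maximise the number of copies inside \<open>W\<close> minus \<open>w\<close> times the size of \<open>W\<close>, where
\<open>w = \<delta> * n ^ (r - 1)\<close>. Removing a vertex of \<open>W\<close> does not increase this quantity, so every vertex of \<open>W\<close> lies in at
least \<open>w\<close> of the copies inside \<open>W\<close>. Comparison with the whole vertex set shows that many copies remain,
and since they are edge-disjoint, \<open>W\<close> cannot be small.\<close>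

lemma uniform_subgraph:
  assumes G: "r_graph r G" and \<kappa>: "\<kappa> \<in> homs G F" and pack: "packing G \<kappa> \<C>"
    and \<delta>: "0 < \<delta>" and ne: "verts G \<noteq> {}"
    and many: "2 * \<delta> * real (card (verts G)) ^ r \<le> real (card \<C>)"
  obtains W where "W \<subseteq> verts G" "\<delta> * real (card (verts G)) \<le> real (card W)"
    "host \<delta> (induced G W) (restrict \<kappa> W)"
proof -
  let ?n = "real (card (verts G))"
  let ?\<C> = "\<lambda>W. {\<psi> \<in> \<C>. \<psi> ` verts F \<subseteq> W}"
  define w where "w = \<delta> * ?n ^ (r - 1)"
  define f where "f W = real (card (?\<C> W)) - w * real (card W)" for W
  have finG: "finite (verts G)" by (rule r_graph_finite[OF G])
  have n: "0 < ?n" using ne finG by (simp add: card_gt_0_iff)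
  have w0: "0 < w" using \<delta> n by (simp add: w_def)
  have rS: "?n ^ r = ?n * ?n ^ (r - 1)"
    by (rule power_r)
  have fin\<C>: "finite \<C>" by (rule finite_packing[OF pack finG])
  have "Max (f ` Pow (verts G)) \<in> f ` Pow (verts G)"
    using finG by (intro Max_in) auto
  then obtain W where W: "W \<subseteq> verts G" "f W = Max (f ` Pow (verts G))" by auto
  have max: "f X \<le> f W" if "X \<subseteq> verts G" for X
    unfolding W(2) using that finG by (intro Max_ge) auto
  have finW: "finite W" using W(1) finG by (rule finite_subset)
  have "?\<C> (verts G) = \<C>"
    using packing_section(1)[OF pack] by auto
  then have "f (verts G) = real (card \<C>) - \<delta> * ?n ^ r"
    by (simp add: f_def w_def rS mult_ac)
  then have "\<delta> * ?n ^ r \<le> f W"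
    using many max[of "verts G"] by simp
  then have \<C>W: "\<delta> * ?n ^ r \<le> real (card (?\<C> W))"
    using w0 unfolding f_def by (smt (verit) mult_nonneg_nonneg of_nat_0_le_iff)
  obtain e where e: "e \<in> edges F" using edges_F by auto
  have eF: "e \<subseteq> verts F" "card e = r" "finite e" using r_graph_edge[OF r_graph_F e] by auto
  have "card (?\<C> W) \<le> card (e \<rightarrow>\<^sub>E W)"
  proof (rule card_inj_on_le[where f = "\<lambda>\<psi>. restrict \<psi> e"])
    show "inj_on (\<lambda>\<psi>. restrict \<psi> e) (?\<C> W)"
    proof (rule inj_onI)
      fix \<psi> \<chi> assume *: "\<psi> \<in> ?\<C> W" "\<chi> \<in> ?\<C> W" "restrict \<psi> e = restrict \<chi> e"
      then have "\<psi> ` e = \<chi> ` e" by (metis image_restrict_eq)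
      then show "\<psi> = \<chi>"
        using packing_determined[OF pack _ _ e, of \<psi> \<chi>] *(1,2) by simp
    qed
    show "(\<lambda>\<psi>. restrict \<psi> e) ` ?\<C> W \<subseteq> e \<rightarrow>\<^sub>E W"
    proof (intro image_subsetI PiE_I)
      fix \<psi> a assume "\<psi> \<in> ?\<C> W" "a \<in> e"
      then show "restrict \<psi> e a \<in> W" using eF(1) by auto
    qed auto
    show "finite (e \<rightarrow>\<^sub>E W)" using eF finW by (simp add: finite_PiE)
  qed
  then have "card (?\<C> W) \<le> card W ^ r" using eF by (simp add: card_PiE)
  then have "real (card (?\<C> W)) \<le> real (card W) ^ r" by (simp flip: of_nat_power)
  also have "\<dots> = real (card W) * real (card W) ^ (r - 1)"
    by (rule power_r)
  also have "\<dots> \<le> real (card W) * ?n ^ (r - 1)"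
    using card_mono[OF finG W(1)] by (intro mult_left_mono power_mono) auto
  finally have "(\<delta> * ?n) * ?n ^ (r - 1) \<le> real (card W) * ?n ^ (r - 1)"
    using \<C>W rS by (simp add: mult_ac)
  then have cardW: "\<delta> * ?n \<le> real (card W)"
    by (rule mult_right_le_imp_le) (use n in simp)
  have neW: "W \<noteq> {}" using cardW \<delta> n by (auto simp: mult_le_0_iff)
  have sec: "\<psi> a \<in> verts G" "\<kappa> (\<psi> a) = a" if "\<psi> \<in> \<C>" "a \<in> verts F" for \<psi> a
    using packing_section[OF pack that] by auto
  have packW: "packing (induced G W) (restrict \<kappa> W) (?\<C> W)"
  proof (rule packingI)
    fix \<psi> \<chi> e assume *: "\<psi> \<in> ?\<C> W" "\<chi> \<in> ?\<C> W" "e \<in> edges F" "\<And>a. a \<in> e \<Longrightarrow> \<psi> a = \<chi> a"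
    then have "\<psi> ` e = \<chi> ` e" by (auto intro!: image_cong)
    then show "\<psi> = \<chi>" using packing_determined[OF pack _ _ *(3), of \<psi> \<chi>] *(1,2) by simp
  next
    fix \<psi> e assume *: "\<psi> \<in> ?\<C> W" "e \<in> edges F"
    then show "\<psi> ` e \<in> edges (induced G W)"
      using packing_edge[OF pack, of \<psi> e] r_graph_edge[OF r_graph_F *(2)] by auto
  qed (use sec packing_extensional[OF pack] in auto)
  have hom: "restrict \<kappa> W \<in> homs (induced G W) F"
  proof -
    have "restrict \<kappa> W ` d = \<kappa> ` d" if "d \<subseteq> W" for d
      using that by (auto simp: subset_iff intro!: image_cong)
    then show ?thesis using \<kappa> W(1) by (auto simp: homs_def subset_iff)
  qed
  have "host \<delta> (induced G W) (restrict \<kappa> W)"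
  proof (rule hostI[OF r_graph_induced[OF G W(1)] hom _ packW])
    fix v assume "v \<in> verts (induced G W)"
    then have v: "v \<in> W" by simp
    let ?T = "{\<psi> \<in> ?\<C> W. \<psi> (\<kappa> v) = v}"
    have "?\<C> W \<subseteq> ?\<C> (W - {v}) \<union> ?T"
      using sec(2) by fastforce
    then have "card (?\<C> W) \<le> card (?\<C> (W - {v}) \<union> ?T)"
      using fin\<C> by (intro card_mono) auto
    also have "\<dots> \<le> card (?\<C> (W - {v})) + card ?T" by (rule card_Un_le)
    finally have le: "real (card (?\<C> W)) \<le> real (card (?\<C> (W - {v}))) + real (card ?T)"
      by (simp only: of_nat_add[symmetric] of_nat_le_iff)
    have "card W = Suc (card (W - {v}))" by (rule card.remove[OF finW v])
    then have cW: "w * real (card W) = w * real (card (W - {v})) + w" by (simp add: algebra_simps)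
    have "f (W - {v}) \<le> f W" using W(1) by (intro max) auto
    then have "w \<le> real (card ?T)" using le cW unfolding f_def by linarith
    moreover have "\<delta> * real (card W) ^ (r - 1) \<le> w"
      unfolding w_def using card_mono[OF finG W(1)] \<delta> by (intro mult_left_mono power_mono) auto
    ultimately show "\<delta> * real (card (verts (induced G W))) ^ (r - 1)
        \<le> real (card {\<psi> \<in> ?\<C> W. \<psi> (restrict \<kappa> W v) = v})"
      using v by simp
  qed (use neW in simp)
  then show ?thesis by (rule that[OF W(1) cardW])
qed

text \<open>The constant by which farness drops when a far hypergraph is made uniformly far: \<open>k ^ r\<close> because the
product with \<open>F\<close> has \<open>k * n\<close> vertices, \<open>card (edges F)\<close> from the greedy packing, and \<open>2\<close> from the extremal
subset.\<close>

definition loss :: real where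
  "loss = 2 * real k ^ r * real (card (edges F))"

lemma edges_F_pos: "0 < card (edges F)"
  using edges_F r_graph_finite_edges[OF r_graph_F] by (simp add: card_gt_0_iff)

lemma loss_ge_2: "2 \<le> loss"
proof -
  have "1 \<le> real k ^ r" using k_ge_2 by (intro one_le_power) simp
  moreover have "1 \<le> real (card (edges F))" using edges_F_pos by linarith
  ultimately have "1 * 1 \<le> real k ^ r * real (card (edges F))" by (rule mult_mono) auto
  then show ?thesis by (simp add: loss_def)
qed

text \<open>In the tensor product of \<open>G\<close> with \<open>F\<close>, coloured by the second coordinate, an embedding \<open>\<psi>\<close> of \<open>F\<close> into \<open>G\<close>
becomes the canonical copy \<open>a \<mapsto> (\<psi> a, a)\<close>. This replaces a random \<open>F\<close>-colouring of \<open>G\<close>: all copies become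
canonical, at the cost of constant factors.\<close>

lemma far_imp_host:
  fixes G :: "nat hypergraph" and H :: "'h hypergraph"
  assumes G: "r_graph r G" "verts G \<noteq> {}" and far: "far r F \<epsilon> G" and \<epsilon>: "0 < \<epsilon>"
    and H: "r_graph s H"
  obtains G' :: "nat hypergraph" and \<kappa>' where "host (\<epsilon> / loss) G' \<kappa>'"
    "\<epsilon> / loss * (real k * real (card (verts G))) \<le> real (card (verts G'))"
    "real (card (lhoms H (\<lambda>_. UNIV) G' \<kappa>')) \<le> real (card (lhoms H (\<lambda>_. UNIV) G \<kappa>)) * real k ^ card (verts H)"
proof -
  let ?n = "real (card (verts G))"
  have finG: "finite (verts G)" by (rule r_graph_finite[OF G(1)])
  obtain \<C> where \<C>: "\<C> \<subseteq> embeddings F G" "disjoint_family_on (\<lambda>\<psi>. (\<lambda>e. \<psi> ` e) ` edges F) \<C>"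
    "\<epsilon> * ?n ^ r \<le> real (card \<C>) * real (card (edges F))"
    using far_imp_edge_disjoint_copies[OF G(1) far] by blast
  let ?W = "verts G \<times> verts F"
  define P where "P = tensor r ?W G F"
  define \<pi> where "\<pi> = restrict snd ?W"
  have P: "r_graph r P" unfolding P_def by (rule r_graph_tensor) (use finG in simp)
  have vP: "verts P = ?W" by (simp add: P_def)
  have cardP: "real (card (verts P)) = real k * ?n"
    by (simp add: vP card_cartesian_product)
  have \<pi>: "\<pi> \<in> homs P F"
  proof -
    have "\<pi> ` e = snd ` e" if "e \<subseteq> ?W" for e
      using that by (auto simp: \<pi>_def subset_iff intro!: image_cong)
    then show ?thesis by (auto simp: homs_def P_def \<pi>_def)
  qed
  let ?h = "\<lambda>\<psi>. restrict (\<lambda>a. (\<psi> a, a)) (verts F)"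
  have emb: "\<psi> a \<in> verts G" if "\<psi> \<in> \<C>" "a \<in> verts F" for \<psi> a
    using \<C>(1) that by (auto simp: embeddings_def homs_def)
  have pack: "packing P \<pi> (?h ` \<C>)"
  proof (rule packingI)
    fix \<psi> a assume "\<psi> \<in> ?h ` \<C>" "a \<in> verts F"
    then show "\<psi> a \<in> verts P \<and> \<pi> (\<psi> a) = a" using emb by (auto simp: vP \<pi>_def)
  next
    fix \<psi>' e assume "\<psi>' \<in> ?h ` \<C>" and e: "e \<in> edges F"
    then obtain \<psi> where \<psi>: "\<psi> \<in> \<C>" "\<psi>' = ?h \<psi>" by auto
    have eF: "e \<subseteq> verts F" "card e = r" using r_graph_edge[OF r_graph_F e] by auto
    have img: "\<psi>' ` e = (\<lambda>a. (\<psi> a, a)) ` e"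
      unfolding \<psi>(2) using eF by (intro image_cong) auto
    have "card (\<psi>' ` e) = r"
      unfolding img using eF by (subst card_image) (auto simp: inj_on_def)
    moreover have "fst ` \<psi>' ` e = \<psi> ` e" "snd ` \<psi>' ` e = e"
      unfolding img by (auto simp: image_image)
    moreover have "\<psi> ` e \<in> edges G" using \<psi>(1) \<C>(1) e by (auto simp: embeddings_def homs_def)
    moreover have "\<psi>' ` e \<subseteq> ?W" unfolding img using emb[OF \<psi>(1)] eF by auto
    ultimately show "\<psi>' ` e \<in> edges P" using e by (simp add: P_def)
  next
    fix \<psi>' \<chi>' e assume "\<psi>' \<in> ?h ` \<C>" "\<chi>' \<in> ?h ` \<C>" and e: "e \<in> edges F" and eq: "\<And>a. a \<in> e \<Longrightarrow> \<psi>' a = \<chi>' a"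
    then obtain \<psi> \<chi> where \<psi>: "\<psi> \<in> \<C>" "\<psi>' = ?h \<psi>" "\<chi> \<in> \<C>" "\<chi>' = ?h \<chi>" by auto
    have "\<psi> a = \<chi> a" if "a \<in> e" for a
      using eq[OF that] \<psi> that r_graph_edge[OF r_graph_F e] by auto
    then have img: "\<psi> ` e = \<chi> ` e" by (auto intro!: image_cong)
    have "\<psi> = \<chi>"
    proof (rule ccontr)
      assume "\<psi> \<noteq> \<chi>"
      then have "(\<lambda>e. \<psi> ` e) ` edges F \<inter> (\<lambda>e. \<chi> ` e) ` edges F = {}"
        using disjoint_family_onD[OF \<C>(2) \<psi>(1,3)] by simp
      then show False using img e by blast
    qed
    then show "\<psi>' = \<chi>'" using \<psi> by simp
  qed auto
  have inj: "inj_on ?h \<C>"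
  proof (rule inj_onI)
    fix \<psi> \<chi> assume *: "\<psi> \<in> \<C>" "\<chi> \<in> \<C>" "?h \<psi> = ?h \<chi>"
    have "\<psi> a = \<chi> a" if "a \<in> verts F" for a using fun_cong[OF *(3), of a] that by simp
    moreover have "\<psi> \<in> extensional (verts F)" "\<chi> \<in> extensional (verts F)"
      using *(1,2) \<C>(1) by (auto simp: embeddings_def homs_def PiE_iff)
    ultimately show "\<psi> = \<chi>" by (intro extensionalityI[of _ "verts F"]) auto
  qed
  have loss: "0 < loss" using loss_ge_2 by linarith
  have many: "2 * (\<epsilon> / loss) * real (card (verts P)) ^ r \<le> real (card (?h ` \<C>))"
  proof -
    have "2 * (\<epsilon> / loss) * real (card (verts P)) ^ r = \<epsilon> * ?n ^ r / real (card (edges F))"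
      using verts_F_ne by (simp add: cardP loss_def power_mult_distrib)
    also have "\<dots> \<le> real (card \<C>)"
      using \<C>(3) edges_F_pos by (simp add: divide_le_eq)
    finally show ?thesis by (simp add: card_image[OF inj])
  qed
  obtain W where W: "W \<subseteq> verts P" "\<epsilon> / loss * real (card (verts P)) \<le> real (card W)"
    "host (\<epsilon> / loss) (induced P W) (restrict \<pi> W)"
    by (rule uniform_subgraph[OF P \<pi> pack _ _ many]) (use \<epsilon> loss G(2) verts_F_ne vP in auto)
  obtain f :: "nat \<times> 'f \<Rightarrow> nat" where f: "inj_on f (verts (induced P W))"
    using finite_imp_inj_to_nat_seg[OF host_finite[OF W(3)]] by auto
  show ?thesis
  proof (rule that[OF host_relabel[OF W(3) f]])
    show "\<epsilon> / loss * (real k * ?n) \<le> real (card (verts (relabel f (induced P W))))"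
      using W(2) f by (simp add: cardP card_image)
    have "card (lhoms H (\<lambda>_. UNIV) (relabel f (induced P W)) (relabel_col f (induced P W) (restrict \<pi> W)))
        \<le> card (lhoms H (\<lambda>_. UNIV) (induced P W) (restrict \<pi> W))"
      by (rule card_lhoms_relabel_le[OF H host_r_graph[OF W(3)] f])
    also have "\<dots> \<le> card (lhoms H (\<lambda>_. UNIV) P \<pi>)"
    proof (intro card_mono finite_lhoms subsetI lhomsI conjI UNIV_I)
      fix \<phi> assume \<phi>: "\<phi> \<in> lhoms H (\<lambda>_. UNIV) (induced P W) (restrict \<pi> W)"
      show "\<phi> v \<in> verts P" if "v \<in> verts H" for v
        by (rule subsetD[OF W(1)]) (use \<phi> that in \<open>auto simp: lhoms_def homs_def PiE_iff\<close>)
      show "\<phi> \<in> extensional (verts H)" using \<phi> by (auto simp: lhoms_def homs_def PiE_iff)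
      show "\<phi> ` e \<in> edges P" if "e \<in> edges H" for e
        using \<phi> that by (auto simp: lhoms_def homs_def)
    qed (use r_graph_finite[OF H] r_graph_finite[OF P] in auto)
    also have "\<dots> \<le> card (lhoms H (\<lambda>_. UNIV) G \<kappa>) * card (lhoms H (\<lambda>_. UNIV) F id)"
      unfolding P_def by (rule card_lhoms_tensor_le[OF H finG finite_F]) auto
    also have "\<dots> \<le> card (lhoms H (\<lambda>_. UNIV) G \<kappa>) * k ^ card (verts H)"
      using card_lhoms_le[OF r_graph_finite[OF H] finite_F] by (intro mult_left_mono) auto
    finally show "real (card (lhoms H (\<lambda>_. UNIV) (relabel f (induced P W)) (relabel_col f (induced P W) (restrict \<pi> W))))
        \<le> real (card (lhoms H (\<lambda>_. UNIV) G \<kappa>)) * real k ^ card (verts H)"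
      by (simp flip: of_nat_mult of_nat_power)
  qed
qed

text \<open>Compared with \<open>C\<close>, the exponent \<open>D\<close> contains \<open>card (verts H)\<close> extra, because the uniformly far hypergraph may
have fewer vertices than \<open>G\<close> by a factor of order \<open>\<epsilon>\<close>.\<close>

lemma suppressible_if_not_abundant:
  assumes H: "r_graph r H" and non: "\<not> abundant r F H"
  shows "suppressible H (\<lambda>_. UNIV)"
  unfolding suppressible_def
proof
  fix C :: nat
  let ?v = "card (verts H)"
  define D where "D = C + ?v + 1"
  define c :: real where "c = 1 / (2 * loss ^ D)"
  have loss: "0 < loss" using loss_ge_2 by linarith
  have "0 < c" "0 < real D" using loss by (simp_all add: c_def D_def)
  define Q where "Q \<epsilon> n\<^sub>0 \<longleftrightarrow> (\<forall>G :: nat hypergraph.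
      r_graph r G \<and> card (verts G) \<ge> n\<^sub>0 \<and> far r F \<epsilon> G \<longrightarrow>
      real (Emb H G) \<ge> c * \<epsilon> powr real D * real (card (verts G)) ^ ?v)" for \<epsilon> n\<^sub>0
  have "\<not> (\<forall>\<epsilon>. 0 < \<epsilon> \<and> \<epsilon> \<le> 1 \<longrightarrow> (\<exists>n\<^sub>0. Q \<epsilon> n\<^sub>0))"
    using non \<open>0 < c\<close> \<open>0 < real D\<close> unfolding abundant_def Q_def by blast
  then obtain \<epsilon> where \<epsilon>: "0 < \<epsilon>" "\<epsilon> \<le> 1" and bad: "\<not> Q \<epsilon> n\<^sub>0" for n\<^sub>0
    by blast
  define b where "b = c * \<epsilon> ^ D"
  have b: "0 < b" using \<epsilon> loss by (simp add: b_def c_def)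
  have b_eq: "c * \<epsilon> powr real D = b"
    unfolding b_def using \<epsilon> by (subst powr_realpow) auto
  obtain G where G: "r_graph r (G :: nat hypergraph)"
      "nat \<lceil>real (?v ^ 2) / b\<rceil> + 1 \<le> card (verts G)" "far r F \<epsilon> G"
      "real (Emb H G) < b * real (card (verts G)) ^ ?v"
    using bad[of "nat \<lceil>real (?v ^ 2) / b\<rceil> + 1"]
    unfolding Q_def b_eq not_all not_imp not_le by blast
  define \<kappa> :: "nat \<Rightarrow> 'f" where "\<kappa> = undefined"
  define \<delta> where "\<delta> = \<epsilon> / loss"
  have \<delta>: "0 < \<delta>" "\<delta> \<le> 1 / 2"
    using \<epsilon> loss_ge_2 by (auto simp: \<delta>_def field_simps)
  have ne: "verts G \<noteq> {}" using G(2) by auto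
  obtain G' \<kappa>' where G': "host \<delta> (G' :: nat hypergraph) \<kappa>'"
    "\<delta> * (real k * real (card (verts G))) \<le> real (card (verts G'))"
    "real (card (lhoms H (\<lambda>_. UNIV) G' \<kappa>')) \<le> real (card (lhoms H (\<lambda>_. UNIV) G \<kappa>)) * real k ^ ?v"
    unfolding \<delta>_def by (rule far_imp_host[OF G(1) ne G(3) \<epsilon>(1) H, of \<kappa>])
  have "real (card (lhoms H (\<lambda>_. UNIV) G \<kappa>)) \<le> 2 * b * real (card (verts G)) ^ ?v"
    using lhoms_le_of_few_embeddings[OF r_graph_finite[OF H] r_graph_finite[OF G(1)] b G(2), of "\<lambda>_. UNIV" \<kappa>] G(4)
    by (simp add: Emb_eq[of H G \<kappa>])
  also have "2 * b = \<delta> ^ (C + 1 + ?v)"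
    using loss by (simp add: b_def c_def D_def \<delta>_def power_divide add_ac)
  finally have "real (card (lhoms H (\<lambda>_. UNIV) G \<kappa>)) * real k ^ ?v
      \<le> \<delta> ^ (C + 1 + ?v) * real (card (verts G)) ^ ?v * real k ^ ?v"
    by (rule mult_right_mono) simp
  then have "real (card (lhoms H (\<lambda>_. UNIV) G' \<kappa>')) \<le> \<delta> ^ (C + 1 + ?v) * (real k ^ ?v * real (card (verts G)) ^ ?v)"
    using order.trans[OF G'(3)] by (simp add: mult_ac)
  then have "real (card (lhoms H (\<lambda>_. UNIV) G' \<kappa>')) \<le> \<delta> ^ (C + 1) * real (card (verts G')) ^ ?v"
    by (rule power_rescale) (use \<delta> G'(2) in \<open>auto simp: mult_ac\<close>)
  also have "\<dots> \<le> \<delta> ^ C * real (card (verts G')) ^ ?v"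
    using \<delta> by (intro mult_right_mono power_decreasing) auto
  finally show "\<exists>\<epsilon>. 0 < \<epsilon> \<and> \<epsilon> \<le> 1 / 2 \<and> (\<exists>(G :: nat hypergraph) \<kappa>. host \<epsilon> G \<kappa> \<and>
     real (card (lhoms H (\<lambda>_. UNIV) G \<kappa>)) \<le> \<epsilon> ^ C * real (card (verts G)) ^ ?v)"
    using \<delta> G'(1) by blast
qed

section \<open>Abundant families have abundant members\<close>

text \<open>Double counting incidences gives at least \<open>\<epsilon> / k * n ^ r\<close> edge-disjoint copies, and each of them has to
lose an edge of its own.\<close>

lemma host_imp_far:
  assumes host: "host \<epsilon> G \<kappa>"
  shows "far r F (\<epsilon> / real k) G"
  unfolding far_def
proof (intro allI impI)
  fix D assume D: "D \<subseteq> edges G" and free: "free_of F (delete_edges G D)"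
  let ?n = "real (card (verts G))"
  have finD: "finite D" using D r_graph_finite_edges[OF host_r_graph[OF host]] by (rule finite_subset)
  obtain \<C> where \<C>: "packing G \<kappa> \<C>"
    "\<forall>v\<in>verts G. \<epsilon> * ?n ^ (r - 1) \<le> real (card {\<psi> \<in> \<C>. \<psi> (\<kappa> v) = v})"
    using host_packing[OF host] by blast
  have fin\<C>: "finite \<C>" by (rule finite_packing[OF \<C>(1) host_finite[OF host]])
  have "\<exists>e\<in>edges F. \<psi> ` e \<in> D" if "\<psi> \<in> \<C>" for \<psi>
  proof (rule ccontr)
    assume "\<not> (\<exists>e\<in>edges F. \<psi> ` e \<in> D)"
    moreover have "\<psi> \<in> embeddings F G" using \<C>(1) that by (auto simp: packing_def)
    ultimately have "\<psi> \<in> embeddings F (delete_edges G D)"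
      by (auto simp: embeddings_def homs_def delete_edges_def)
    then show False using free by (auto simp: free_of_def)
  qed
  then obtain e where e: "\<And>\<psi>. \<psi> \<in> \<C> \<Longrightarrow> e \<psi> \<in> edges F \<and> \<psi> ` e \<psi> \<in> D" by metis
  have "card \<C> \<le> card D"
  proof (rule card_inj_on_le[OF _ _ finD, where f = "\<lambda>\<psi>. \<psi> ` e \<psi>"])
    show "inj_on (\<lambda>\<psi>. \<psi> ` e \<psi>) \<C>"
    proof (rule inj_onI, rule ccontr)
      fix \<psi> \<chi> assume *: "\<psi> \<in> \<C>" "\<chi> \<in> \<C>" "\<psi> ` e \<psi> = \<chi> ` e \<chi>" "\<psi> \<noteq> \<chi>"
      have "disjoint_family_on (\<lambda>\<psi>. (\<lambda>e. \<psi> ` e) ` edges F) \<C>" using \<C>(1) by (simp add: packing_def)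
      then have "(\<lambda>e. \<psi> ` e) ` edges F \<inter> (\<lambda>e. \<chi> ` e) ` edges F = {}"
        by (rule disjoint_family_onD[OF _ *(1,2,4)])
      moreover have "\<psi> ` e \<psi> \<in> (\<lambda>e. \<psi> ` e) ` edges F" using e[OF *(1)] by blast
      moreover have "\<psi> ` e \<psi> \<in> (\<lambda>e. \<chi> ` e) ` edges F" unfolding *(3) using e[OF *(2)] by blast
      ultimately show False by blast
    qed
  qed (use e in auto)
  have "real (card (verts G)) * (\<epsilon> * ?n ^ (r - 1)) \<le> (\<Sum>v\<in>verts G. real (card {\<psi> \<in> \<C>. \<psi> (\<kappa> v) = v}))"
    using \<C>(2) by (intro sum_bounded_below) auto
  also have "\<dots> = real (card (SIGMA v:verts G. {\<psi> \<in> \<C>. \<psi> (\<kappa> v) = v}))"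
    using host_finite[OF host] fin\<C> by (subst card_SigmaI) auto
  also have "card (SIGMA v:verts G. {\<psi> \<in> \<C>. \<psi> (\<kappa> v) = v}) \<le> card (\<C> \<times> verts F)"
  proof (rule card_inj_on_le[where f = "\<lambda>(v, \<psi>). (\<psi>, \<kappa> v)"])
    show "inj_on (\<lambda>(v, \<psi>). (\<psi>, \<kappa> v)) (SIGMA v:verts G. {\<psi> \<in> \<C>. \<psi> (\<kappa> v) = v})"
      by (rule inj_on_inverseI[where g = "\<lambda>(\<psi>, a). (\<psi> a, \<psi>)"]) auto
  qed (use host_col[OF host] fin\<C> in auto)
  also have "real (card (\<C> \<times> verts F)) \<le> real (card D) * real k"
    using \<open>card \<C> \<le> card D\<close> by (simp add: card_cartesian_product mult_right_mono)
  finally have "?n * (\<epsilon> * ?n ^ (r - 1)) \<le> real (card D) * real k" by simp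
  moreover have "?n ^ r = ?n * ?n ^ (r - 1)"
    by (rule power_r)
  ultimately have "\<epsilon> * ?n ^ r \<le> real (card D) * real k" by (simp add: mult_ac)
  then show "\<epsilon> / real k * ?n ^ r \<le> real (card D)"
    using k_ge_2 by (simp add: divide_le_eq)
qed

lemma abundant_family_col_has_member:
  fixes \<H> :: "('h hypergraph \<times> ('h \<Rightarrow> 'f)) set"
  assumes \<H>: "\<And>H \<sigma>. (H, \<sigma>) \<in> \<H> \<Longrightarrow> coloured_r_graph r F H \<sigma>" and ab: "abundant_family_col r F \<H>"
  shows "\<exists>(H, \<sigma>)\<in>\<H>. abundant_col r F H \<sigma>"
proof (rule ccontr)
  assume no: "\<not> ?thesis"
  obtain c C where c: "c > 0" "\<forall>\<epsilon>. 0 < \<epsilon> \<and> \<epsilon> \<le> 1 \<longrightarrow> (\<exists>n\<^sub>0. \<forall>(G :: nat hypergraph) \<kappa>.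
      coloured_r_graph r F G \<kappa> \<and> card (verts G) \<ge> n\<^sub>0 \<and> uniformly_far r F \<epsilon> G \<kappa> \<longrightarrow>
      (\<exists>(H, \<sigma>)\<in>\<H>. real (Emb_col H \<sigma> G \<kappa>) \<ge> c * \<epsilon> powr C * real (card (verts G)) ^ card (verts H)))"
    using ab unfolding abundant_family_col_def by blast
  define m where "m = nat \<lceil>C\<rceil>"
  define \<L> where "\<L> = (\<lambda>(H, \<sigma>). (H, \<lambda>v. {\<sigma> v})) ` \<H>"
  have \<L>: "r_graph r H \<and> (\<forall>v\<in>verts H. L v \<inter> verts F \<noteq> {}) \<and> suppressible H L" if "(H, L) \<in> \<L>" for H L
  proof -
    from that obtain \<sigma> where \<sigma>: "(H, \<sigma>) \<in> \<H>" "L = (\<lambda>v. {\<sigma> v})" by (auto simp: \<L>_def)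
    have "\<not> abundant_col r F H \<sigma>" using no \<sigma>(1) by blast
    then show ?thesis
      using suppressible_if_not_abundant_col[OF \<H>[OF \<sigma>(1)]] \<H>[OF \<sigma>(1)] \<sigma>(2)
      by (auto simp: coloured_r_graph_def homs_def)
  qed
  obtain \<epsilon> where \<epsilon>: "0 < \<epsilon>" "\<epsilon> \<le> 1" "\<forall>n\<^sub>0. \<exists>(G :: nat hypergraph) \<kappa>. host \<epsilon> G \<kappa> \<and> n\<^sub>0 \<le> card (verts G) \<and>
     (\<forall>(H, L)\<in>\<L>. real (card (lhoms H L G \<kappa>)) < c * \<epsilon> ^ m * real (card (verts G)) ^ card (verts H))"
    using common_sparse_host[OF \<L> c(1), of \<L> m] by blast
  obtain n\<^sub>0 where n0: "\<forall>(G :: nat hypergraph) \<kappa>.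
      coloured_r_graph r F G \<kappa> \<and> card (verts G) \<ge> n\<^sub>0 \<and> uniformly_far r F \<epsilon> G \<kappa> \<longrightarrow>
      (\<exists>(H, \<sigma>)\<in>\<H>. real (Emb_col H \<sigma> G \<kappa>) \<ge> c * \<epsilon> powr C * real (card (verts G)) ^ card (verts H))"
    using c(2) \<epsilon>(1,2) by blast
  obtain G \<kappa> where G: "host \<epsilon> (G :: nat hypergraph) \<kappa>" "n\<^sub>0 \<le> card (verts G)"
     "\<forall>(H, L)\<in>\<L>. real (card (lhoms H L G \<kappa>)) < c * \<epsilon> ^ m * real (card (verts G)) ^ card (verts H)"
    using \<epsilon>(3) by blast
  then obtain H \<sigma> where H: "(H, \<sigma>) \<in> \<H>"
    "real (Emb_col H \<sigma> G \<kappa>) \<ge> c * \<epsilon> powr C * real (card (verts G)) ^ card (verts H)"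
    using n0 unfolding host_def by blast
  have finH: "finite (verts H)" using \<H>[OF H(1)] by (auto simp: coloured_r_graph_def)
  have "(H, \<lambda>v. {\<sigma> v}) \<in> \<L>" using H(1) by (force simp: \<L>_def)
  then have "real (card (lhoms H (\<lambda>v. {\<sigma> v}) G \<kappa>)) < c * \<epsilon> ^ m * real (card (verts G)) ^ card (verts H)"
    using G(3) by blast
  also have "\<dots> \<le> c * \<epsilon> powr C * real (card (verts G)) ^ card (verts H)"
    unfolding m_def using powr_ge_power[OF \<epsilon>(1,2), of C] c(1) by (intro mult_right_mono mult_left_mono) auto
  also have "\<dots> \<le> real (Emb_col H \<sigma> G \<kappa>)" by (rule H(2))
  also have "\<dots> \<le> real (card (lhoms H (\<lambda>v. {\<sigma> v}) G \<kappa>))"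
    unfolding Emb_col_eq using finH host_finite[OF G(1)] by (intro of_nat_mono card_mono) auto
  finally show False by simp
qed

text \<open>A host at \<open>\<epsilon>\<close> is only known to be \<open>\<epsilon> / k\<close>-far in the uncoloured sense; the factor \<open>k ^ m\<close> is paid for in
advance by the constant given to \<open>common_sparse_host\<close>.\<close>

lemma abundant_family_has_member:
  fixes \<U> :: "'h hypergraph set"
  assumes \<U>: "\<And>H. H \<in> \<U> \<Longrightarrow> r_graph r H" and ab: "abundant_family r F \<U>"
  shows "\<exists>H\<in>\<U>. abundant r F H"
proof (rule ccontr)
  assume no: "\<not> ?thesis"
  obtain c C where c: "c > 0" "\<forall>\<epsilon>. 0 < \<epsilon> \<and> \<epsilon> \<le> 1 \<longrightarrow> (\<exists>n\<^sub>0. \<forall>G :: nat hypergraph.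
      r_graph r G \<and> card (verts G) \<ge> n\<^sub>0 \<and> far r F \<epsilon> G \<longrightarrow>
      (\<exists>H\<in>\<U>. real (Emb H G) \<ge> c * \<epsilon> powr C * real (card (verts G)) ^ card (verts H)))"
    using ab unfolding abundant_family_def by blast
  define m where "m = nat \<lceil>C\<rceil>"
  define \<L> :: "('h hypergraph \<times> ('h \<Rightarrow> 'f set)) set" where "\<L> = (\<lambda>H. (H, \<lambda>_. UNIV)) ` \<U>"
  have \<L>: "r_graph r H \<and> (\<forall>v\<in>verts H. L v \<inter> verts F \<noteq> {}) \<and> suppressible H L" if "(H, L) \<in> \<L>" for H L
  proof -
    have H: "H \<in> \<U>" "L = (\<lambda>_. UNIV)" using that by (auto simp: \<L>_def)
    have "\<not> abundant r F H" using no H(1) by blast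
    then show ?thesis
      using suppressible_if_not_abundant[OF \<U>[OF H(1)]] \<U>[OF H(1)] H(2) verts_F_ne by simp
  qed
  have k1: "1 \<le> real k" and k0: "0 < real k" using k_ge_2 by linarith+
  have c': "0 < c / real k ^ m" using c(1) k0 by simp
  obtain \<epsilon> where \<epsilon>: "0 < \<epsilon>" "\<epsilon> \<le> 1" "\<forall>n\<^sub>0. \<exists>(G :: nat hypergraph) \<kappa>. host \<epsilon> G \<kappa> \<and> n\<^sub>0 \<le> card (verts G) \<and>
     (\<forall>(H, L)\<in>\<L>. real (card (lhoms H L G \<kappa>)) < c / real k ^ m * \<epsilon> ^ m * real (card (verts G)) ^ card (verts H))"
    using common_sparse_host[OF \<L> c', of \<L> m] by blast
  define \<delta> where "\<delta> = \<epsilon> / real k"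
  have \<delta>: "0 < \<delta>" "\<delta> \<le> 1" using \<epsilon>(1,2) k1 k0 by (auto simp: \<delta>_def divide_le_eq)
  obtain n\<^sub>0 where n0: "\<forall>G :: nat hypergraph. r_graph r G \<and> card (verts G) \<ge> n\<^sub>0 \<and> far r F \<delta> G \<longrightarrow>
      (\<exists>H\<in>\<U>. real (Emb H G) \<ge> c * \<delta> powr C * real (card (verts G)) ^ card (verts H))"
    using c(2) \<delta> by blast
  obtain G \<kappa> where G: "host \<epsilon> (G :: nat hypergraph) \<kappa>" "n\<^sub>0 \<le> card (verts G)"
     "\<forall>(H, L)\<in>\<L>. real (card (lhoms H L G \<kappa>)) < c / real k ^ m * \<epsilon> ^ m * real (card (verts G)) ^ card (verts H)"
    using \<epsilon>(3) by blast
  obtain H where H: "H \<in> \<U>"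
    "real (Emb H G) \<ge> c * \<delta> powr C * real (card (verts G)) ^ card (verts H)"
    using n0 host_r_graph[OF G(1)] G(2) host_imp_far[OF G(1)] unfolding \<delta>_def by blast
  have "(H, \<lambda>_. UNIV) \<in> \<L>" using H(1) by (simp add: \<L>_def)
  then have "real (card (lhoms H (\<lambda>_. UNIV) G \<kappa>)) < c / real k ^ m * \<epsilon> ^ m * real (card (verts G)) ^ card (verts H)"
    using G(3) by blast
  also have "c / real k ^ m * \<epsilon> ^ m = c * \<delta> ^ m" by (simp add: \<delta>_def power_divide)
  also have "c * \<delta> ^ m * real (card (verts G)) ^ card (verts H) \<le> c * \<delta> powr C * real (card (verts G)) ^ card (verts H)"
    unfolding m_def using powr_ge_power[OF \<delta>, of C] c(1) by (intro mult_right_mono mult_left_mono) auto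
  also have "\<dots> \<le> real (Emb H G)" by (rule H(2))
  also have "\<dots> \<le> real (card (lhoms H (\<lambda>_. UNIV) G \<kappa>))"
    unfolding Emb_eq[of H G \<kappa>] using r_graph_finite[OF \<U>[OF H(1)]] host_finite[OF G(1)]
    by (intro of_nat_mono card_mono) auto
  finally show False by simp
qed

end

lemma abundant_family_col_if_member:
  assumes mem: "(H, \<sigma>) \<in> \<H>" and ab: "abundant_col r F H \<sigma>"
  shows "abundant_family_col r F \<H>"
proof -
  obtain c C where c: "c > 0" "C > 0" and far: "\<And>\<epsilon>. 0 < \<epsilon> \<and> \<epsilon> \<le> 1 \<Longrightarrow>
      \<exists>n\<^sub>0. \<forall>(G :: nat hypergraph) \<kappa>. coloured_r_graph r F G \<kappa> \<and> card (verts G) \<ge> n\<^sub>0 \<and> uniformly_far r F \<epsilon> G \<kappa> \<longrightarrow>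
        real (Emb_col H \<sigma> G \<kappa>) \<ge> c * \<epsilon> powr C * real (card (verts G)) ^ card (verts H)"
    using ab unfolding abundant_col_def by blast
  show ?thesis
    unfolding abundant_family_col_def
  proof (rule exI[of _ c], rule conjI[OF c(1)], rule exI[of _ C], rule conjI[OF c(2)], intro allI impI)
    fix \<epsilon> :: real assume "0 < \<epsilon> \<and> \<epsilon> \<le> 1"
    from far[OF this] obtain n\<^sub>0 where n0: "\<forall>(G :: nat hypergraph) \<kappa>.
        coloured_r_graph r F G \<kappa> \<and> card (verts G) \<ge> n\<^sub>0 \<and> uniformly_far r F \<epsilon> G \<kappa> \<longrightarrow>
        real (Emb_col H \<sigma> G \<kappa>) \<ge> c * \<epsilon> powr C * real (card (verts G)) ^ card (verts H)" ..
    show "\<exists>n\<^sub>0. \<forall>(G :: nat hypergraph) \<kappa>.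
        coloured_r_graph r F G \<kappa> \<and> card (verts G) \<ge> n\<^sub>0 \<and> uniformly_far r F \<epsilon> G \<kappa> \<longrightarrow>
        (\<exists>(H, \<sigma>)\<in>\<H>. real (Emb_col H \<sigma> G \<kappa>) \<ge> c * \<epsilon> powr C * real (card (verts G)) ^ card (verts H))"
      by (intro exI[of _ n\<^sub>0] allI impI bexI[OF _ mem]) (use n0 in simp)
  qed
qed

lemma abundant_family_if_member:
  assumes mem: "H \<in> \<U>" and ab: "abundant r F H"
  shows "abundant_family r F \<U>"
proof -
  obtain c C where c: "c > 0" "C > 0" and far: "\<And>\<epsilon>. 0 < \<epsilon> \<and> \<epsilon> \<le> 1 \<Longrightarrow>
      \<exists>n\<^sub>0. \<forall>G :: nat hypergraph. r_graph r G \<and> card (verts G) \<ge> n\<^sub>0 \<and> far r F \<epsilon> G \<longrightarrow>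
        real (Emb H G) \<ge> c * \<epsilon> powr C * real (card (verts G)) ^ card (verts H)"
    using ab unfolding abundant_def by blast
  show ?thesis
    unfolding abundant_family_def
  proof (rule exI[of _ c], rule conjI[OF c(1)], rule exI[of _ C], rule conjI[OF c(2)], intro allI impI)
    fix \<epsilon> :: real assume "0 < \<epsilon> \<and> \<epsilon> \<le> 1"
    from far[OF this] obtain n\<^sub>0 where n0: "\<forall>G :: nat hypergraph.
        r_graph r G \<and> card (verts G) \<ge> n\<^sub>0 \<and> far r F \<epsilon> G \<longrightarrow>
        real (Emb H G) \<ge> c * \<epsilon> powr C * real (card (verts G)) ^ card (verts H)" ..
    show "\<exists>n\<^sub>0. \<forall>G :: nat hypergraph. r_graph r G \<and> card (verts G) \<ge> n\<^sub>0 \<and> far r F \<epsilon> G \<longrightarrow>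
        (\<exists>H\<in>\<U>. real (Emb H G) \<ge> c * \<epsilon> powr C * real (card (verts G)) ^ card (verts H))"
      by (intro exI[of _ n\<^sub>0] allI impI bexI[OF _ mem]) (use n0 in simp)
  qed
qed

theorem theorem1p3:
  fixes r :: nat and F :: "'f hypergraph"
  assumes "r \<ge> 2"
    and "r_graph r F"
    and "card (edges F) > 0"
    and "\<nexists>v. isolated F v"
  shows "(\<forall>\<H> :: ('h hypergraph \<times> ('h \<Rightarrow> 'f)) set.
            (\<forall>(H, \<sigma>)\<in>\<H>. coloured_r_graph r F H \<sigma>) \<longrightarrow>
            (abundant_family_col r F \<H> \<longleftrightarrow> (\<exists>(H, \<sigma>)\<in>\<H>. abundant_col r F H \<sigma>)))
       \<and> (\<forall>\<U> :: 'h hypergraph set.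
            (\<forall>H\<in>\<U>. r_graph r H) \<longrightarrow>
            (abundant_family r F \<U> \<longleftrightarrow> (\<exists>H\<in>\<U>. abundant r F H)))"
proof -
  interpret covered_r_graph r F
  proof
    show "edges F \<noteq> {}" using assms(3) by auto
    show "\<exists>e\<in>edges F. a \<in> e" if "a \<in> verts F" for a
      using assms(4) that unfolding isolated_def by blast
  qed (rule assms(1,2))+
  show ?thesis
  proof (intro conjI allI impI iffI)
    fix \<H> :: "('h hypergraph \<times> ('h \<Rightarrow> 'f)) set"
    assume "\<forall>(H, \<sigma>)\<in>\<H>. coloured_r_graph r F H \<sigma>" "abundant_family_col r F \<H>"
    then show "\<exists>(H, \<sigma>)\<in>\<H>. abundant_col r F H \<sigma>"
      by (intro abundant_family_col_has_member) auto
  next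
    fix \<H> :: "('h hypergraph \<times> ('h \<Rightarrow> 'f)) set"
    assume "\<exists>(H, \<sigma>)\<in>\<H>. abundant_col r F H \<sigma>"
    then show "abundant_family_col r F \<H>"
      using abundant_family_col_if_member by fast
  next
    fix \<U> :: "'h hypergraph set"
    assume "\<forall>H\<in>\<U>. r_graph r H" "abundant_family r F \<U>"
    then show "\<exists>H\<in>\<U>. abundant r F H"
      by (intro abundant_family_has_member) auto
  next
    fix \<U> :: "'h hypergraph set"
    assume "\<exists>H\<in>\<U>. abundant r F H"
    then show "abundant_family r F \<U>"
      using abundant_family_if_member by blast
  qed
qed

end
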